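(* For $t\in\mathbb{R}$ let $V_t(x,y,z)=(x^4+tx^2+y^2+z^2)^2$ on $\mathbb{R}^3$. (a) If $t>0$, the oscillation index of $V_t$ at the origin is $\frac34$. (b) The oscillation index of $V_0$ at the origin is $\frac58$. (c) If $t<0$, the oscillation index of $V_t$ at the origin is $\frac12$.
   Context: Oscillation index (also called oscillatory index): for a real-analytic $S$ near $0\in\mathbb{R}^n$ with $S(0)=0$ and smooth real-valued $\phi$ supported in a sufficiently small neighborhood of $0$, the integral $J_{S,\phi}(\lambda)=\int_{\mathbb{R}^n}e^{i\lambda S(x)}\phi(x)\,dx$ has an asymptotic expansion $\sum_{j\ge0}\sum_{i=0}^{n-1}d_{ij}(\phi)(\ln\lambda)^i\lambda^{-s_j}$ as $\lambda\to+\infty$, with $\{s_j\}$ an increasing arithmetic progression of positive rationals independent of $\phi$. The oscillation index of $S$ at the origin is the minimal $s_j$ such that for every sufficiently small neighborhood $V$ of the origin $d_{ij}(\phi)\neq0$ for some $i$ and some $\phi$ supported in $V$. *)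

theory Defs
  imports "HOL-Analysis.Analysis" "HOL-Library.Landau_Symbols"
begin

primrec Ck :: "nat \<Rightarrow> ('a::euclidean_space \<Rightarrow> real) \<Rightarrow> bool" where
  "Ck 0 f \<longleftrightarrow> continuous_on UNIV f"
| "Ck (Suc k) f \<longleftrightarrow> f differentiable_on UNIV \<and>
     (\<forall>b\<in>Basis. Ck k (\<lambda>x. frechet_derivative f (at x) b))"

definition smooth :: "('a::euclidean_space \<Rightarrow> real) \<Rightarrow> bool" where
  "smooth f \<longleftrightarrow> (\<forall>k. Ck k f)"

definition test_function :: "'a::euclidean_space set \<Rightarrow> ('a \<Rightarrow> real) \<Rightarrow> bool" where
  "test_function V \<phi> \<longleftrightarrow> smooth \<phi> \<and>
     compact (closure {x. \<phi> x \<noteq> 0}) \<and> closure {x. \<phi> x \<noteq> 0} \<subseteq> V"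

definition osc_integral :: "('a::euclidean_space \<Rightarrow> real) \<Rightarrow> ('a \<Rightarrow> real) \<Rightarrow> real \<Rightarrow> complex" where
  "osc_integral S \<phi> \<Lambda> =
     (LINT x|lborel. exp (\<i> * complex_of_real (\<Lambda> * S x)) * complex_of_real (\<phi> x))"

(* The asymptotic series is meant in the sense of Poincare. The error after the block of index N
   is required to be o(\<Lambda> powr - s N); since the whole block of index N + 1 is itself
   of that order, for all N together this is the same as stopping the double series at any term.
   The exponents s and the neighbourhood U are uniform in \<phi>. *)
definition osc_expansion ::
  "('a::euclidean_space \<Rightarrow> real) \<Rightarrow> 'a set \<Rightarrow> (nat \<Rightarrow> real) \<Rightarrow>
   (nat \<Rightarrow> nat \<Rightarrow> ('a \<Rightarrow> real) \<Rightarrow> complex) \<Rightarrow> bool" where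
  "osc_expansion S U s d \<longleftrightarrow>
     open U \<and> 0 \<in> U \<and>
     (\<exists>a q. a \<in> \<rat> \<and> q \<in> \<rat> \<and> 0 < a \<and> 0 < q \<and> (\<forall>j. s j = a + real j * q)) \<and>
     (\<forall>\<phi>. test_function U \<phi> \<longrightarrow>
       (\<forall>N. (\<lambda>\<Lambda>. osc_integral S \<phi> \<Lambda> -
               (\<Sum>j\<le>N. \<Sum>i<DIM('a). d i j \<phi> * complex_of_real (ln \<Lambda> ^ i * \<Lambda> powr - s j)))
             \<in> o[at_top](\<lambda>\<Lambda>. complex_of_real (\<Lambda> powr - s N))))"

definition contributes ::
  "(nat \<Rightarrow> nat \<Rightarrow> ('a::euclidean_space \<Rightarrow> real) \<Rightarrow> complex) \<Rightarrow> nat \<Rightarrow> bool" where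
  "contributes d j \<longleftrightarrow>
     (\<exists>W. open W \<and> 0 \<in> W \<and>
       (\<forall>V. open V \<and> 0 \<in> V \<and> V \<subseteq> W \<longrightarrow>
         (\<exists>i<DIM('a). \<exists>\<phi>. test_function V \<phi> \<and> d i j \<phi> \<noteq> 0)))"

(* A relation rather than a function, so that an index is only assigned when the expansion exists
   (as it does for every real-analytic S near 0 with S 0 = 0) and some term contributes.
   The value does not depend on the chosen expansion: see has_oscillation_index_unique. *)
definition has_oscillation_index ::
  "('a::euclidean_space \<Rightarrow> real) \<Rightarrow> real \<Rightarrow> bool"
  (infixr "has'_oscillation'_index" 46) where
  "(S has_oscillation_index \<beta>) \<longleftrightarrow>
     (\<exists>U s d. osc_expansion S U s d \<and>
       (\<exists>j. s j = \<beta> \<and> contributes d j \<and> (\<forall>k. contributes d k \<longrightarrow> s j \<le> s k)))"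

definition Vt :: "real \<Rightarrow> real ^ 3 \<Rightarrow> real" where
  "Vt t p = ((p $ 1) ^ 4 + t * (p $ 1)\<^sup>2 + (p $ 2)\<^sup>2 + (p $ 3)\<^sup>2)\<^sup>2"

lemma poly_ln_tendsto_0:
  fixes c :: "nat \<Rightarrow> complex"
  assumes "((\<lambda>x::real. \<Sum>i<n. c i * complex_of_real (ln x ^ i)) \<longlongrightarrow> 0) at_top" and "i < n"
  shows "c i = 0"
proof -
  obtain m where n: "n = Suc m" using assms(2) by (cases n) auto
  define p where "p z = (\<Sum>i\<le>m. c i * z ^ i)" for z :: complex
  have "filterlim (\<lambda>x::real. exp x) at_top at_top" by (rule exp_at_top)
  from filterlim_compose[OF assms(1) this]
  have lim: "((\<lambda>x::real. p (of_real x)) \<longlongrightarrow> 0) at_top"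
    by (simp add: n p_def lessThan_Suc_atMost)
  have nz: "\<not> (\<exists>k. k \<noteq> 0 \<and> k \<le> m \<and> c k \<noteq> 0)"
  proof
    assume "\<exists>k. k \<noteq> 0 \<and> k \<le> m \<and> c k \<noteq> 0"
    then have "\<forall>\<^sub>F z in at_infinity. 1 \<le> norm (p z)"
      unfolding p_def by (rule Poly_Roots.polyfun_extremal)
    moreover have "filterlim (\<lambda>x::real. complex_of_real x) at_infinity at_top"
      by (rule filterlim_of_real_at_infinity)
    ultimately have "\<forall>\<^sub>F x::real in at_top. 1 \<le> norm (p (of_real x))"
      by (rule eventually_compose_filterlim)
    moreover have "\<forall>\<^sub>F x::real in at_top. norm (p (of_real x)) < 1"
      using tendstoD[OF lim, of 1] by simp
    ultimately have "\<forall>\<^sub>F x::real in at_top. False"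
      by eventually_elim simp
    then show False by simp
  qed
  have "p z = c 0" for z
  proof -
    have "p z = (\<Sum>i\<le>m. if i = 0 then c 0 else 0)"
      unfolding p_def using nz by (intro sum.cong) auto
    then show ?thesis by simp
  qed
  with lim have "c 0 = 0" by (simp add: tendsto_const_iff)
  with nz assms(2) n show ?thesis by (metis less_Suc_eq_le)
qed

lemma osc_leading_block:
  fixes S :: "'a::euclidean_space \<Rightarrow> real"
  assumes "osc_expansion S U s d" "test_function U \<phi>"
    and "\<And>k i. k < j \<Longrightarrow> i < DIM('a) \<Longrightarrow> d i k \<phi> = 0"
  shows "((\<lambda>\<Lambda>. osc_integral S \<phi> \<Lambda> * complex_of_real (\<Lambda> powr s j) -
            (\<Sum>i<DIM('a). d i j \<phi> * complex_of_real (ln \<Lambda> ^ i))) \<longlongrightarrow> 0) at_top"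
proof -
  have eq: "(\<Sum>k\<le>j. \<Sum>i<DIM('a). d i k \<phi> * complex_of_real (ln \<Lambda> ^ i * \<Lambda> powr - s k)) =
      (\<Sum>i<DIM('a). d i j \<phi> * complex_of_real (ln \<Lambda> ^ i * \<Lambda> powr - s j))" for \<Lambda>
    unfolding lessThan_Suc_atMost[symmetric] using assms(3) by simp
  have "(\<lambda>\<Lambda>. osc_integral S \<phi> \<Lambda> -
      (\<Sum>k\<le>j. \<Sum>i<DIM('a). d i k \<phi> * complex_of_real (ln \<Lambda> ^ i * \<Lambda> powr - s k)))
      \<in> o[at_top](\<lambda>\<Lambda>. complex_of_real (\<Lambda> powr - s j))"
    using assms(1,2) unfolding osc_expansion_def by blast
  then have "((\<lambda>\<Lambda>. (osc_integral S \<phi> \<Lambda> -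
      (\<Sum>i<DIM('a). d i j \<phi> * complex_of_real (ln \<Lambda> ^ i * \<Lambda> powr - s j))) /
      complex_of_real (\<Lambda> powr - s j)) \<longlongrightarrow> 0) at_top"
    unfolding eq by (rule smalloD_tendsto)
  moreover have "\<forall>\<^sub>F \<Lambda> in at_top. (osc_integral S \<phi> \<Lambda> -
      (\<Sum>i<DIM('a). d i j \<phi> * complex_of_real (ln \<Lambda> ^ i * \<Lambda> powr - s j))) /
      complex_of_real (\<Lambda> powr - s j) =
      osc_integral S \<phi> \<Lambda> * complex_of_real (\<Lambda> powr s j) -
            (\<Sum>i<DIM('a). d i j \<phi> * complex_of_real (ln \<Lambda> ^ i))"
    using eventually_gt_at_top[of "0::real"]
    by eventually_elim
      (simp add: powr_minus field_simps sum_distrib_left sum_distrib_right sum_divide_distrib)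
  ultimately show ?thesis by (rule Lim_transform_eventually)
qed

lemma has_oscillation_index_le:
  fixes S :: "'a::euclidean_space \<Rightarrow> real"
  assumes "S has_oscillation_index a" "S has_oscillation_index b"
  shows "b \<le> a"
proof (rule ccontr)
  assume "\<not> b \<le> a"
  then have ab: "a < b" by simp
  obtain U s d j where e1: "osc_expansion S U s d" and sj: "s j = a" and cj: "contributes d j"
    using assms(1) unfolding has_oscillation_index_def by blast
  obtain U' s' d' k where e2: "osc_expansion S U' s' d'" and sk: "s' k = b"
    and min: "\<And>l. contributes d' l \<Longrightarrow> s' k \<le> s' l"
    using assms(2) unfolding has_oscillation_index_def by blast
  have mono1: "i \<le> l \<Longrightarrow> s i \<le> s l" for i l
    using e1 unfolding osc_expansion_def by (auto intro!: mult_right_mono)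
  have mono2: "i < l \<Longrightarrow> s' i < s' l" for i l
    using e2 unfolding osc_expansion_def by auto
  obtain W where W: "open W" "0 \<in> W"
    and WV: "\<And>V. open V \<Longrightarrow> 0 \<in> V \<Longrightarrow> V \<subseteq> W \<Longrightarrow>
       \<exists>i<DIM('a). \<exists>\<phi>. test_function V \<phi> \<and> d i j \<phi> \<noteq> 0"
    using cj unfolding contributes_def by metis
  have "\<exists>X. open X \<and> 0 \<in> X \<and>
      \<not> (\<exists>i<DIM('a). \<exists>\<phi>. test_function X \<phi> \<and> d' i l \<phi> \<noteq> 0)" if "l < k" for l
  proof -
    have "\<not> contributes d' l" using min mono2[OF that] by fastforce
    then show ?thesis unfolding contributes_def by (metis UNIV_I open_UNIV)
  qed
  then obtain X where X: "\<And>l. l < k \<Longrightarrow> open (X l) \<and> 0 \<in> X l \<and>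
      \<not> (\<exists>i<DIM('a). \<exists>\<phi>. test_function (X l) \<phi> \<and> d' i l \<phi> \<noteq> 0)"
    by metis
  define Y where "Y = W \<inter> U \<inter> U' \<inter> (\<Inter>l<k. X l)"
  have U: "open U" "0 \<in> U" "open U'" "0 \<in> U'"
    using e1 e2 unfolding osc_expansion_def by blast+
  have "open Y" "0 \<in> Y" "Y \<subseteq> W"
    using W U X by (auto simp: Y_def intro!: open_Int open_INT)
  then obtain i \<phi> where i: "i < DIM('a)" and \<phi>: "test_function Y \<phi>" and nz: "d i j \<phi> \<noteq> 0"
    using WV by blast
  have tf: "test_function Z \<phi>" if "Y \<subseteq> Z" for Z
    using \<phi> that unfolding test_function_def by blast
  define j0 where "j0 = (LEAST l. \<exists>i<DIM('a). d i l \<phi> \<noteq> 0)"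
  have ex: "\<exists>l. \<exists>i<DIM('a). d i l \<phi> \<noteq> 0" using i nz by blast
  obtain i0 where i0: "i0 < DIM('a)" "d i0 j0 \<phi> \<noteq> 0"
    using LeastI_ex[OF ex] unfolding j0_def by blast
  have "j0 \<le> j" unfolding j0_def using i nz by (intro Least_le) blast
  then have a0: "s j0 < b" using mono1[of j0 j] sj ab by simp
  have l1: "((\<lambda>\<Lambda>. osc_integral S \<phi> \<Lambda> * complex_of_real (\<Lambda> powr s j0) -
            (\<Sum>i<DIM('a). d i j0 \<phi> * complex_of_real (ln \<Lambda> ^ i))) \<longlongrightarrow> 0) at_top"
  proof (rule osc_leading_block[OF e1])
    show "test_function U \<phi>" by (rule tf) (auto simp: Y_def)
    show "d i l \<phi> = 0" if "l < j0" "i < DIM('a)" for l i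
      using not_less_Least[OF that(1)[unfolded j0_def]] that(2) by blast
  qed
  have z': "d' i l \<phi> = 0" if "l < k" "i < DIM('a)" for l i
  proof -
    have "test_function (X l) \<phi>" by (rule tf) (use that in \<open>auto simp: Y_def\<close>)
    then show ?thesis using X[OF that(1)] that(2) by blast
  qed
  have l2: "((\<lambda>\<Lambda>. osc_integral S \<phi> \<Lambda> * complex_of_real (\<Lambda> powr b) -
            (\<Sum>i<DIM('a). d' i k \<phi> * complex_of_real (ln \<Lambda> ^ i))) \<longlongrightarrow> 0) at_top"
    unfolding sk[symmetric]
  proof (rule osc_leading_block[OF e2])
    show "test_function U' \<phi>" by (rule tf) (auto simp: Y_def)
  qed (rule z')
  define \<epsilon> where "\<epsilon> = b - s j0"
  have \<epsilon>: "\<epsilon> > 0" using a0 by (simp add: \<epsilon>_def)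
  have t1: "((\<lambda>\<Lambda>::real. complex_of_real (\<Lambda> powr - \<epsilon>)) \<longlongrightarrow> complex_of_real 0) at_top"
    by (intro tendsto_of_real tendsto_neg_powr filterlim_ident) (use \<epsilon> in auto)
  have t2: "((\<lambda>\<Lambda>::real. complex_of_real (ln \<Lambda> ^ i * \<Lambda> powr - \<epsilon>)) \<longlongrightarrow> complex_of_real 0) at_top"
    for i
  proof (rule tendsto_of_real)
    have "filterlim (\<lambda>x::real. \<epsilon> * ln x) at_top at_top"
      by (intro filterlim_tendsto_pos_mult_at_top[OF tendsto_const \<epsilon>] ln_at_top)
    from filterlim_compose[OF tendsto_power_div_exp_0 this]
    have "((\<lambda>x::real. (\<epsilon> * ln x) ^ i / exp (\<epsilon> * ln x) * (1 / \<epsilon> ^ i)) \<longlongrightarrow> 0 * (1 / \<epsilon> ^ i)) at_top"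
      by (intro tendsto_mult tendsto_const)
    moreover have "\<forall>\<^sub>F x::real in at_top.
        (\<epsilon> * ln x) ^ i / exp (\<epsilon> * ln x) * (1 / \<epsilon> ^ i) = ln x ^ i * x powr - \<epsilon>"
      using eventually_gt_at_top[of "0::real"]
      by eventually_elim (use \<epsilon> in \<open>simp add: powr_def power_mult_distrib exp_minus field_simps\<close>)
    ultimately show "((\<lambda>x::real. ln x ^ i * x powr - \<epsilon>) \<longlongrightarrow> 0) at_top"
      by (simp add: Lim_transform_eventually)
  qed
  have "((\<lambda>\<Lambda>. (osc_integral S \<phi> \<Lambda> * complex_of_real (\<Lambda> powr b) -
            (\<Sum>i<DIM('a). d' i k \<phi> * complex_of_real (ln \<Lambda> ^ i))) * complex_of_real (\<Lambda> powr - \<epsilon>)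
       + (\<Sum>i<DIM('a). d' i k \<phi> * complex_of_real (ln \<Lambda> ^ i * \<Lambda> powr - \<epsilon>)))
       \<longlongrightarrow> 0 * complex_of_real 0 + (\<Sum>i<DIM('a). d' i k \<phi> * complex_of_real 0)) at_top"
    by (intro tendsto_add tendsto_mult l2 t1 t2 tendsto_sum tendsto_const)
  then have l3: "((\<lambda>\<Lambda>. (osc_integral S \<phi> \<Lambda> * complex_of_real (\<Lambda> powr b)) *
      complex_of_real (\<Lambda> powr - \<epsilon>)) \<longlongrightarrow> 0) at_top"
    by (simp add: algebra_simps sum_distrib_left sum_distrib_right)
  have "complex_of_real (\<Lambda> powr b) * complex_of_real (\<Lambda> powr - \<epsilon>) =
      complex_of_real (\<Lambda> powr s j0)" for \<Lambda> :: real
    unfolding of_real_mult[symmetric] powr_add[symmetric] by (simp add: \<epsilon>_def)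
  then have "((\<lambda>\<Lambda>. osc_integral S \<phi> \<Lambda> * complex_of_real (\<Lambda> powr s j0)) \<longlongrightarrow> 0) at_top"
    using l3 by (simp add: mult.assoc)
  from tendsto_diff[OF this l1]
  have "((\<lambda>\<Lambda>. \<Sum>i<DIM('a). d i j0 \<phi> * complex_of_real (ln \<Lambda> ^ i)) \<longlongrightarrow> 0) at_top"
    by simp
  from poly_ln_tendsto_0[OF this i0(1)] i0(2) show False by contradiction
qed

lemma has_oscillation_index_unique:
  assumes "S has_oscillation_index a" "S has_oscillation_index b"
  shows "a = b"
  using has_oscillation_index_le assms by (meson order_antisym)

end

theory Submission
  imports Defs "HOL-Complex_Analysis.Cauchy_Integral_Theorem"
begin

text \<open>
  In cylindrical coordinates around the $x$-axis, $V_t = (a(x) + r^2)^2$ with $a(x) = x^4 + t x^2$. For fixed $x$ and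
  fixed direction, the sum of the amplitude at the two points at distance $r$ is a smooth function of $u = r^2$, so
  repeated integration by parts in $u$, with the bounded iterated antiderivatives $e_j$ of $e^{i u^2}$, expands the
  radial integral in terms $\lambda^{-j/2} e_j(\sqrt\lambda \, a(x))$ with $j \ge 1$. For $t < 0$ one splits at the zero
  $r^2 = -a(x)$ of the phase, where additional terms $\lambda^{-j/2} e_j(0)$ appear; the first of them gives the
  index $1/2$, with the integral of the amplitude over the cone $V_t = 0$ as its coefficient.
  It remains to expand $\int e_j(\sqrt\lambda \, |a(x)|) \psi(x) \, dx$. A change of variables turns $|a(x)|$ into $y^2$
  if $t \neq 0$ and into $y^4$ if $t = 0$, and integration by parts with the bounded iterated antiderivatives of
  $e_j(y^2)$ or $e_j(y^4)$ gives powers $\lambda^{-i/4}$ or $\lambda^{-i/8}$ with $i \ge 1$, so the leading exponents are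
  $1/2 + 1/4$ and $1/2 + 1/8$. No logarithms occur, and the leading coefficients do not vanish because
  on the rotated rays the antiderivatives are integrals of positive functions up to a constant phase.
\<close>

section \<open>Antiderivatives decaying along a ray\<close>

text \<open>The remainders shape the proof. After K integrations by parts the K-th antiderivative
  must be bounded, independently of the large parameter, on the whole half-line swept by its
  argument; a wrong constant of integration would make it grow. The argument must also stay
  nonnegative, because the decay controls one side only; hence the split at the zero of the phase
  for t < 0. With lambda = \<nu>^(2m), where |a| is straightened to y^m, both expansions run in
  integer powers of 1/\<nu>; m = 2 and m = 4 then fit one progression of exponents with step 1/8.
  For t < 0 the amplitude is confined to x^2 < -t/2, where |a| = x^2 (|t| - x^2) increases with |x|
  and can be straightened; for t \<ge> 0 it increases on the whole half-line. The leading
  coefficient is a multiple of the value of the amplitude at 0 for t \<ge> 0, but an integral over a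
  cone for t < 0; nonnegative bump functions detect both.\<close>

text \<open>
  Iterated antiderivatives of an oscillating entire function are bounded on the half-line if they are normalised to
  vanish at infinity along a ray into the sector where the function decays. This replaces explicit contour rotation.
\<close>

definition cone2 :: "complex \<Rightarrow> complex set" where
  "cone2 \<eta> = {of_real y + \<eta> * of_real x |x y. 0 \<le> x \<and> 0 \<le> y}"

text \<open>The rate exp (- r), weaker than the Gaussian decay of the model function, is chosen
  because it reproduces itself under integration from r to infinity. The starting points range over
  the whole sector so that an antiderivative satisfies the same kind of bound.\<close>

definition ray_decay :: "complex \<Rightarrow> (complex \<Rightarrow> complex) \<Rightarrow> bool" where
  "ray_decay \<eta> f \<longleftrightarrow> f holomorphic_on UNIV \<and>
     (\<exists>C. \<forall>z\<in>cone2 \<eta>. \<forall>r\<ge>0. norm (f (z + \<eta> * of_real r)) \<le> C * exp (- r))"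

lemma cone2_0: "0 \<in> cone2 \<eta>"
  unfolding cone2_def by (rule CollectI, rule exI[of _ 0], rule exI[of _ 0]) simp

lemma cone2_real: "0 \<le> y \<Longrightarrow> of_real y \<in> cone2 \<eta>"
  unfolding cone2_def by (rule CollectI, rule exI[of _ 0], rule exI[of _ y]) simp

lemma cone2_scale: "z \<in> cone2 \<eta> \<Longrightarrow> 0 \<le> u \<Longrightarrow> of_real u * z \<in> cone2 \<eta>"
  unfolding cone2_def
proof (clarify)
  fix x y :: real assume "0 \<le> u" "0 \<le> x" "0 \<le> y"
  then show "\<exists>x' y'. of_real u * (of_real y + \<eta> * of_real x) = of_real y' + \<eta> * of_real x' \<and> 0 \<le> x' \<and> 0 \<le> y'"
    by (intro exI[of _ "u*x"] exI[of _ "u*y"]) (simp add: algebra_simps)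
qed

lemma cone2_add: "z \<in> cone2 \<eta> \<Longrightarrow> w \<in> cone2 \<eta> \<Longrightarrow> z + w \<in> cone2 \<eta>"
  unfolding cone2_def
proof (clarify)
  fix x y x' y' :: real assume "0 \<le> x" "0 \<le> y" "0 \<le> x'" "0 \<le> y'"
  then show "\<exists>xa ya. of_real y + \<eta> * of_real x + (of_real y' + \<eta> * of_real x') = of_real ya + \<eta> * of_real xa \<and> 0 \<le> xa \<and> 0 \<le> ya"
    by (intro exI[of _ "x+x'"] exI[of _ "y+y'"]) (simp add: algebra_simps)
qed

lemma cone2_sum: "(\<And>i. i \<in> I \<Longrightarrow> f i \<in> cone2 \<eta>) \<Longrightarrow> sum f I \<in> cone2 \<eta>"
  by (induction I rule: infinite_finite_induct) (auto intro: cone2_0 cone2_add)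

lemma ray_decay_tendsto_0:
  assumes "ray_decay \<eta> f"
  shows "((\<lambda>r. f (\<eta> * of_real r)) \<longlongrightarrow> 0) at_top"
proof -
  obtain C where C: "\<And>z r. z \<in> cone2 \<eta> \<Longrightarrow> r \<ge> 0 \<Longrightarrow> norm (f (z + \<eta> * of_real r)) \<le> C * exp (- r)"
    using assms unfolding ray_decay_def by blast
  have "((\<lambda>r::real. C * exp (- r)) \<longlongrightarrow> C * 0) at_top"
    by (intro tendsto_mult tendsto_const filterlim_compose[OF exp_at_bot filterlim_uminus_at_bot_at_top])
  moreover have "eventually (\<lambda>r. norm (f (\<eta> * of_real r)) \<le> C * exp (- r)) at_top"
    using eventually_ge_at_top[of 0]
    by eventually_elim (use C[OF cone2_0] in auto)
  ultimately show ?thesis by (auto intro: Lim_null_comparison)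
qed

text \<open>The antiderivative is \<open>P\<close> minus its limit at infinity along the ray.
  Integrating the bound along a ray gives the tail estimate with the same constant; integrating
  across shows that all parallel rays starting in the sector lead to the same limit.\<close>

lemma ray_decay_primitive:
  assumes f: "ray_decay \<eta> f" and \<eta>: "norm \<eta> = 1"
  shows "\<exists>g. ray_decay \<eta> g \<and> (\<forall>z. (g has_field_derivative f z) (at z))"
proof -
  obtain C where C: "\<And>z r. z \<in> cone2 \<eta> \<Longrightarrow> r \<ge> 0 \<Longrightarrow> norm (f (z + \<eta> * of_real r)) \<le> C * exp (- r)"
    using f unfolding ray_decay_def by blast
  have C0: "C \<ge> 0" using order_trans[OF norm_ge_zero C[OF cone2_0, of 0]] by simp
  obtain P where P: "\<And>z. (P has_field_derivative f z) (at z)"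
    using f holomorphic_convex_primitive'[of UNIV f] unfolding ray_decay_def by auto
  have ray: "norm (P (z + \<eta> * of_real b) - P (z + \<eta> * of_real a)) \<le> C * exp (- a)"
    if "z \<in> cone2 \<eta>" "0 \<le> a" "a \<le> b" for z a b
  proof (cases "a = b")
    case False
    have "norm (P (z + \<eta> * of_real b) - P (z + \<eta> * of_real a)) \<le> - C * exp (- b) - (- C * exp (- a))"
    proof (rule differentiable_bound_general[where f = "\<lambda>r. P (z + \<eta> * of_real r)" and \<phi> = "\<lambda>r. - C * exp (- r)" and f' = "\<lambda>r. \<eta> * f (z + \<eta> * of_real r)" and \<phi>' = "\<lambda>r. C * exp (- r)"])
      show "a < b" using that False by simp
      have vd: "((\<lambda>r. P (z + \<eta> * of_real r)) has_vector_derivative \<eta> * f (z + \<eta> * of_real r)) (at r)" for r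
      proof -
        have "((\<lambda>r. z + \<eta> * of_real r) has_vector_derivative \<eta>) (at r)"
          by (auto intro!: derivative_eq_intros)
        from field_vector_diff_chain_at[OF this P] show ?thesis by (simp add: o_def)
      qed
      show "((\<lambda>r. P (z + \<eta> * of_real r)) has_vector_derivative \<eta> * f (z + \<eta> * of_real r)) (at r)" for r by (rule vd)
      show "((\<lambda>r. - C * exp (- r)) has_vector_derivative C * exp (- r)) (at r)" for r
        unfolding has_real_derivative_iff_has_vector_derivative[symmetric]
        by (auto intro!: derivative_eq_intros)
      show "continuous_on {a..b} (\<lambda>r. P (z + \<eta> * of_real r))"
        using vd by (intro continuous_at_imp_continuous_on ballI) (blast intro: has_vector_derivative_continuous)
      show "continuous_on {a..b} (\<lambda>r. - C * exp (- r))" by (intro continuous_intros)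
      show "norm (\<eta> * f (z + \<eta> * of_real r)) \<le> C * exp (- r)" if "a < r" for r
        using C[OF \<open>z \<in> cone2 \<eta>\<close>, of r] that \<open>0 \<le> a\<close> \<eta> by (simp add: norm_mult)
    qed
    also have "\<dots> \<le> C * exp (- a)" using C0 by simp
    finally show ?thesis .
  qed (use C0 in simp)
  have exp0: "(\<lambda>n. C * exp (- real n)) \<longlonglongrightarrow> C * 0"
    by (intro tendsto_mult tendsto_const filterlim_compose[OF exp_at_bot]
        filterlim_compose[OF filterlim_uminus_at_bot_at_top filterlim_real_sequentially])
  have "Cauchy (\<lambda>n. P (\<eta> * of_real (real n)))"
  proof (rule metric_CauchyI)
    fix e :: real assume "e > 0"
    obtain M where M: "\<And>n. n \<ge> M \<Longrightarrow> norm (C * exp (- real n)) < e / 2"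
      using LIMSEQ_D[OF exp0, of "e/2"] \<open>e > 0\<close> by auto
    have "dist (P (\<eta> * of_real (real m))) (P (\<eta> * of_real (real M))) < e / 2" if "m \<ge> M" for m
      using ray[OF cone2_0, of "real M" "real m"] that M[of M] by (simp add: dist_norm)
    then show "\<exists>M. \<forall>m\<ge>M. \<forall>n\<ge>M. dist (P (\<eta> * of_real (real m))) (P (\<eta> * of_real (real n))) < e"
      by (meson dist_triangle_half_l)
  qed
  then obtain L where L: "(\<lambda>n. P (\<eta> * of_real (real n))) \<longlonglongrightarrow> L"
    using Cauchy_convergent_iff convergent_def by blast
  have tr: "norm (P (z + \<eta> * of_real b) - P (\<eta> * of_real b)) \<le> C * exp (- b) * norm z"
    if "z \<in> cone2 \<eta>" "0 \<le> b" for z b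
  proof -
    have "norm (P (z + \<eta> * of_real b) - P (\<eta> * of_real b)) \<le> C * exp (- b) * norm ((z + \<eta> * of_real b) - \<eta> * of_real b)"
    proof (rule field_differentiable_bound[where f = P and f' = f and S = "closed_segment (\<eta> * of_real b) (z + \<eta> * of_real b)"])
      fix w assume "w \<in> closed_segment (\<eta> * of_real b) (z + \<eta> * of_real b)"
      then obtain u where u: "0 \<le> u" "u \<le> 1"
         and w: "w = (1 - u) *\<^sub>R (\<eta> * of_real b) + u *\<^sub>R (z + \<eta> * of_real b)"
        by (auto simp: in_segment)
      have "w = of_real u * z + \<eta> * of_real b"
        unfolding w by (simp add: scaleR_conv_of_real algebra_simps)
      then show "norm (f w) \<le> C * exp (- b)"
        using C[OF cone2_scale[OF that(1) u(1)] that(2)] by simp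
    qed (use P in \<open>auto intro: DERIV_subset\<close>)
    then show ?thesis by simp
  qed
  define g where "g z = P z - L" for z
  have gd: "(g has_field_derivative f z) (at z)" for z
    unfolding g_def using P[of z] by (auto intro!: derivative_eq_intros)
  \<comment> \<open>The point at infinity is reached in three pieces: along the ray from z, across
    to the ray from 0, and along that ray. Only the first piece survives as n grows.\<close>
  have "norm (g (z + \<eta> * of_real r)) \<le> C * exp (- r)" if z: "z \<in> cone2 \<eta>" and r: "0 \<le> r" for z r
  proof (rule tendsto_lowerbound)
    have "(\<lambda>n. C * exp (- r) + C * exp (- real n) * norm z + norm (P (\<eta> * of_real (real n)) - L))
       \<longlonglongrightarrow> C * exp (- r) + (C * 0) * norm z + norm (L - L)"
      by (intro tendsto_intros exp0 L)
    then show "(\<lambda>n. C * exp (- r) + C * exp (- real n) * norm z + norm (P (\<eta> * of_real (real n)) - L))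
       \<longlonglongrightarrow> C * exp (- r)" by simp
    have "eventually (\<lambda>n. real n \<ge> r) sequentially"
      by (meson eventually_sequentiallyI nat_ceiling_le_eq)
    then show "eventually (\<lambda>n. norm (g (z + \<eta> * of_real r)) \<le> C * exp (- r) + C * exp (- real n) * norm z + norm (P (\<eta> * of_real (real n)) - L)) sequentially"
    proof eventually_elim
      case (elim n)
      have "g (z + \<eta> * of_real r) = (P (z + \<eta> * of_real r) - P (z + \<eta> * of_real (real n)))
          + (P (z + \<eta> * of_real (real n)) - P (\<eta> * of_real (real n))) + (P (\<eta> * of_real (real n)) - L)"
        by (simp add: g_def)
      moreover have "norm \<dots> \<le> C * exp (- r) + C * exp (- real n) * norm z + norm (P (\<eta> * of_real (real n)) - L)"
        using ray[OF z r elim] tr[OF z, of "real n"]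
        by (intro norm_triangle_le add_mono) (auto simp: norm_minus_commute)
      ultimately show ?case by simp
    qed
  qed auto
  then have "ray_decay \<eta> g"
    unfolding ray_decay_def using gd by (auto simp: holomorphic_on_open)
  then show ?thesis using gd by blast
qed

lemma ray_decay_chain:
  assumes "ray_decay \<eta> f" and "norm \<eta> = 1"
  shows "\<exists>F. F 0 = f \<and> (\<forall>k. ray_decay \<eta> (F k)) \<and>
     (\<forall>k z. (F (Suc k) has_field_derivative F k z) (at z))"
proof -
  have "\<exists>F. \<forall>n. (ray_decay \<eta> (F n) \<and> (n = 0 \<longrightarrow> F n = f)) \<and> (\<forall>z. (F (Suc n) has_field_derivative F n z) (at z))"
    by (rule dependent_nat_choice) (use assms ray_decay_primitive[OF _ assms(2)] in auto)
  then show ?thesis by metis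
qed

text \<open>The source of all uniform remainders: the nonnegative half-line lies in the sector, so r
  = 0 in the decay estimate bounds the function there.\<close>

lemma ray_decay_bounded_real:
  assumes "ray_decay \<eta> f"
  shows "\<exists>C\<ge>0. \<forall>y\<ge>0. norm (f (of_real y)) \<le> C"
proof -
  obtain C where C: "\<And>z r. z \<in> cone2 \<eta> \<Longrightarrow> r \<ge> 0 \<Longrightarrow> norm (f (z + \<eta> * of_real r)) \<le> C * exp (- r)"
    using assms unfolding ray_decay_def by blast
  have *: "norm (f (of_real y)) \<le> C" if "y \<ge> 0" for y
    using C[OF cone2_real[OF that], of 0] by simp
  then show ?thesis using order_trans[OF norm_ge_zero *[of 0]] by auto
qed

section \<open>Model functions on the rotated rays\<close>

lemma cis_cone2: "0 \<le> x \<Longrightarrow> x \<le> pi / 4 \<Longrightarrow> cis x \<in> cone2 (cis (pi/4))"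
proof -
  assume x: "0 \<le> x" "x \<le> pi / 4"
  have s: "0 \<le> sin x" using x by (intro sin_ge_zero) auto
  have "sin x \<le> sin (pi/4)" using x by (intro sin_monotone_2pi_le) auto
  also have "\<dots> = cos (pi/4)" by (simp add: sin_45 cos_45)
  also have "\<dots> \<le> cos x" using x by (intro cos_monotone_0_pi_le) auto
  finally have sc: "sin x \<le> cos x" .
  have "cis x = of_real (cos x - sin x) + cis (pi/4) * of_real (sqrt 2 * sin x)"
    by (simp add: complex_eq_iff sin_45 cos_45)
  then show ?thesis unfolding cone2_def using s sc by (intro CollectI exI[of _ "sqrt 2 * sin x"] exI[of _ "cos x - sin x"]) auto
qed

text \<open>At y + cis (pi/4) R the square has imaginary part R^2 + sqrt 2 y R, which is at least
  R^2. The factor exp 1 comes from r - 1 \<le> r^2.\<close>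

lemma ray_decay_exp: "ray_decay (cis (pi/4)) (\<lambda>z. exp (\<i> * z\<^sup>2))"
proof -
  have "norm (exp (\<i> * (z + cis (pi/4) * of_real r)\<^sup>2)) \<le> exp 1 * exp (- r)"
    if z: "z \<in> cone2 (cis (pi/4))" and r: "0 \<le> r" for z r
  proof -
    obtain x y where xy: "0 \<le> x" "0 \<le> y" and zz: "z = of_real y + cis (pi/4) * of_real x"
      using z unfolding cone2_def by blast
    have e: "z + cis (pi/4) * of_real r = of_real y + cis (pi/4) * of_real (x + r)"
      by (simp add: zz algebra_simps)
    have "Im ((z + cis (pi/4) * of_real r)\<^sup>2) = sqrt 2 * y * (x + r) + (x + r)\<^sup>2"
      unfolding e by (simp add: power2_eq_square sin_45 cos_45 algebra_simps)
    also have "\<dots> \<ge> 0 + r\<^sup>2" using xy r by (intro add_mono power_mono) auto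
    finally have "Im ((z + cis (pi/4) * of_real r)\<^sup>2) \<ge> r\<^sup>2" by simp
    moreover have "r\<^sup>2 \<ge> r - 1" using zero_le_power2[of "2 * r - 1"] by (simp add: power2_eq_square algebra_simps)
    ultimately show ?thesis unfolding exp_add[symmetric] by simp
  qed
  then show ?thesis unfolding ray_decay_def by (auto intro!: holomorphic_intros)
qed

lemma cis_root_power: "m > 0 \<Longrightarrow> cis (pi / (4 * real m)) ^ m = cis (pi/4)"
proof -
  assume "m > 0"
  then have "real m * (pi / (4 * real m)) = pi/4" by simp
  then show ?thesis unfolding Complex.DeMoivre by (rule arg_cong)
qed

text \<open>The m-th power maps the sector of angle pi / (4 m) into that of angle pi / 4. In the
  binomial expansion the pure power of the ray parameter supplies the decay; all other terms have
  arguments at most pi / 4 and together form the new starting point.\<close>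

lemma ray_decay_power:
  assumes f: "ray_decay (cis (pi/4)) f" and m: "m > 0"
  shows "ray_decay (cis (pi / (4 * real m))) (\<lambda>z. f (z ^ m))"
proof -
  let ?\<eta> = "cis (pi / (4 * real m))"
  obtain C where C: "\<And>z r. z \<in> cone2 (cis (pi/4)) \<Longrightarrow> r \<ge> 0 \<Longrightarrow> norm (f (z + cis (pi/4) * of_real r)) \<le> C * exp (- r)"
    using f unfolding ray_decay_def by blast
  have C0: "C \<ge> 0" using order_trans[OF norm_ge_zero C[OF cone2_0, of 0]] by simp
  have "norm (f ((z + ?\<eta> * of_real r) ^ m)) \<le> C * exp 1 * exp (- r)" if z: "z \<in> cone2 ?\<eta>" and r: "0 \<le> r" for z r
  proof -
    obtain x y where xy: "0 \<le> x" "0 \<le> y" and zz: "z = of_real y + ?\<eta> * of_real x"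
      using z unfolding cone2_def by blast
    define R where "R = x + r"
    have R: "0 \<le> R" "r \<le> R" using xy r by (auto simp: R_def)
    have e: "z + ?\<eta> * of_real r = ?\<eta> * of_real R + of_real y"
      by (simp add: zz R_def algebra_simps)
    define p where "p = (\<Sum>k<m. of_nat (m choose k) * (?\<eta> * of_real R) ^ k * of_real y ^ (m - k))"
    have ck: "?\<eta> ^ k \<in> cone2 (cis (pi/4))" if "k \<le> m" for k
      unfolding Complex.DeMoivre
      using that m by (intro cis_cone2) (auto simp: field_simps)
    have "of_nat (m choose k) * (?\<eta> * of_real R) ^ k * of_real y ^ (m - k) \<in> cone2 (cis (pi/4))" if "k < m" for k
      using cone2_scale[OF ck[of k], of "real (m choose k) * R ^ k * y ^ (m - k)"] that R xy
      by (simp add: power_mult_distrib mult_ac)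
    then have p: "p \<in> cone2 (cis (pi/4))"
      unfolding p_def by (intro cone2_sum) auto
    have "(z + ?\<eta> * of_real r) ^ m = (\<Sum>k\<le>m. of_nat (m choose k) * (?\<eta> * of_real R) ^ k * of_real y ^ (m - k))"
      unfolding e by (rule binomial_ring)
    also have "\<dots> = p + ?\<eta> ^ m * of_real (R ^ m)"
      unfolding p_def lessThan_Suc_atMost[symmetric] by (simp add: power_mult_distrib)
    also note cis_root_power[OF m]
    finally have "norm (f ((z + ?\<eta> * of_real r) ^ m)) \<le> C * exp (- (R ^ m))"
      using C[OF p, of "R ^ m"] R by simp
    \<comment> \<open>The extra 1, and with it the factor exp 1, pays for R^m being smaller than R
      when R is below 1.\<close>
    also have "r \<le> R ^ m + 1"
    proof (cases "R \<le> 1")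
      case True then show ?thesis using R(2) zero_le_power[OF R(1), of m] by linarith
    next
      case False then have "R ^ 1 \<le> R ^ m" using m by (intro power_increasing) auto
      then show ?thesis using R by simp
    qed
    then have "C * exp (- (R ^ m)) \<le> C * (exp 1 * exp (- r))"
      unfolding exp_add[symmetric] using C0 by (intro mult_left_mono) auto
    finally show ?thesis by (simp add: mult.assoc)
  qed
  moreover have "(\<lambda>z. f (z ^ m)) holomorphic_on UNIV"
    using f holomorphic_on_compose_gen[of "\<lambda>z. z ^ m" UNIV f UNIV] holomorphic_on_power[OF holomorphic_on_ident, of m UNIV]
    unfolding ray_decay_def by (auto simp: o_def)
  ultimately show ?thesis unfolding ray_decay_def by blast
qed

text \<open>In effect f x is the integral of d from x to infinity: the limit fixes the constant of
  integration, including its imaginary part.\<close>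

lemma pos_real_if_decreasing_to_0:
  fixes f :: "real \<Rightarrow> complex"
  assumes d: "\<And>x. 0 \<le> x \<Longrightarrow> (f has_vector_derivative of_real (- d x)) (at x)"
    and pos: "\<And>x. 0 \<le> x \<Longrightarrow> 0 < d x" and lim: "(f \<longlongrightarrow> 0) at_top" and x: "0 \<le> x"
  shows "\<exists>y>0. f x = of_real y"
proof -
  have dr: "((\<lambda>x. Re (f x)) has_real_derivative - d x) (at x)" if "0 \<le> x" for x
    using bounded_linear.has_vector_derivative[OF bounded_linear_Re d[OF that]]
    by (simp add: has_real_derivative_iff_has_vector_derivative)
  have di: "((\<lambda>x. Im (f x)) has_real_derivative 0) (at x)" if "0 \<le> x" for x
    using bounded_linear.has_vector_derivative[OF bounded_linear_Im d[OF that]]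
    by (simp add: has_real_derivative_iff_has_vector_derivative)
  have ci: "Im (f z) = Im (f x)" if "x < z" for z
  proof (rule DERIV_isconst_end[OF that])
    show "continuous_on {x..z} (\<lambda>x. Im (f x))"
      using x di by (intro continuous_at_imp_continuous_on ballI) (metis DERIV_isCont atLeastAtMost_iff order_trans)
    show "((\<lambda>x. Im (f x)) has_real_derivative 0) (at y)" if "x < y" for y
      using di that x by simp
  qed
  have "((\<lambda>z. Im (f z)) \<longlongrightarrow> Im 0) at_top" by (intro tendsto_intros lim)
  moreover have "eventually (\<lambda>z. Im (f z) = Im (f x)) at_top"
    using eventually_gt_at_top[of x] by eventually_elim (rule ci)
  ultimately have i0: "Im (f x) = 0"
    using tendsto_unique[OF trivial_limit_at_top_linorder tendsto_eventually] by fastforce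
  have dec: "Re (f z) < Re (f y)" if "0 \<le> y" "y < z" for y z
    by (rule DERIV_neg_imp_decreasing[OF that(2)]) (metis that(1) dr pos neg_less_0_iff_less order_trans)
  have "((\<lambda>z. Re (f z)) \<longlongrightarrow> Re 0) at_top" by (intro tendsto_intros lim)
  \<comment> \<open>A limit keeps only a weak inequality, so the comparison is made at x + 1;
    strictness then comes from the decrease between x and x + 1.\<close>
  moreover have "eventually (\<lambda>z. Re (f z) \<le> Re (f (x + 1))) at_top"
    using eventually_gt_at_top[of "x+1"] by eventually_elim (use dec[of "x+1"] x in force)
  ultimately have "Re 0 \<le> Re (f (x + 1))" by (rule tendsto_upperbound) simp
  then have "Re (f x) > 0" using dec[of x "x+1"] x by simp
  then show ?thesis using i0 by (intro exI[of _ "Re (f x)"]) (simp add: complex_eq_iff)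
qed

lemma ray_vector_derivative:
  assumes "\<And>z. (g has_field_derivative f z) (at z)"
  shows "((\<lambda>r. g (\<eta> * of_real r)) has_vector_derivative \<eta> * f (\<eta> * of_real r)) (at r)"
proof -
  have "((\<lambda>r. \<eta> * of_real r) has_vector_derivative \<eta>) (at r)"
    by (auto intro!: derivative_eq_intros)
  from field_vector_diff_chain_at[OF this assms] show ?thesis by (simp add: o_def)
qed

text \<open>With w = cis (pi/4), the identity w^2 = i turns the oscillation into a Gaussian: g (w r)
  is -w times the integral of exp (-s^2) over s from r to infinity.\<close>

lemma fresnel_primitive_ray:
  assumes g: "ray_decay (cis (pi/4)) g" and d: "\<And>z. (g has_field_derivative exp (\<i> * z\<^sup>2)) (at z)"
    and r: "0 \<le> r"
  shows "\<exists>y>0. g (cis (pi/4) * of_real r) = - cis (pi/4) * of_real y"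
proof -
  let ?w = "cis (pi/4)"
  have w2: "?w\<^sup>2 = \<i>" by (simp only: Complex.DeMoivre) simp
  have "\<exists>y>0. - (g (?w * of_real r)) / ?w = of_real y"
  proof (rule pos_real_if_decreasing_to_0[where f = "\<lambda>r. - g (?w * of_real r) / ?w" and d = "\<lambda>r. exp (- r\<^sup>2)", OF _ _ _ r])
    show "((\<lambda>r. - g (?w * of_real r) / ?w) has_vector_derivative of_real (- exp (- r\<^sup>2))) (at r)" for r
    proof -
      have "((\<lambda>r. - g (?w * of_real r) / ?w) has_vector_derivative - (?w * exp (\<i> * (?w * of_real r)\<^sup>2)) / ?w) (at r)"
        by (intro derivative_intros has_vector_derivative_divide ray_vector_derivative d)
      moreover have "- (?w * exp (\<i> * (?w * of_real r)\<^sup>2)) / ?w = of_real (- exp (- r\<^sup>2))"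
        by (simp add: power_mult_distrib w2 exp_of_real[symmetric] flip: mult.assoc)
      ultimately show ?thesis by simp
    qed
    have "((\<lambda>r. - g (?w * of_real r) / ?w) \<longlongrightarrow> - 0 / ?w) at_top"
      by (intro tendsto_intros ray_decay_tendsto_0 g) auto
    then show "((\<lambda>r. - g (?w * of_real r) / ?w) \<longlongrightarrow> 0) at_top" by simp
  qed auto
  then obtain y where y: "y > 0" "- g (?w * of_real r) / ?w = of_real y" by blast
  have "g (?w * of_real r) = - ?w * (- g (?w * of_real r) / ?w)" by simp
  then have "g (?w * of_real r) = - ?w * of_real y" by (simp only: y)
  then show ?thesis using y(1) by blast
qed

text \<open>Since \<eta>^m = cis (pi/4), the m-th power carries the ray of f to the ray of g. Hence
  f 0 is a unimodular constant times the integral of the positive Gaussian tails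
  \<open>A (r ^ m)\<close>, and no cancellation can occur.\<close>

lemma fresnel_primitive_power_nonzero:
  assumes g: "ray_decay (cis (pi/4)) g" and d: "\<And>z. (g has_field_derivative exp (\<i> * z\<^sup>2)) (at z)"
    and m: "m > 0" and f: "ray_decay (cis (pi / (4 * real m))) f"
    and df: "\<And>z. (f has_field_derivative g (z ^ m)) (at z)"
  shows "f 0 \<noteq> 0"
proof -
  let ?w = "cis (pi/4)" and ?\<eta> = "cis (pi / (4 * real m))"
  have em: "?\<eta> ^ m = ?w" by (rule cis_root_power[OF m])
  obtain A where A: "\<And>r. 0 \<le> r \<Longrightarrow> A r > 0 \<and> g (?w * of_real r) = - ?w * of_real (A r)"
    using fresnel_primitive_ray[OF g d] by metis
  have "\<exists>y>0. f (?\<eta> * of_real 0) / (?\<eta> * ?w) = of_real y"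
  proof (rule pos_real_if_decreasing_to_0[where f = "\<lambda>r. f (?\<eta> * of_real r) / (?\<eta> * ?w)" and d = "\<lambda>r. A (r ^ m)" and x = 0])
    show "((\<lambda>r. f (?\<eta> * of_real r) / (?\<eta> * ?w)) has_vector_derivative of_real (- A (r ^ m))) (at r)" if "0 \<le> r" for r
    proof -
      have "((\<lambda>r. f (?\<eta> * of_real r) / (?\<eta> * ?w)) has_vector_derivative (?\<eta> * g ((?\<eta> * of_real r) ^ m)) / (?\<eta> * ?w)) (at r)"
        by (intro has_vector_derivative_divide ray_vector_derivative df)
      moreover have "(?\<eta> * g ((?\<eta> * of_real r) ^ m)) / (?\<eta> * ?w) = of_real (- A (r ^ m))"
        using A[of "r ^ m"] that by (simp add: power_mult_distrib em)
      ultimately show ?thesis by simp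
    qed
    have "((\<lambda>r. f (?\<eta> * of_real r) / (?\<eta> * ?w)) \<longlongrightarrow> 0 / (?\<eta> * ?w)) at_top"
      by (intro tendsto_intros ray_decay_tendsto_0 f) auto
    then show "((\<lambda>r. f (?\<eta> * of_real r) / (?\<eta> * ?w)) \<longlongrightarrow> 0) at_top" by simp
  qed (use A in auto)
  then show ?thesis by auto
qed

section \<open>Iterated integration by parts and smooth functions of one variable\<close>

text \<open>Integration by parts with respect to u where du = p x dx: both families are
  differentiated in u but parametrised by x. With p = 2 r this treats u = r^2 down to r = 0 without
  square roots; p = 1 is the plain case.\<close>

lemma iterated_by_parts:
  fixes A Q :: "nat \<Rightarrow> real \<Rightarrow> complex" and p :: "real \<Rightarrow> complex"
  assumes ab: "a \<le> b"
    and A: "\<And>j x. a \<le> x \<Longrightarrow> x \<le> b \<Longrightarrow> (A (Suc j) has_vector_derivative p x * A j x) (at x within {a..b})"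
    and Q: "\<And>j x. j < K \<Longrightarrow> a \<le> x \<Longrightarrow> x \<le> b \<Longrightarrow> (Q j has_vector_derivative p x * Q (Suc j) x) (at x within {a..b})"
    and cont: "continuous_on {a..b} p" "continuous_on {a..b} (A 0)" "continuous_on {a..b} (Q K)"
    and I: "((\<lambda>x. p x * (A 0 x * Q 0 x)) has_integral I) {a..b}"
  shows "((\<lambda>x. p x * (A K x * Q K x)) has_integral
    (-1) ^ K * (I - (\<Sum>j<K. (-1) ^ j * (A (Suc j) b * Q j b - A (Suc j) a * Q j a)))) {a..b}"
  using Q cont(3)
proof (induction K)
  case 0
  then show ?case using I by simp
next
  case (Suc K)
  have cA: "continuous_on {a..b} (A j)" for j
  proof (cases j)
    case 0 then show ?thesis using cont by simp
  next
    case (Suc i) then show ?thesis using A[of _ i]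
      by (auto simp: continuous_on_eq_continuous_within intro!: has_vector_derivative_continuous)
  qed
  have cQ: "continuous_on {a..b} (Q K)"
    using Suc.prems(1)[of K]
    by (auto simp: continuous_on_eq_continuous_within intro!: has_vector_derivative_continuous)
  let ?S = "\<lambda>K. \<Sum>j<K. (-1) ^ j * (A (Suc j) b * Q j b - A (Suc j) a * Q j a)"
  have IH: "((\<lambda>x. p x * (A K x * Q K x)) has_integral (-1) ^ K * (I - ?S K)) {a..b}"
    using Suc.prems cQ by (intro Suc.IH) auto
  have "((\<lambda>x. (p x * Q (Suc K) x) * A (Suc K) x) has_integral
      (Q K b * A (Suc K) b - Q K a * A (Suc K) a) - (-1) ^ K * (I - ?S K)) {a..b}"
  proof (rule integration_by_parts_interior[OF bounded_bilinear_mult ab cQ cA])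
    show "((\<lambda>x. Q K x * (p x * A K x)) has_integral
        Q K b * A (Suc K) b - Q K a * A (Suc K) a - (Q K b * A (Suc K) b - Q K a * A (Suc K) a - (-1) ^ K * (I - ?S K))) {a..b}"
      using IH by (simp add: mult_ac)
    fix x assume "x \<in> {a<..<b}"
    then show "(Q K has_vector_derivative p x * Q (Suc K) x) (at x)"
      and "(A (Suc K) has_vector_derivative p x * A K x) (at x)"
      using A[of x K] Suc.prems(1)[of K x] at_within_Icc_at[of a x b] by auto
  qed
  moreover have "(Q K b * A (Suc K) b - Q K a * A (Suc K) a) - (-1) ^ K * (I - ?S K)
      = (-1) ^ Suc K * (I - ?S (Suc K))"
    by (cases "even K") (simp_all add: algebra_simps)
  ultimately show ?case by (simp add: mult_ac)
qed

text \<open>Quantifying the derivatives existentially gives closure under products and compositions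
  without formulas for higher derivatives. The top derivative carries no continuity, so a continuous
  K-th derivative is obtained from order K + 1.\<close>

primrec kdiff :: "nat \<Rightarrow> real set \<Rightarrow> (real \<Rightarrow> real) \<Rightarrow> bool" where
  "kdiff 0 S f \<longleftrightarrow> True"
| "kdiff (Suc k) S f \<longleftrightarrow> (\<exists>f'. (\<forall>x\<in>S. (f has_real_derivative f' x) (at x)) \<and> kdiff k S f')"

lemma kdiff_SucD: "kdiff (Suc k) S f \<Longrightarrow> kdiff k S f"
  by (induction k arbitrary: f) auto

lemma kdiff_const: "kdiff k S (\<lambda>_. c)"
proof (induction k arbitrary: c)
  case (Suc k)
  show ?case unfolding kdiff.simps using Suc.IH[of 0] by (intro exI[of _ "\<lambda>_. 0"]) simp
qed simp

lemma kdiff_ident: "kdiff k S (\<lambda>x. x)"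
proof (cases k)
  case (Suc k)
  then show ?thesis using kdiff_const[of k S 1] by (auto intro!: exI[of _ "\<lambda>_. 1"])
qed simp

lemma kdiff_add: "kdiff k S f \<Longrightarrow> kdiff k S g \<Longrightarrow> kdiff k S (\<lambda>x. f x + g x)"
proof (induction k arbitrary: f g)
  case (Suc k)
  from Suc.prems obtain f' g' where "\<forall>x\<in>S. (f has_real_derivative f' x) (at x)" "kdiff k S f'"
    "\<forall>x\<in>S. (g has_real_derivative g' x) (at x)" "kdiff k S g'" unfolding kdiff.simps by blast
  with Suc.IH[of f' g'] show ?case
    unfolding kdiff.simps by (intro exI[of _ "\<lambda>x. f' x + g' x"]) (simp add: DERIV_add)
qed auto

lemma kdiff_mult: "kdiff k S f \<Longrightarrow> kdiff k S g \<Longrightarrow> kdiff k S (\<lambda>x. f x * g x)"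
proof (induction k arbitrary: f g)
  case (Suc k)
  from Suc.prems obtain f' g' where *: "\<forall>x\<in>S. (f has_real_derivative f' x) (at x)" "kdiff k S f'"
    "\<forall>x\<in>S. (g has_real_derivative g' x) (at x)" "kdiff k S g'" unfolding kdiff.simps by blast
  have "kdiff k S (\<lambda>x. f' x * g x + f x * g' x)"
    by (intro kdiff_add Suc.IH *(2,4) kdiff_SucD[OF Suc.prems(1)] kdiff_SucD[OF Suc.prems(2)])
  moreover have "((\<lambda>x. f x * g x) has_real_derivative f' x * g x + f x * g' x) (at x)" if "x \<in> S" for x
    using DERIV_mult[OF bspec[OF *(1) that] bspec[OF *(3) that]] by (simp add: mult.commute)
  ultimately show ?case
    unfolding kdiff.simps by (intro exI[of _ "\<lambda>x. f' x * g x + f x * g' x"]) simp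
qed auto

lemma kdiff_compose:
  assumes "\<And>x. x \<in> S \<Longrightarrow> g x \<in> T"
  shows "kdiff k T f \<Longrightarrow> kdiff k S g \<Longrightarrow> kdiff k S (\<lambda>x. f (g x))"
proof (induction k arbitrary: f)
  case (Suc k)
  from Suc.prems obtain f' g' where *: "\<forall>x\<in>T. (f has_real_derivative f' x) (at x)" "kdiff k T f'"
    "\<forall>x\<in>S. (g has_real_derivative g' x) (at x)" "kdiff k S g'" unfolding kdiff.simps by blast
  have "kdiff k S (\<lambda>x. f' (g x) * g' x)"
    by (rule kdiff_mult[OF Suc.IH[OF *(2) kdiff_SucD[OF Suc.prems(2)]] *(4)])
  moreover have "((\<lambda>x. f (g x)) has_real_derivative f' (g x) * g' x) (at x)" if "x \<in> S" for x
    using DERIV_chain2[OF bspec[OF *(1) assms[OF that]] bspec[OF *(3) that]] .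
  ultimately show ?case unfolding kdiff.simps by (intro exI[of _ "\<lambda>x. f' (g x) * g' x"]) simp
qed auto

lemma kdiff_powr: "kdiff k {0<..} (\<lambda>x. x powr a)"
proof (induction k arbitrary: a)
  case (Suc k)
  have "((\<lambda>x. x powr a) has_real_derivative a * x powr (a - 1)) (at x)" if "x > 0" for x
    using that by (auto intro!: derivative_eq_intros)
  then show ?case using kdiff_mult[OF kdiff_const Suc.IH[of "a - 1"], of a]
    unfolding kdiff.simps by (intro exI[of _ "\<lambda>x. a * x powr (a - 1)"]) simp
qed auto

lemma kdiff_sequence:
  assumes "kdiff K S f"
  shows "\<exists>D. D 0 = f \<and> (\<forall>j<K. \<forall>x\<in>S. (D j has_real_derivative D (Suc j) x) (at x))"
  using assms
proof (induction K arbitrary: f)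
  case 0
  then show ?case by (intro exI[of _ "\<lambda>_. f"]) auto
next
  case (Suc K)
  then obtain f' where f': "\<forall>x\<in>S. (f has_real_derivative f' x) (at x)" "kdiff K S f'" by auto
  then obtain D where D: "D 0 = f'" "\<forall>j<K. \<forall>x\<in>S. (D j has_real_derivative D (Suc j) x) (at x)"
    using Suc.IH by blast
  show ?case
    by (rule exI[of _ "case_nat f D"]) (use f' D in \<open>auto split: nat.split simp: less_Suc_eq_0_disj\<close>)
qed

text \<open>For the far endpoint of an integral, where the amplitude already vanishes on a
  neighbourhood and all boundary terms must drop out.\<close>

lemma derivative_sequence_vanishes:
  fixes D :: "nat \<Rightarrow> real \<Rightarrow> real"
  assumes "\<And>j x. j < K \<Longrightarrow> x \<in> S \<Longrightarrow> (D j has_real_derivative D (Suc j) x) (at x)"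
    and "open S" "\<And>x. x \<in> S \<Longrightarrow> D 0 x = 0" "x \<in> S" "j \<le> K"
  shows "D j x = 0"
  using assms(4,5)
proof (induction j arbitrary: x)
  case 0 then show ?case using assms(3) by simp
next
  case (Suc j)
  have "((\<lambda>_. 0) has_real_derivative D (Suc j) x) (at x)"
    by (rule has_field_derivative_transform_within_open[OF assms(1)[of j] assms(2)]) (use Suc in auto)
  then show ?case using DERIV_unique DERIV_const by blast
qed

section \<open>Directional derivatives of test functions\<close>

text \<open>Defined for every vector, not only for basis vectors, because the directions of the
  cylindrical coordinates move. The curried order lets \<open>dd v ^^ n\<close> stand for the n-fold
  derivative.\<close>

definition dd :: "'a::euclidean_space \<Rightarrow> ('a \<Rightarrow> real) \<Rightarrow> 'a \<Rightarrow> real" where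
  "dd v f x = frechet_derivative f (at x) v"

lemma dd_eqI: "(f has_derivative f') (at x) \<Longrightarrow> dd v f x = f' v"
  unfolding dd_def by (simp add: frechet_derivative_at[symmetric])

lemma Ck_Suc_dd: "Ck (Suc k) f \<longleftrightarrow> (\<forall>x. f differentiable (at x)) \<and> (\<forall>b\<in>Basis. Ck k (dd b f))"
  unfolding Ck.simps dd_def differentiable_on_def by simp

declare Ck.simps(2) [simp del]

lemma Ck_SucD: "Ck (Suc k) f \<Longrightarrow> Ck k f"
proof (induction k arbitrary: f)
  case 0
  then show ?case
    by (auto simp: Ck.simps(2) intro: differentiable_imp_continuous_on)
next
  case (Suc k)
  then show ?case unfolding Ck_Suc_dd by blast
qed

lemma Ck_const: "Ck k (\<lambda>_. c)"
proof (induction k arbitrary: c)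
  case (Suc k)
  have "dd b (\<lambda>_. c) = (\<lambda>_. 0)" for b :: 'a by (rule ext) (simp add: dd_def)
  then show ?case using Suc.IH[of 0] by (simp add: Ck_Suc_dd)
qed simp

lemma dd_add: "f differentiable (at x) \<Longrightarrow> g differentiable (at x) \<Longrightarrow> dd b (\<lambda>x. f x + g x) x = dd b f x + dd b g x"
  by (subst dd_eqI[OF has_derivative_add])
    (auto simp: dd_def frechet_derivative_works)

lemma dd_mult: "f differentiable (at x) \<Longrightarrow> g differentiable (at x) \<Longrightarrow> dd b (\<lambda>x. f x * g x) x = f x * dd b g x + dd b f x * g x"
  by (subst dd_eqI[OF has_derivative_mult])
    (auto simp: dd_def frechet_derivative_works)

lemma Ck_add: "Ck k f \<Longrightarrow> Ck k g \<Longrightarrow> Ck k (\<lambda>x. f x + g x)"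
proof (induction k arbitrary: f g)
  case 0 then show ?case by (auto intro: continuous_intros)
next
  case (Suc k)
  then have d: "\<And>x. f differentiable (at x)" "\<And>x. g differentiable (at x)" unfolding Ck_Suc_dd by auto
  have "dd b (\<lambda>x. f x + g x) = (\<lambda>x. dd b f x + dd b g x)" for b
    by (rule ext) (rule dd_add[OF d])
  with Suc d show ?case unfolding Ck_Suc_dd by (auto intro: differentiable_add)
qed

lemma Ck_mult: "Ck k f \<Longrightarrow> Ck k g \<Longrightarrow> Ck k (\<lambda>x. f x * g x)"
proof (induction k arbitrary: f g)
  case 0 then show ?case by (auto intro: continuous_intros)
next
  case (Suc k)
  then have d: "\<And>x. f differentiable (at x)" "\<And>x. g differentiable (at x)" unfolding Ck_Suc_dd by auto
  have "dd b (\<lambda>x. f x * g x) = (\<lambda>x. f x * dd b g x + dd b f x * g x)" for b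
    by (rule ext) (rule dd_mult[OF d])
  moreover have "Ck k (\<lambda>x. f x * dd b g x + dd b f x * g x)" if "b \<in> Basis" for b
    using Suc.prems[THEN Ck_SucD] Suc.prems that unfolding Ck_Suc_dd
    by (intro Ck_add Suc.IH) auto
  ultimately show ?case using d unfolding Ck_Suc_dd by (auto intro: differentiable_mult)
qed

lemma smooth_Ck: "smooth f \<Longrightarrow> Ck k f"
  unfolding smooth_def by blast

lemma smooth_continuous: "smooth f \<Longrightarrow> continuous_on UNIV f"
  using smooth_Ck[of f 0] by simp

lemma smooth_differentiable: "smooth f \<Longrightarrow> f differentiable (at x)"
  using smooth_Ck[of f "Suc 0"] unfolding Ck_Suc_dd by blast

lemma smooth_const: "smooth (\<lambda>_. c)"
  unfolding smooth_def using Ck_const by blast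

lemma smooth_add: "smooth f \<Longrightarrow> smooth g \<Longrightarrow> smooth (\<lambda>x. f x + g x)"
  unfolding smooth_def using Ck_add by blast

lemma smooth_mult: "smooth f \<Longrightarrow> smooth g \<Longrightarrow> smooth (\<lambda>x. f x * g x)"
  unfolding smooth_def using Ck_mult by blast

lemma smooth_sum: "(\<And>i. i \<in> I \<Longrightarrow> smooth (f i)) \<Longrightarrow> smooth (\<lambda>x. \<Sum>i\<in>I. f i x)"
  by (induction I rule: infinite_finite_induct) (auto intro: smooth_const smooth_add)

lemma dd_basis: "smooth f \<Longrightarrow> dd v f x = (\<Sum>b\<in>Basis. (v \<bullet> b) * dd b f x)"
proof -
  assume "smooth f"
  then have "linear (frechet_derivative f (at x))"
    using smooth_differentiable linear_frechet_derivative by blast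
  then have "frechet_derivative f (at x) (\<Sum>b\<in>Basis. (v \<bullet> b) *\<^sub>R b) = (\<Sum>b\<in>Basis. (v \<bullet> b) * frechet_derivative f (at x) b)"
    by (simp add: linear_sum linear_cmul)
  then show ?thesis unfolding dd_def by (simp add: euclidean_representation)
qed

lemma smooth_dd: "smooth f \<Longrightarrow> smooth (dd v f)"
proof -
  assume f: "smooth f"
  have "smooth (dd b f)" if "b \<in> Basis" for b
    unfolding smooth_def using smooth_Ck[OF f] that Ck_Suc_dd by blast
  then have "smooth (\<lambda>x. \<Sum>b\<in>Basis. (v \<bullet> b) * dd b f x)"
    by (intro smooth_sum smooth_mult smooth_const)
  moreover have "dd v f = (\<lambda>x. \<Sum>b\<in>Basis. (v \<bullet> b) * dd b f x)"
    by (rule ext) (rule dd_basis[OF f])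
  ultimately show ?thesis by simp
qed

lemma dd_line: "smooth f \<Longrightarrow> ((\<lambda>r. f (p + r *\<^sub>R v)) has_real_derivative dd v f (p + r *\<^sub>R v)) (at r)"
proof -
  assume f: "smooth f"
  have "((\<lambda>r. p + r *\<^sub>R v) has_derivative (\<lambda>h. h *\<^sub>R v)) (at r)"
    by (auto intro!: derivative_eq_intros)
  moreover have D: "(f has_derivative frechet_derivative f (at (p + r *\<^sub>R v))) (at (p + r *\<^sub>R v))"
    using smooth_differentiable[OF f] by (simp add: frechet_derivative_works)
  ultimately have "((\<lambda>r. f (p + r *\<^sub>R v)) has_derivative (\<lambda>h. frechet_derivative f (at (p + r *\<^sub>R v)) (h *\<^sub>R v))) (at r)"
    by (rule has_derivative_compose)
  moreover have "(\<lambda>h. frechet_derivative f (at (p + r *\<^sub>R v)) (h *\<^sub>R v)) = (*) (dd v f (p + r *\<^sub>R v))"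
    using has_derivative_linear[OF D] by (auto simp: dd_def linear_cmul mult.commute)
  ultimately show ?thesis by (simp add: has_field_derivative_def)
qed

lemma dd_sum_cmult:
  assumes "\<And>i. i \<in> I \<Longrightarrow> smooth (f i)"
  shows "dd v (\<lambda>x. \<Sum>i\<in>I. c i * f i x) x = (\<Sum>i\<in>I. c i * dd v (f i) x)"
proof -
  have "((\<lambda>x. \<Sum>i\<in>I. c i * f i x) has_derivative (\<lambda>h. \<Sum>i\<in>I. c i * frechet_derivative (f i) (at x) h)) (at x)"
    using assms smooth_differentiable frechet_derivative_works
    by (intro has_derivative_sum has_derivative_mult_right) blast
  from dd_eqI[OF this] show ?thesis unfolding dd_def by simp
qed

lemma smooth_ddn: "smooth f \<Longrightarrow> smooth ((dd v ^^ n) f)"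
  by (induction n) (auto intro: smooth_dd)

lemma ddn_sum_cmult:
  assumes "\<And>i. i \<in> I \<Longrightarrow> smooth (f i)"
  shows "(dd v ^^ n) (\<lambda>x. \<Sum>i\<in>I. c i * f i x) = (\<lambda>x. \<Sum>i\<in>I. c i * (dd v ^^ n) (f i) x)"
  using assms
proof (induction n)
  case (Suc n)
  have "dd v (\<lambda>x. \<Sum>i\<in>I. c i * (dd v ^^ n) (f i) x) x = (\<Sum>i\<in>I. c i * dd v ((dd v ^^ n) (f i)) x)" for x
    by (rule dd_sum_cmult) (rule smooth_ddn[OF Suc.prems])
  then show ?case by (simp add: Suc.IH[OF Suc.prems])
qed simp

text \<open>Peeling off the innermost derivative leaves an n-fold derivative of the fixed function
  \<open>dd b f\<close>; the peeled one contributes only the coefficients v \<bullet> b. Inductions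
  on n with varying f rest on this.\<close>

lemma ddn_Suc_basis:
  assumes "smooth f"
  shows "(dd v ^^ Suc n) f x = (\<Sum>b\<in>Basis. (v \<bullet> b) * (dd v ^^ n) (dd b f) x)"
proof -
  have "(dd v ^^ Suc n) f = (dd v ^^ n) (dd v f)"
    by (simp only: funpow_Suc_right o_apply)
  also have "dd v f = (\<lambda>x. \<Sum>b\<in>Basis. (v \<bullet> b) * dd b f x)"
    by (rule ext) (rule dd_basis[OF assms])
  also have "(dd v ^^ n) \<dots> = (\<lambda>x. \<Sum>b\<in>Basis. (v \<bullet> b) * (dd v ^^ n) (dd b f) x)"
    by (rule ddn_sum_cmult) (rule smooth_dd[OF assms])
  finally show ?thesis by simp
qed

lemma ddn_continuous:
  "smooth f \<Longrightarrow> continuous_on UNIV (\<lambda>z. (dd (fst z) ^^ n) f (snd z))"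
proof (induction n arbitrary: f)
  case 0
  then show ?case
    using continuous_on_compose2[OF smooth_continuous[OF 0] continuous_on_snd[OF continuous_on_id]] by auto
next
  case (Suc n)
  then show ?case unfolding ddn_Suc_basis[OF Suc.prems]
    by (intro continuous_intros Suc.IH smooth_dd)
qed

section \<open>Supports, uniform bounds and averages of test functions\<close>

lemma closure_subset_compact:
  fixes A :: "'a::t2_space set"
  assumes "compact K" "A \<subseteq> K"
  shows "compact (closure A)" "closure A \<subseteq> K"
proof -
  show s: "closure A \<subseteq> K" using assms by (simp add: closure_minimal compact_imp_closed)
  then show "compact (closure A)"
    using compact_Int_closed[OF assms(1) closed_closure[of A]] by (simp add: inf.absorb2)
qed

lemma ddn_outside_support:
  assumes "x \<notin> closure {x. f x \<noteq> 0}"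
  shows "(dd v ^^ n) f x = 0"
  using assms
proof (induction n arbitrary: x)
  case 0
  then show ?case using closure_subset[of "{x. f x \<noteq> 0}"] by auto
next
  case (Suc n)
  have "((dd v ^^ n) f has_derivative (\<lambda>_. 0)) (at x)"
  proof (rule has_derivative_transform_within_open[where s = "- closure {x. f x \<noteq> 0}"])
    show "((\<lambda>_. 0) has_derivative (\<lambda>_. 0)) (at x)" by simp
    show "open (- closure {x. f x \<noteq> 0})" by (rule open_Compl) simp
  qed (use Suc in auto)
  from dd_eqI[OF this] show ?case by simp
qed

lemma test_function_smooth: "test_function V f \<Longrightarrow> smooth f"
  by (simp add: test_function_def)

lemma test_function_dd:
  assumes "test_function V f" shows "test_function V (dd v f)"
proof -
  have "{x. dd v f x \<noteq> 0} \<subseteq> closure {x. f x \<noteq> 0}"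
    using ddn_outside_support[of _ f 1 v] by auto
  from closure_subset_compact[OF _ this] show ?thesis
    using assms smooth_dd unfolding test_function_def by blast
qed

lemma test_function_sum_cmult:
  assumes "finite I" "\<And>i. i \<in> I \<Longrightarrow> test_function V (f i)"
  shows "test_function V (\<lambda>x. \<Sum>i\<in>I. c i * f i x)"
proof -
  let ?S = "\<lambda>f. closure {x. f x \<noteq> 0}"
  have sub: "{x. (\<Sum>i\<in>I. c i * f i x) \<noteq> 0} \<subseteq> (\<Union>i\<in>I. ?S (f i))"
  proof
    fix x assume "x \<in> {x. (\<Sum>i\<in>I. c i * f i x) \<noteq> 0}"
    then obtain i where "i \<in> I" "f i x \<noteq> 0" by (metis (mono_tags, lifting) mem_Collect_eq mult_zero_right sum.neutral)
    then show "x \<in> (\<Union>i\<in>I. ?S (f i))" using closure_subset[of "{x. f i x \<noteq> 0}"] by auto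
  qed
  have K: "compact (\<Union>i\<in>I. ?S (f i))" "(\<Union>i\<in>I. ?S (f i)) \<subseteq> V"
    using assms unfolding test_function_def by (auto intro!: compact_UN)
  have "smooth (\<lambda>x. \<Sum>i\<in>I. c i * f i x)"
    using assms unfolding test_function_def by (intro smooth_sum smooth_mult smooth_const) auto
  then show ?thesis unfolding test_function_def using closure_subset_compact[OF K(1) sub] K(2) by blast
qed

lemma ddn_bounded:
  assumes "test_function V f"
  shows "\<exists>B\<ge>0. \<forall>v p. norm v \<le> 1 \<longrightarrow> \<bar>(dd v ^^ n) f p\<bar> \<le> B"
proof -
  let ?K = "cball (0::'a) 1 \<times> closure {x. f x \<noteq> 0}"
  have "compact ?K" using assms unfolding test_function_def by (intro compact_Times) auto
  then have "compact ((\<lambda>z. (dd (fst z) ^^ n) f (snd z)) ` ?K)"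
    by (intro compact_continuous_image continuous_on_subset[OF ddn_continuous[OF test_function_smooth[OF assms]]] subset_UNIV)
  then have "bounded ((\<lambda>z. (dd (fst z) ^^ n) f (snd z)) ` ?K)" by (rule compact_imp_bounded)
  then obtain B where B: "\<forall>y\<in>(\<lambda>z. (dd (fst z) ^^ n) f (snd z)) ` ?K. norm y \<le> B"
    unfolding bounded_iff by (elim exE)
  have "\<bar>(dd v ^^ n) f p\<bar> \<le> max B 0" if "norm v \<le> 1" for v p
  proof (cases "p \<in> closure {x. f x \<noteq> 0}")
    case True
    then have "(dd v ^^ n) f p \<in> (\<lambda>z. (dd (fst z) ^^ n) f (snd z)) ` ?K"
      using that by (intro image_eqI[of _ _ "(v, p)"]) auto
    from bspec[OF B this] show ?thesis by simp
  next
    case False then show ?thesis by (simp add: ddn_outside_support)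
  qed
  then show ?thesis by (intro exI[of _ "max B 0"]) auto
qed

text \<open>An n-fold derivative along \<open>v s\<close> is a combination of partial derivatives of
  f with coefficients polynomial in \<open>v s\<close>, so averaging acts on the coefficients alone
  and differentiation under the integral is avoided. The weight p generalises the claim so that the
  induction can absorb each factor \<open>v s \<bullet> b\<close> into it.\<close>

lemma ddn_average_test_function:
  fixes v :: "'b \<Rightarrow> 'a::euclidean_space"
  assumes fin: "finite_measure M" and v: "v \<in> borel_measurable M" "\<And>s. norm (v s) \<le> 1"
    and f: "test_function V f"
    and p: "p \<in> borel_measurable M" "\<And>s. \<bar>p s\<bar> \<le> C"
  shows "\<exists>\<theta>. test_function V \<theta> \<and> (\<forall>x. (\<integral>s. p s * (dd (v s) ^^ n) f x \<partial>M) = \<theta> x)"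
  using f p
proof (induction n arbitrary: f p)
  case 0
  have "test_function V (\<lambda>x. \<Sum>i\<in>{()}. (\<integral>s. p s \<partial>M) * f x)"
    using 0 by (intro test_function_sum_cmult) auto
  then show ?case by (intro exI[of _ "\<lambda>x. (\<integral>s. p s \<partial>M) * f x"]) auto
next
  case (Suc n)
  interpret finite_measure M by fact
  define P where "P b \<theta> \<longleftrightarrow> test_function V \<theta> \<and>
    (\<forall>x. (\<integral>s. (p s * (v s \<bullet> b)) * (dd (v s) ^^ n) (dd b f) x \<partial>M) = \<theta> x)" for b \<theta>
  have "\<exists>\<theta>. P b \<theta>" if "b \<in> Basis" for b
    unfolding P_def
  proof (rule Suc.IH)
    show "test_function V (dd b f)" using Suc.prems(1) by (rule test_function_dd)
    show "(\<lambda>s. p s * (v s \<bullet> b)) \<in> borel_measurable M" using Suc.prems(2) v(1) by measurable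
    show "\<bar>p s * (v s \<bullet> b)\<bar> \<le> C" for s
    proof -
      have "\<bar>v s \<bullet> b\<bar> \<le> 1" using Basis_le_norm[OF that, of "v s"] v(2)[of s] by linarith
      then have "\<bar>p s\<bar> * \<bar>v s \<bullet> b\<bar> \<le> C * 1"
        using Suc.prems(3)[of s] order_trans[OF abs_ge_zero Suc.prems(3)[of s]] by (intro mult_mono) auto
      then show ?thesis by (simp add: abs_mult)
    qed
  qed
  then obtain \<theta> where "\<And>b. b \<in> Basis \<Longrightarrow> P b (\<theta> b)" by metis
  then have \<theta>: "\<And>b. b \<in> Basis \<Longrightarrow> test_function V (\<theta> b)"
    "\<And>b x. b \<in> Basis \<Longrightarrow> (\<integral>s. (p s * (v s \<bullet> b)) * (dd (v s) ^^ n) (dd b f) x \<partial>M) = \<theta> b x" unfolding P_def by blast+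
  have "(\<integral>s. p s * (dd (v s) ^^ Suc n) f x \<partial>M) = (\<Sum>b\<in>Basis. 1 * \<theta> b x)" for x
  proof -
    have int: "integrable M (\<lambda>s. (p s * (v s \<bullet> b)) * (dd (v s) ^^ n) (dd b f) x)" if b: "b \<in> Basis" for b
    proof -
      obtain B where B: "B \<ge> 0" "\<And>v p. norm v \<le> 1 \<Longrightarrow> \<bar>(dd v ^^ n) (dd b f) p\<bar> \<le> B"
        using ddn_bounded[OF test_function_dd[OF Suc.prems(1)]] by blast
      have "continuous_on UNIV (\<lambda>w. (dd w ^^ n) (dd b f) x)"
        using continuous_on_compose2[OF ddn_continuous[OF smooth_dd[OF test_function_smooth[OF Suc.prems(1)]]]
            continuous_on_Pair[OF continuous_on_id continuous_on_const]] by simp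
      then have "(\<lambda>w. (dd w ^^ n) (dd b f) x) \<in> borel_measurable borel"
        by (rule borel_measurable_continuous_onI)
      then have m: "(\<lambda>s. (dd (v s) ^^ n) (dd b f) x) \<in> borel_measurable M"
        by (rule measurable_compose[OF v(1)])
      show ?thesis
      proof (rule integrable_const_bound[where B = "C * 1 * B"])
        have "\<bar>v s \<bullet> b\<bar> \<le> 1" for s using Basis_le_norm[OF b, of "v s"] v(2)[of s] by linarith
        then have "\<bar>p s\<bar> * \<bar>v s \<bullet> b\<bar> * \<bar>(dd (v s) ^^ n) (dd b f) x\<bar> \<le> C * 1 * B" for s
          using Suc.prems(3)[of s] B(1) B(2)[OF v(2)[of s]] order_trans[OF abs_ge_zero Suc.prems(3)[of s]]
          by (intro mult_mono) auto
        then show "AE s in M. norm (p s * (v s \<bullet> b) * (dd (v s) ^^ n) (dd b f) x) \<le> C * 1 * B"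
          by (simp add: abs_mult)
        show "(\<lambda>s. p s * (v s \<bullet> b) * (dd (v s) ^^ n) (dd b f) x) \<in> borel_measurable M"
          using Suc.prems(2) v(1) m by measurable
      qed
    qed
    have "(\<integral>s. p s * (dd (v s) ^^ Suc n) f x \<partial>M) = (\<integral>s. (\<Sum>b\<in>Basis. (p s * (v s \<bullet> b)) * (dd (v s) ^^ n) (dd b f) x) \<partial>M)"
      unfolding ddn_Suc_basis[OF test_function_smooth[OF Suc.prems(1)]] by (simp add: sum_distrib_left mult.assoc)
    also have "\<dots> = (\<Sum>b\<in>Basis. \<theta> b x)"
      using int \<theta>(2) by (subst Bochner_Integration.integral_sum) auto
    finally show ?thesis by simp
  qed
  then show ?case using test_function_sum_cmult[of Basis V \<theta> "\<lambda>_. 1"] \<theta>(1) by auto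
qed

lemma kdiff_smooth_line: "smooth f \<Longrightarrow> kdiff k S (\<lambda>r. f (p + r *\<^sub>R v))"
proof (induction k arbitrary: f)
  case (Suc k)
  then show ?case unfolding kdiff.simps
    by (intro exI[of _ "\<lambda>r. dd v f (p + r *\<^sub>R v)"] conjI ballI dd_line Suc.IH smooth_dd)
qed simp

section \<open>Smooth bump functions\<close>

text \<open>With y = 1/x, the x-derivative of P(y) exp (-y) is y^2 (P - P')(y) exp (-y). Iterating
  from P = 1 yields all derivatives of the flat function exp (-1/x).\<close>

definition flat_poly :: "nat \<Rightarrow> real poly" where
  "flat_poly n = ((\<lambda>p. [:0, 0, 1:] * (p - pderiv p)) ^^ n) 1"

definition flat_deriv :: "nat \<Rightarrow> real \<Rightarrow> real" where
  "flat_deriv n x = (if x > 0 then poly (flat_poly n) (1 / x) * exp (- (1 / x)) else 0)"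

lemma poly_exp_tendsto_0: "((\<lambda>x::real. poly p x * exp (- x)) \<longlongrightarrow> 0) at_top"
proof -
  have "((\<lambda>x::real. \<Sum>i\<le>degree p. coeff p i * (x ^ i / exp x)) \<longlongrightarrow> (\<Sum>i\<le>degree p. coeff p i * 0)) at_top"
    by (intro tendsto_intros tendsto_power_div_exp_0)
  then show ?thesis
    by (simp add: poly_altdef exp_minus sum_distrib_right divide_inverse mult.assoc)
qed

lemma flat_deriv_derivative: "(flat_deriv n has_real_derivative flat_deriv (Suc n) x) (at x)"
proof (cases x "0::real" rule: linorder_cases)
  case less
  have "((\<lambda>_. 0) has_real_derivative 0) (at x)" by simp
  then have "(flat_deriv n has_real_derivative 0) (at x)"
    by (rule has_field_derivative_transform_within_open[of _ _ _ "{..<0}"]) (use less in \<open>auto simp: flat_deriv_def\<close>)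
  then show ?thesis using less by (simp add: flat_deriv_def)
next
  case greater
  have "((\<lambda>x. poly (flat_poly n) (1 / x) * exp (- (1 / x))) has_real_derivative
     poly (pderiv (flat_poly n)) (1 / x) * (- 1 / x^2) * exp (- (1 / x)) + exp (- (1 / x)) * (1 / x^2) * poly (flat_poly n) (1 / x)) (at x)"
  proof (rule DERIV_mult)
    have i: "((\<lambda>x. 1 / x) has_real_derivative - 1 / x^2) (at x)"
      using greater by (auto intro!: derivative_eq_intros simp: power2_eq_square)
    show "((\<lambda>x. poly (flat_poly n) (1 / x)) has_real_derivative poly (pderiv (flat_poly n)) (1 / x) * (- 1 / x\<^sup>2)) (at x)"
      by (rule DERIV_chain2[OF poly_DERIV i])
    show "((\<lambda>x. exp (- (1 / x))) has_real_derivative exp (- (1 / x)) * (1 / x\<^sup>2)) (at x)"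
      using DERIV_chain2[OF DERIV_exp DERIV_minus[OF i]] by simp
  qed
  moreover have "poly (pderiv (flat_poly n)) (1 / x) * (- 1 / x^2) * exp (- (1 / x)) + exp (- (1 / x)) * (1 / x^2) * poly (flat_poly n) (1 / x)
      = flat_deriv (Suc n) x"
    using greater by (simp add: flat_deriv_def flat_poly_def power2_eq_square field_simps)
  ultimately have "((\<lambda>x. poly (flat_poly n) (1 / x) * exp (- (1 / x))) has_real_derivative flat_deriv (Suc n) x) (at x)" by simp
  then show ?thesis
    by (rule has_field_derivative_transform_within_open[of _ _ _ "{0<..}"]) (use greater in \<open>auto simp: flat_deriv_def\<close>)
next
  case equal
  have l: "((\<lambda>h. flat_deriv n h / h) \<longlongrightarrow> 0) (at_left 0)"
  proof (rule tendsto_eventually)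
    show "\<forall>\<^sub>F h in at_left (0::real). flat_deriv n h / h = 0"
      unfolding eventually_at_filter by (simp add: flat_deriv_def)
  qed
  \<comment> \<open>From the right, the difference quotient at 0 is again a polynomial in y = 1/h
    times exp (-y), with one more factor y.\<close>
  have "((\<lambda>h. poly ([:0,1:] * flat_poly n) (inverse h) * exp (- inverse h)) \<longlongrightarrow> 0) (at_right (0::real))"
    by (rule filterlim_compose[OF poly_exp_tendsto_0 filterlim_inverse_at_top_right])
  moreover have "\<forall>\<^sub>F h in at_right (0::real). poly ([:0,1:] * flat_poly n) (inverse h) * exp (- inverse h) = flat_deriv n h / h"
    unfolding eventually_at_filter by (simp add: flat_deriv_def field_simps)
  ultimately have r: "((\<lambda>h. flat_deriv n h / h) \<longlongrightarrow> 0) (at_right 0)"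
    by (rule Lim_transform_eventually)
  show ?thesis
    unfolding equal DERIV_def using filterlim_split_at[OF l r] by (simp add: flat_deriv_def)
qed

lemma Ck_inner: "Ck k (\<lambda>p. p \<bullet> b)"
proof (cases k)
  case (Suc n)
  have "dd c (\<lambda>p. p \<bullet> b) = (\<lambda>_. c \<bullet> b)" for c
    by (rule ext, rule dd_eqI) (auto intro!: derivative_eq_intros)
  then show ?thesis unfolding Suc Ck_Suc_dd using Ck_const by (auto intro!: derivative_intros)
qed (auto intro: continuous_intros)

text \<open>Claimed for all members of the sequence at once, since each differentiation passes from
  \<open>D j\<close> to \<open>D (Suc j)\<close> and multiplies by a linear function of p.\<close>

lemma Ck_radial:
  assumes D: "\<And>j x. (D j has_real_derivative D (Suc j) x) (at x)"
  shows "Ck k (\<lambda>p::'a::euclidean_space. D j (c - p \<bullet> p))"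
proof (induction k arbitrary: j)
  have d: "((\<lambda>p::'a. D j (c - p \<bullet> p)) has_derivative (\<lambda>h. D (Suc j) (c - p \<bullet> p) * (- 2 * (p \<bullet> h)))) (at p)" for j p
  proof -
    have "((\<lambda>p::'a. c - p \<bullet> p) has_derivative (\<lambda>h. - 2 * (p \<bullet> h))) (at p)"
      by (auto intro!: derivative_eq_intros simp: inner_commute)
    from has_derivative_compose[OF this D[unfolded has_field_derivative_def]] show ?thesis .
  qed
  {
    case 0
    show ?case using d has_derivative_continuous by (auto simp: continuous_on_eq_continuous_at) blast
  next
    case (Suc k)
    have "dd b (\<lambda>p::'a. D j (c - p \<bullet> p)) = (\<lambda>p. D (Suc j) (c - p \<bullet> p) * (- 2 * (p \<bullet> b)))" for b
      by (rule ext, rule dd_eqI, rule d)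
    moreover have "Ck k (\<lambda>p::'a. D (Suc j) (c - p \<bullet> p) * (- 2 * (p \<bullet> b)))" for b
      by (intro Ck_mult Suc.IH Ck_const Ck_inner)
    ultimately have "Ck k (dd b (\<lambda>p::'a. D j (c - p \<bullet> p)))" for b by (simp only:)
    moreover have "(\<lambda>p::'a. D j (c - p \<bullet> p)) differentiable at p" for p
      using d unfolding differentiable_def by blast
    ultimately show ?case unfolding Ck_Suc_dd by blast
  }
qed

text \<open>These are the amplitudes on which leading coefficients are tested. The argument e^2 -
  |p|^2 is polynomial in p, so the composition with the flat function is smooth also at the
  centre.\<close>

lemma bump_exists:
  fixes V :: "'a::euclidean_space set"
  assumes "open V" "0 \<in> V"
  shows "\<exists>\<phi>. test_function V \<phi> \<and> (\<forall>x. 0 \<le> \<phi> x) \<and> 0 < \<phi> 0"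
proof -
  obtain e where e: "e > 0" "cball 0 e \<subseteq> V" using assms open_contains_cball by blast
  define \<phi> where "\<phi> p = flat_deriv 0 (e\<^sup>2 - p \<bullet> p)" for p :: 'a
  have p0: "flat_poly 0 = 1" by (simp add: flat_poly_def)
  have "smooth \<phi>" unfolding smooth_def \<phi>_def using Ck_radial[of flat_deriv, OF flat_deriv_derivative] by blast
  moreover have "{x. \<phi> x \<noteq> 0} \<subseteq> cball 0 e"
  proof
    fix x assume "x \<in> {x. \<phi> x \<noteq> 0}"
    then have "(norm x)\<^sup>2 < e\<^sup>2" by (auto simp: \<phi>_def flat_deriv_def power2_norm_eq_inner split: if_splits)
    then show "x \<in> cball 0 e" using e power2_less_imp_less[of "norm x" e] by simp
  qed
  then have "compact (closure {x. \<phi> x \<noteq> 0})" "closure {x. \<phi> x \<noteq> 0} \<subseteq> cball 0 e"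
    using closure_subset_compact[OF compact_cball] by blast+
  ultimately have "test_function V \<phi>" unfolding test_function_def using e by auto
  moreover have "0 \<le> \<phi> x" for x by (simp add: \<phi>_def flat_deriv_def p0)
  moreover have "0 < \<phi> 0" using e by (simp add: \<phi>_def flat_deriv_def p0)
  ultimately show ?thesis by blast
qed

section \<open>Cylindrical coordinates\<close>

text \<open>The unit vector of slope s, so s is the tangent of the polar angle. With r of either
  sign every line through the axis is counted once, except the one of infinite slope.\<close>

definition direction :: "real \<Rightarrow> real ^ 3" where
  "direction s = (1 / sqrt (1 + s\<^sup>2)) *\<^sub>R (axis 2 1 + s *\<^sub>R axis 3 1)"

text \<open>The angle measure in the tangent parameter, by d(arctan s) = ds / (1 + s^2).\<close>

definition direction_measure :: "real measure" where
  "direction_measure = density lborel (\<lambda>s. ennreal (1 / (1 + s\<^sup>2)))"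

lemma sets_direction_measure [simp, measurable_cong]: "sets direction_measure = sets borel"
  by (simp add: direction_measure_def)

lemma space_direction_measure [simp]: "space direction_measure = UNIV"
  by (simp add: direction_measure_def)

lemma one_plus_square_pos: "0 < 1 + (s::real)\<^sup>2"
  by (simp add: add_pos_nonneg)

lemma finite_direction_measure: "finite_measure direction_measure"
proof
  let ?f = "\<lambda>s::real. ennreal (1 / (1 + s\<^sup>2))"
  have "(\<integral>\<^sup>+s. ?f s * indicator {0..} s \<partial>lborel) = ennreal (pi / 2 - arctan 0)"
    by (rule nn_integral_FTC_atLeast)
       (auto intro!: derivative_eq_intros tendsto_arctan_at_top simp: one_plus_square_pos inverse_eq_divide)
  then have half: "(\<integral>\<^sup>+s. ?f s * indicator {0..} s \<partial>lborel) < \<infinity>" by simp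
  have "(\<integral>\<^sup>+s. ?f s * indicator {..0} s \<partial>lborel) = (\<integral>\<^sup>+s. ?f s * indicator {0..} s \<partial>lborel)"
    by (subst nn_integral_real_affine[where c = "-1" and t = 0])
       (auto intro!: nn_integral_cong split: split_indicator)
  with half have "(\<integral>\<^sup>+s. ?f s * indicator {0..} s \<partial>lborel) + (\<integral>\<^sup>+s. ?f s * indicator {..0} s \<partial>lborel) < \<infinity>"
    by (simp add: less_top)
  moreover have "(\<integral>\<^sup>+s. ?f s \<partial>lborel) \<le> (\<integral>\<^sup>+s. ?f s * indicator {0..} s \<partial>lborel) + (\<integral>\<^sup>+s. ?f s * indicator {..0} s \<partial>lborel)"
    by (subst nn_integral_add[symmetric]) (auto intro!: nn_integral_mono split: split_indicator)
  ultimately have "(\<integral>\<^sup>+s. ?f s \<partial>lborel) < \<infinity>" by (rule le_less_trans[rotated])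
  then show "emeasure direction_measure (space direction_measure) \<noteq> \<infinity>"
    by (simp add: direction_measure_def emeasure_density)
qed

lemma direction_component [simp]:
  "direction s $ 1 = 0" "direction s $ 2 = 1 / sqrt (1 + s\<^sup>2)" "direction s $ 3 = s / sqrt (1 + s\<^sup>2)"
  by (simp_all add: direction_def axis_def)

lemma norm_direction: "norm (direction s) = 1"
proof -
  have "(direction s $ 1)\<^sup>2 + (direction s $ 2)\<^sup>2 + (direction s $ 3)\<^sup>2 = 1"
    using one_plus_square_pos[of s] by (simp add: power_divide add_divide_distrib[symmetric])
  then show ?thesis by (simp add: norm_vec_def L2_set_def sum_3)
qed

lemma continuous_direction: "continuous_on UNIV direction"
  unfolding direction_def using one_plus_square_pos
  by (intro continuous_intros) (auto simp: less_imp_neq[THEN not_sym])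

lemma measurable_direction [measurable]: "direction \<in> borel_measurable borel"
  using continuous_direction by (rule borel_measurable_continuous_onI)

definition vec3 :: "real \<times> real \<times> real \<Rightarrow> real ^ 3" where
  "vec3 = (\<lambda>(x, y, z). x *\<^sub>R axis 1 1 + y *\<^sub>R axis 2 1 + z *\<^sub>R axis 3 1)"

lemma vec3_component [simp]: "vec3 (x, y, z) $ 1 = x" "vec3 (x, y, z) $ 2 = y" "vec3 (x, y, z) $ 3 = z"
  by (simp_all add: vec3_def axis_def)

lemma measurable_vec3 [measurable]: "vec3 \<in> borel_measurable borel"
  unfolding vec3_def case_prod_beta by (intro borel_measurable_continuous_onI continuous_intros)

lemma Basis_3: "(Basis :: (real ^ 3) set) = {axis 1 1, axis 2 1, axis 3 1}"
  unfolding Basis_vec_def by (auto simp: UNIV_3)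

lemma emeasure_lborel_Times:
  fixes A :: "'a::euclidean_space set" and B :: "'b::euclidean_space set"
  assumes "A \<in> sets borel" "B \<in> sets borel"
  shows "emeasure lborel (A \<times> B) = emeasure lborel A * emeasure lborel B"
  unfolding lborel_prod[symmetric] using assms by (simp add: lborel.emeasure_pair_measure_Times)

lemma lborel_vec3: "distr lborel borel vec3 = lborel"
proof (rule lborel_eqI[symmetric])
  fix l u :: "real ^ 3" assume lu: "\<And>b. b \<in> Basis \<Longrightarrow> l \<bullet> b \<le> u \<bullet> b"
  then have le: "l $ 1 \<le> u $ 1" "l $ 2 \<le> u $ 2" "l $ 3 \<le> u $ 3"
    using lu[of "axis 1 1"] lu[of "axis 2 1"] lu[of "axis 3 1"] by (auto simp: Basis_3 inner_axis)
  have "vec3 -` box l u = {l $ 1 <..< u $ 1} \<times> {l $ 2 <..< u $ 2} \<times> {l $ 3 <..< u $ 3}"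
    by (auto simp: box_def Basis_3 inner_axis)
  then have "emeasure (distr lborel borel vec3) (box l u) =
      emeasure lborel ({l $ 1 <..< u $ 1} \<times> {l $ 2 <..< u $ 2} \<times> {l $ 3 <..< u $ 3})"
    by (simp add: emeasure_distr)
  also have "\<dots> = ennreal (u $ 1 - l $ 1) * (ennreal (u $ 2 - l $ 2) * ennreal (u $ 3 - l $ 3))"
    using le by (simp add: emeasure_lborel_Times borel_Times)
  also have "\<dots> = ennreal (\<Prod>b\<in>Basis. (u - l) \<bullet> b)"
    using le by (simp add: Basis_3 inner_axis axis_eq_axis ennreal_mult' mult.assoc)
  finally show "emeasure (distr lborel borel vec3) (box l u) = ennreal (\<Prod>b\<in>Basis. (u - l) \<bullet> b)" .
qed simp

text \<open>
  Polar coordinates without angles: substitute $z = y s$ and then $y = r / \sqrt{1 + s^2}$, so that only linear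
  substitutions in one variable are needed. The pairs $(s, r)$ with $r \in \mathbb{R}$ cover the plane once.
\<close>

lemma nn_integral_polar:
  fixes f :: "real \<times> real \<Rightarrow> ennreal"
  assumes [measurable]: "f \<in> borel_measurable borel"
  shows "(\<integral>\<^sup>+y. \<integral>\<^sup>+z. f (y, z) \<partial>lborel \<partial>lborel) =
     (\<integral>\<^sup>+s. \<integral>\<^sup>+r. ennreal \<bar>r\<bar> * f (r / sqrt (1 + s\<^sup>2), r * s / sqrt (1 + s\<^sup>2)) \<partial>lborel \<partial>direction_measure)"
proof -
  have [measurable]: "f \<in> borel_measurable (borel \<Otimes>\<^sub>M borel)" by (simp add: borel_prod)
  have "(\<integral>\<^sup>+y. \<integral>\<^sup>+z. f (y, z) \<partial>lborel \<partial>lborel) = (\<integral>\<^sup>+y. ennreal \<bar>y\<bar> * (\<integral>\<^sup>+s. f (y, y * s) \<partial>lborel) \<partial>lborel)"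
  proof (rule nn_integral_cong_AE)
    show "AE y in lborel. (\<integral>\<^sup>+z. f (y, z) \<partial>lborel) = ennreal \<bar>y\<bar> * (\<integral>\<^sup>+s. f (y, y * s) \<partial>lborel)"
      using AE_lborel_singleton[of 0]
    proof eventually_elim
      case (elim y)
      then show ?case using nn_integral_real_affine[of "\<lambda>z. f (y, z)" y 0] by simp
    qed
  qed
  also have "\<dots> = (\<integral>\<^sup>+y. \<integral>\<^sup>+s. ennreal \<bar>y\<bar> * f (y, y * s) \<partial>lborel \<partial>lborel)"
    by (intro nn_integral_cong nn_integral_cmult[symmetric]) measurable
  also have "\<dots> = (\<integral>\<^sup>+s. \<integral>\<^sup>+y. ennreal \<bar>y\<bar> * f (y, y * s) \<partial>lborel \<partial>lborel)"
    by (rule lborel_pair.Fubini') measurable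
  also have "\<dots> = (\<integral>\<^sup>+s. ennreal (1 / (1 + s\<^sup>2)) * (\<integral>\<^sup>+r. ennreal \<bar>r\<bar> * f (r / sqrt (1 + s\<^sup>2), r * s / sqrt (1 + s\<^sup>2)) \<partial>lborel) \<partial>lborel)"
  proof (rule nn_integral_cong)
    fix s :: real
    define c where "c = 1 / sqrt (1 + s\<^sup>2)"
    have c: "c > 0" "c * c = 1 / (1 + s\<^sup>2)" using one_plus_square_pos[of s] by (auto simp: c_def)
    have "(\<integral>\<^sup>+y. ennreal \<bar>y\<bar> * f (y, y * s) \<partial>lborel) = ennreal \<bar>c\<bar> * (\<integral>\<^sup>+r. ennreal \<bar>c * r\<bar> * f (c * r, c * r * s) \<partial>lborel)"
      using c by (subst nn_integral_real_affine[where c = c and t = 0]) auto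
    also have "\<dots> = ennreal c * (\<integral>\<^sup>+r. ennreal c * (ennreal \<bar>r\<bar> * f (c * r, c * r * s)) \<partial>lborel)"
      using c by (simp add: abs_mult ennreal_mult mult.assoc)
    also have "\<dots> = ennreal c * (ennreal c * (\<integral>\<^sup>+r. ennreal \<bar>r\<bar> * f (c * r, c * r * s) \<partial>lborel))"
      by (subst nn_integral_cmult) auto
    also have "\<dots> = ennreal (c * c) * (\<integral>\<^sup>+r. ennreal \<bar>r\<bar> * f (c * r, c * r * s) \<partial>lborel)"
      using c(1) by (simp only: ennreal_mult[OF less_imp_le less_imp_le] mult.assoc)
    finally show "(\<integral>\<^sup>+y. ennreal \<bar>y\<bar> * f (y, y * s) \<partial>lborel) =
        ennreal (1 / (1 + s\<^sup>2)) * (\<integral>\<^sup>+r. ennreal \<bar>r\<bar> * f (r / sqrt (1 + s\<^sup>2), r * s / sqrt (1 + s\<^sup>2)) \<partial>lborel)"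
      unfolding c(2) by (simp add: c_def)
  qed
  also have "\<dots> = (\<integral>\<^sup>+s. \<integral>\<^sup>+r. ennreal \<bar>r\<bar> * f (r / sqrt (1 + s\<^sup>2), r * s / sqrt (1 + s\<^sup>2)) \<partial>lborel \<partial>direction_measure)"
    unfolding direction_measure_def by (subst nn_integral_density) auto
  finally show ?thesis .
qed

definition cyl :: "real \<times> real \<Rightarrow> real \<Rightarrow> real ^ 3" where
  "cyl z r = fst z *\<^sub>R axis 1 1 + r *\<^sub>R direction (snd z)"

lemma cyl_vec3: "cyl (x, s) r = vec3 (x, r / sqrt (1 + s\<^sup>2), r * s / sqrt (1 + s\<^sup>2))"
  by (simp add: cyl_def vec3_def direction_def scaleR_add_right)

lemma continuous_cyl: "continuous_on UNIV (\<lambda>w. cyl (fst w) (snd w))"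
  unfolding cyl_def
  by (intro continuous_intros continuous_on_compose2[OF continuous_direction]) auto

abbreviation axis_measure :: "(real \<times> real) measure" where
  "axis_measure \<equiv> lborel \<Otimes>\<^sub>M direction_measure"

lemma sets_axis_measure [measurable_cong]: "sets axis_measure = sets borel"
  by (rule trans[OF sets_pair_measure_cong[OF sets_lborel sets_direction_measure] arg_cong[OF borel_prod, of sets]])

lemma sigma_finite_axis_measure: "sigma_finite_measure axis_measure"
proof -
  interpret finite_measure direction_measure by (rule finite_direction_measure)
  interpret pair_sigma_finite lborel direction_measure ..
  show ?thesis by (rule sigma_finite_measure_axioms)
qed

abbreviation cyl_measure :: "(real ^ 3) measure" where
  "cyl_measure \<equiv> distr (density (axis_measure \<Otimes>\<^sub>M lborel) (\<lambda>w. ennreal \<bar>snd w\<bar>)) borel (\<lambda>w. cyl (fst w) (snd w))"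

text \<open>Tonelli reduces this to the polar formula in the plane at fixed x. As an equality of
  measures it transfers integrability as well as the values of complex integrals.\<close>

lemma lborel_cyl:
  "cyl_measure = lborel"
proof (rule measure_eqI)
  interpret D: finite_measure direction_measure by (rule finite_direction_measure)
  interpret P: pair_sigma_finite lborel direction_measure ..
  have mc: "(\<lambda>w. cyl (fst w) (snd w)) \<in> borel_measurable borel"
    by (rule borel_measurable_continuous_onI[OF continuous_cyl])
  have sets3: "sets (axis_measure \<Otimes>\<^sub>M lborel) = sets borel"
    by (rule trans[OF sets_pair_measure_cong[OF sets_axis_measure sets_lborel] arg_cong[OF borel_prod, of sets]])
  have [measurable]: "(\<lambda>w. cyl (fst w) (snd w)) \<in> borel_measurable (axis_measure \<Otimes>\<^sub>M lborel)"
    using mc by (simp add: measurable_cong_sets[OF sets3 refl])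
  show "sets (cyl_measure) = sets lborel"
    by simp
  fix A assume "A \<in> sets (cyl_measure)"
  then have A[measurable]: "A \<in> sets borel" by simp
  let ?i = "indicator A :: real ^ 3 \<Rightarrow> ennreal"
  have "emeasure (cyl_measure) A
      = (\<integral>\<^sup>+p. ?i p \<partial>cyl_measure)"
    by simp
  also have "\<dots> = (\<integral>\<^sup>+w. ennreal \<bar>snd w\<bar> * ?i (cyl (fst w) (snd w)) \<partial>(axis_measure \<Otimes>\<^sub>M lborel))"
    by (subst nn_integral_distr) (auto simp: nn_integral_density)
  also have "\<dots> = (\<integral>\<^sup>+z. \<integral>\<^sup>+r. ennreal \<bar>r\<bar> * ?i (cyl z r) \<partial>lborel \<partial>axis_measure)"
    by (subst lborel.nn_integral_fst[symmetric]) auto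
  also have "\<dots> = (\<integral>\<^sup>+x. \<integral>\<^sup>+s. \<integral>\<^sup>+r. ennreal \<bar>r\<bar> * ?i (cyl (x, s) r) \<partial>lborel \<partial>direction_measure \<partial>lborel)"
    by (subst D.nn_integral_fst[symmetric]) auto
  also have "\<dots> = (\<integral>\<^sup>+x. \<integral>\<^sup>+y. \<integral>\<^sup>+z. ?i (vec3 (x, y, z)) \<partial>lborel \<partial>lborel \<partial>lborel)"
  proof (rule nn_integral_cong)
    fix x :: real
    have "(\<lambda>p. vec3 (x, p)) \<in> borel_measurable borel" by measurable
    then have "(\<lambda>p. ?i (vec3 (x, p))) \<in> borel_measurable borel" by measurable
    from nn_integral_polar[OF this] show "(\<integral>\<^sup>+s. \<integral>\<^sup>+r. ennreal \<bar>r\<bar> * ?i (cyl (x, s) r) \<partial>lborel \<partial>direction_measure)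
       = (\<integral>\<^sup>+y. \<integral>\<^sup>+z. ?i (vec3 (x, y, z)) \<partial>lborel \<partial>lborel)"
      by (simp add: cyl_vec3)
  qed
  also have "\<dots> = (\<integral>\<^sup>+x. \<integral>\<^sup>+q. ?i (vec3 (x, q)) \<partial>lborel \<partial>lborel)"
  proof (rule nn_integral_cong)
    fix x :: real
    have "(\<lambda>p. vec3 (x, p)) \<in> borel_measurable borel" by measurable
    then have "(\<lambda>p. ?i (vec3 (x, p))) \<in> borel_measurable (lborel \<Otimes>\<^sub>M lborel)" by (simp add: lborel_prod)
    from lborel.nn_integral_fst[OF this] show "(\<integral>\<^sup>+y. \<integral>\<^sup>+z. ?i (vec3 (x, y, z)) \<partial>lborel \<partial>lborel) = (\<integral>\<^sup>+q. ?i (vec3 (x, q)) \<partial>lborel)"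
      by (simp add: lborel_prod)
  qed
  also have "\<dots> = (\<integral>\<^sup>+w. ?i (vec3 w) \<partial>(lborel \<Otimes>\<^sub>M lborel))"
    by (rule lborel.nn_integral_fst) (simp add: lborel_prod)
  also have "\<dots> = (\<integral>\<^sup>+p. ?i p \<partial>distr lborel borel vec3)"
    unfolding lborel_prod by (subst nn_integral_distr) auto
  also have "\<dots> = emeasure lborel A" by (simp add: lborel_vec3)
  finally show "emeasure (cyl_measure) A = emeasure lborel A" .
qed

lemma integral_cyl:
  fixes F :: "real ^ 3 \<Rightarrow> complex"
  assumes F: "integrable lborel F"
  shows "integrable axis_measure (\<lambda>z. \<integral>r. \<bar>r\<bar> *\<^sub>R F (cyl z r) \<partial>lborel)"
    and "(\<integral>p. F p \<partial>lborel) = (\<integral>z. (\<integral>r. \<bar>r\<bar> *\<^sub>R F (cyl z r) \<partial>lborel) \<partial>axis_measure)"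
proof -
  interpret S: sigma_finite_measure axis_measure by (rule sigma_finite_axis_measure)
  interpret Q: pair_sigma_finite axis_measure lborel ..
  have sets3: "sets (axis_measure \<Otimes>\<^sub>M lborel) = sets borel"
    by (rule trans[OF sets_pair_measure_cong[OF sets_axis_measure sets_lborel] arg_cong[OF borel_prod, of sets]])
  have mc[measurable]: "(\<lambda>w. cyl (fst w) (snd w)) \<in> borel_measurable (axis_measure \<Otimes>\<^sub>M lborel)"
    using borel_measurable_continuous_onI[OF continuous_cyl] by (simp add: measurable_cong_sets[OF sets3 refl])
  have mF[measurable]: "F \<in> borel_measurable borel" using F by (auto dest: borel_measurable_integrable)
  have "integrable (cyl_measure) F"
    unfolding lborel_cyl by (rule F)
  then have int: "integrable (axis_measure \<Otimes>\<^sub>M lborel) (\<lambda>w. \<bar>snd w\<bar> *\<^sub>R F (cyl (fst w) (snd w)))"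
    by (subst (asm) integrable_distr_eq) (auto simp: integrable_density)
  show "integrable axis_measure (\<lambda>z. \<integral>r. \<bar>r\<bar> *\<^sub>R F (cyl z r) \<partial>lborel)"
    using Q.integrable_fst'[OF int] by simp
  have "(\<integral>p. F p \<partial>lborel) = (\<integral>p. F p \<partial>cyl_measure)"
    unfolding lborel_cyl ..
  also have "\<dots> = (\<integral>w. \<bar>snd w\<bar> *\<^sub>R F (cyl (fst w) (snd w)) \<partial>(axis_measure \<Otimes>\<^sub>M lborel))"
    by (subst integral_distr) (auto simp: integral_density)
  also have "\<dots> = (\<integral>z. (\<integral>r. \<bar>r\<bar> *\<^sub>R F (cyl z r) \<partial>lborel) \<partial>axis_measure)"
    using Q.integral_fst'[OF int] by simp
  finally show "(\<integral>p. F p \<partial>lborel) = (\<integral>z. (\<integral>r. \<bar>r\<bar> *\<^sub>R F (cyl z r) \<partial>lborel) \<partial>axis_measure)" .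
qed

lemma direction_components_square:
  "(r / sqrt (1 + s\<^sup>2))\<^sup>2 + (r * s / sqrt (1 + s\<^sup>2))\<^sup>2 = r\<^sup>2"
  using one_plus_square_pos[of s]
  by (simp add: power_divide power_mult_distrib add_divide_distrib[symmetric] nonzero_divide_eq_eq algebra_simps)

lemma Vt_cyl: "Vt t (cyl (x, s) r) = (x ^ 4 + t * x\<^sup>2 + r\<^sup>2)\<^sup>2"
  unfolding Vt_def cyl_vec3 using direction_components_square[of r s] by (simp add: add.assoc)

section \<open>Expansions in negative powers\<close>

text \<open>The step 1/8 is 1 / (2 m) for m = 4; the steps 1/4 and 1/2 of the other terms are
  multiples of it.\<close>

abbreviation inv_power :: "real \<Rightarrow> nat \<Rightarrow> real \<Rightarrow> complex" where
  "inv_power \<beta> j \<equiv> \<lambda>\<Lambda>. complex_of_real (\<Lambda> powr - (\<beta> + real j / 8))"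

text \<open>A Poincare expansion to one order N. The order is a parameter because different N are
  reached with different numbers of integrations by parts, each with its own coefficients.\<close>

definition is_expansion :: "real \<Rightarrow> nat \<Rightarrow> (real \<Rightarrow> complex) \<Rightarrow> (nat \<Rightarrow> complex) \<Rightarrow> bool" where
  "is_expansion \<beta> N f c \<longleftrightarrow>
     (\<lambda>\<Lambda>. f \<Lambda> - (\<Sum>j\<le>N. c j * inv_power \<beta> j \<Lambda>))
       \<in> o[at_top](inv_power \<beta> N)"

lemma powr_smallo:
  assumes "a < b" shows "(\<lambda>\<Lambda>. complex_of_real (\<Lambda> powr - b)) \<in> o[at_top](\<lambda>\<Lambda>. complex_of_real (\<Lambda> powr - a))"
proof (rule smalloI_tendsto)
  have "((\<lambda>\<Lambda>. complex_of_real (\<Lambda> powr - (b - a))) \<longlongrightarrow> complex_of_real 0) at_top"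
    by (intro tendsto_of_real tendsto_neg_powr filterlim_ident) (use assms in auto)
  moreover have "\<forall>\<^sub>F \<Lambda> in at_top. complex_of_real (\<Lambda> powr - (b - a)) = complex_of_real (\<Lambda> powr - b) / complex_of_real (\<Lambda> powr - a)"
    using eventually_gt_at_top[of "0::real"]
    by eventually_elim (simp add: of_real_divide[symmetric] powr_diff[symmetric] del: of_real_divide)
  ultimately show "((\<lambda>\<Lambda>. complex_of_real (\<Lambda> powr - b) / complex_of_real (\<Lambda> powr - a)) \<longlongrightarrow> 0) at_top"
    by (simp add: Lim_transform_eventually)
  show "\<forall>\<^sub>F \<Lambda> in at_top. complex_of_real (\<Lambda> powr - a) \<noteq> 0"
    using eventually_gt_at_top[of "0::real"] by eventually_elim simp
qed

lemma cmult_powr_smallo: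
  "a < b \<Longrightarrow> (\<lambda>\<Lambda>. c * complex_of_real (\<Lambda> powr - b)) \<in> o[at_top](\<lambda>\<Lambda>. complex_of_real (\<Lambda> powr - a))"
  by (cases "c = 0") (simp_all add: powr_smallo)

lemma is_expansion_add:
  "is_expansion \<beta> N f c \<Longrightarrow> is_expansion \<beta> N g d \<Longrightarrow> is_expansion \<beta> N (\<lambda>\<Lambda>. f \<Lambda> + g \<Lambda>) (\<lambda>j. c j + d j)"
  unfolding is_expansion_def
  by (drule (1) sum_in_smallo(1)) (simp add: sum.distrib algebra_simps)

lemma is_expansion_0: "is_expansion \<beta> N (\<lambda>_. 0) (\<lambda>_. 0)"
  by (simp add: is_expansion_def)

lemma is_expansion_sum:
  assumes "\<And>i. i \<in> I \<Longrightarrow> is_expansion \<beta> N (f i) (c i)"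
  shows "is_expansion \<beta> N (\<lambda>\<Lambda>. \<Sum>i\<in>I. f i \<Lambda>) (\<lambda>j. \<Sum>i\<in>I. c i j)"
  using assms by (induction I rule: infinite_finite_induct) (auto intro: is_expansion_0 is_expansion_add)

lemma is_expansion_monomial:
  "is_expansion \<beta> N (\<lambda>\<Lambda>. a * inv_power \<beta> i \<Lambda>) (\<lambda>j. if j = i then a else 0)"
proof (cases "i \<le> N")
  case True
  then show ?thesis unfolding is_expansion_def
    by (simp add: if_distrib[of "\<lambda>x. x * _"] cong: if_cong)
next
  case False
  then have "(\<Sum>j\<le>N. (if j = i then a else 0) * inv_power \<beta> j \<Lambda>) = 0" for \<Lambda>
    by (intro sum.neutral) auto
  moreover have "\<beta> + real N / 8 < \<beta> + real i / 8" using False by simp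
  ultimately show ?thesis unfolding is_expansion_def by (simp only: diff_zero cmult_powr_smallo)
qed

lemma is_expansion_bound:
  assumes "\<And>\<Lambda>. 1 \<le> \<Lambda> \<Longrightarrow> norm (f \<Lambda>) \<le> C * \<Lambda> powr - \<gamma>" and "\<beta> + real N / 8 < \<gamma>"
  shows "is_expansion \<beta> N f (\<lambda>_. 0)"
proof -
  have "f \<in> O[at_top](\<lambda>\<Lambda>. complex_of_real (\<Lambda> powr - \<gamma>))"
    using eventually_mono[OF eventually_ge_at_top[of "1::real"] assms(1)]
    by (intro bigoI[of _ C]) simp
  also have "(\<lambda>\<Lambda>. complex_of_real (\<Lambda> powr - \<gamma>)) \<in> o[at_top](inv_power \<beta> N)"
    by (rule powr_smallo[OF assms(2)])
  finally show ?thesis by (simp add: is_expansion_def)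
qed

lemma is_expansion_truncate:
  assumes "is_expansion \<beta> N f c" "M \<le> N"
  shows "is_expansion \<beta> M f c"
proof (cases "M = N")
  case False
  with assms(2) have MN: "M < N" by simp
  have "(\<lambda>\<Lambda>. f \<Lambda> - (\<Sum>j\<le>N. c j * inv_power \<beta> j \<Lambda>))
       \<in> o[at_top](inv_power \<beta> M)"
    using landau_o.small_trans[OF assms(1)[unfolded is_expansion_def] powr_smallo[of "\<beta> + real M / 8" "\<beta> + real N / 8"]] MN by simp
  moreover have "(\<lambda>\<Lambda>. \<Sum>j\<in>{M<..N}. c j * inv_power \<beta> j \<Lambda>)
       \<in> o[at_top](inv_power \<beta> M)"
  proof (rule big_sum_in_smallo)
    fix j assume "j \<in> {M<..N}"
    then show "(\<lambda>\<Lambda>. c j * inv_power \<beta> j \<Lambda>) \<in> o[at_top](inv_power \<beta> M)"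
      by (intro cmult_powr_smallo) simp
  qed
  ultimately have "(\<lambda>\<Lambda>. (f \<Lambda> - (\<Sum>j\<le>N. c j * inv_power \<beta> j \<Lambda>)) + (\<Sum>j\<in>{M<..N}. c j * inv_power \<beta> j \<Lambda>))
       \<in> o[at_top](inv_power \<beta> M)"
    by (rule sum_in_smallo)
  moreover have "(f \<Lambda> - (\<Sum>j\<le>N. c j * inv_power \<beta> j \<Lambda>)) + (\<Sum>j\<in>{M<..N}. c j * inv_power \<beta> j \<Lambda>)
     = f \<Lambda> - (\<Sum>j\<le>M. c j * inv_power \<beta> j \<Lambda>)" for \<Lambda>
  proof -
    have "{..N} = {..M} \<union> {M<..N}" using MN by auto
    then have "(\<Sum>j\<le>N. c j * inv_power \<beta> j \<Lambda>) =
       (\<Sum>j\<le>M. c j * inv_power \<beta> j \<Lambda>) + (\<Sum>j\<in>{M<..N}. c j * inv_power \<beta> j \<Lambda>)"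
      by (simp only:) (rule sum.union_disjoint, auto)
    then show ?thesis by simp
  qed
  ultimately show ?thesis unfolding is_expansion_def by (simp only:)
qed (use assms in simp)

lemma is_expansion_unique:
  assumes c: "is_expansion \<beta> N f c" and d: "is_expansion \<beta> N f d" and "j \<le> N"
  shows "c j = d j"
  using assms(3)
proof (induction j rule: less_induct)
  case (less j)
  note e = is_expansion_truncate[OF c less.prems] is_expansion_truncate[OF d less.prems]
  have "(\<lambda>\<Lambda>. (f \<Lambda> - (\<Sum>j\<le>j. d j * inv_power \<beta> j \<Lambda>))
        - (f \<Lambda> - (\<Sum>j\<le>j. c j * inv_power \<beta> j \<Lambda>)))
     \<in> o[at_top](inv_power \<beta> j)"
    by (rule sum_in_smallo(2)[OF e(2)[unfolded is_expansion_def] e(1)[unfolded is_expansion_def]])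
  moreover have "(f \<Lambda> - (\<Sum>j\<le>j. d j * inv_power \<beta> j \<Lambda>))
        - (f \<Lambda> - (\<Sum>j\<le>j. c j * inv_power \<beta> j \<Lambda>)) = (c j - d j) * inv_power \<beta> j \<Lambda>" for \<Lambda>
  proof -
    have "(\<Sum>i<j. c i * inv_power \<beta> i \<Lambda>) = (\<Sum>i<j. d i * inv_power \<beta> i \<Lambda>)"
      using less by (intro sum.cong) auto
    then show ?thesis by (simp add: lessThan_Suc_atMost[symmetric] algebra_simps)
  qed
  ultimately have s: "(\<lambda>\<Lambda>. (c j - d j) * inv_power \<beta> j \<Lambda>)
     \<in> o[at_top](inv_power \<beta> j)" by simp
  have "((\<lambda>\<Lambda>. (c j - d j) * inv_power \<beta> j \<Lambda> / inv_power \<beta> j \<Lambda>) \<longlongrightarrow> 0) at_top"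
    by (rule smalloD_tendsto[OF s])
  moreover have "\<forall>\<^sub>F \<Lambda> in at_top. (c j - d j) * inv_power \<beta> j \<Lambda> / inv_power \<beta> j \<Lambda> = c j - d j"
    using eventually_gt_at_top[of "0::real"] by eventually_elim simp
  ultimately have "((\<lambda>_. c j - d j) \<longlongrightarrow> 0) (at_top :: real filter)" by (rule Lim_transform_eventually)
  then show ?case by (simp add: tendsto_const_iff)
qed

text \<open>Truncation and uniqueness force the coefficients found for different N to agree where
  both apply, so the diagonal choice works to every order.\<close>

lemma is_expansion_all_orders:
  assumes "\<And>N. \<exists>c. c 0 = c0 \<and> is_expansion \<beta> N f c"
  shows "\<exists>c. c 0 = c0 \<and> (\<forall>N. is_expansion \<beta> N f c)"
proof -
  obtain c where c: "\<And>N. c N 0 = c0" "\<And>N. is_expansion \<beta> N f (c N)" using assms by metis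
  have "is_expansion \<beta> N f (\<lambda>j. c j j)" for N
  proof -
    have "c N j = c j j" if "j \<le> N" for j
      using is_expansion_unique[OF is_expansion_truncate[OF c(2)[of N] that] c(2)[of j]] by simp
    then have "(\<Sum>j\<le>N. c j j * inv_power \<beta> j \<Lambda>) = (\<Sum>j\<le>N. c N j * inv_power \<beta> j \<Lambda>)" for \<Lambda>
      by (intro sum.cong) auto
    then show ?thesis using c(2)[of N] unfolding is_expansion_def by simp
  qed
  then show ?thesis using c(1) by (intro exI[of _ "\<lambda>j. c j j"]) auto
qed

text \<open>As \<beta> is the least exponent of the progression, minimality is automatic and it
  remains to see that index 0 contributes. Nonnegative bumps show this in every neighbourhood, and a
  common \<open>c0\<close> for all N makes the leading coefficient available before the orders are
  combined.\<close>

lemma osc_index_if_expansion: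
  fixes S :: "real ^ 3 \<Rightarrow> real"
  assumes U: "open U" "0 \<in> U" and \<beta>: "\<beta> \<in> \<rat>" "0 < \<beta>"
    and ex: "\<And>\<phi>. test_function U \<phi> \<Longrightarrow> \<exists>c0. ((\<forall>x. 0 \<le> \<phi> x) \<longrightarrow> 0 < \<phi> 0 \<longrightarrow> c0 \<noteq> 0) \<and>
       (\<forall>N. \<exists>c. c 0 = c0 \<and> is_expansion \<beta> N (osc_integral S \<phi>) c)"
  shows "S has_oscillation_index \<beta>"
proof -
  define P where "P \<phi> c \<longleftrightarrow> ((\<forall>x. 0 \<le> \<phi> x) \<longrightarrow> 0 < \<phi> 0 \<longrightarrow> c 0 \<noteq> 0) \<and> (\<forall>N. is_expansion \<beta> N (osc_integral S \<phi>) c)"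
    for \<phi> and c :: "nat \<Rightarrow> complex"
  have "\<exists>c. P \<phi> c" if \<phi>: "test_function U \<phi>" for \<phi>
  proof -
    obtain c0 where c0: "(\<forall>x. 0 \<le> \<phi> x) \<longrightarrow> 0 < \<phi> 0 \<longrightarrow> c0 \<noteq> 0"
      "\<forall>N. \<exists>c. c 0 = c0 \<and> is_expansion \<beta> N (osc_integral S \<phi>) c" using ex[OF \<phi>] by (elim exE conjE)
    obtain c where "c 0 = c0" "\<forall>N. is_expansion \<beta> N (osc_integral S \<phi>) c"
      using is_expansion_all_orders[OF spec[OF c0(2)]] by (elim exE conjE)
    then have "P \<phi> c" unfolding P_def using c0(1) by simp
    then show ?thesis by (rule exI[of _ c])
  qed
  then obtain c where c: "\<And>\<phi>. test_function U \<phi> \<Longrightarrow> P \<phi> (c \<phi>)" by metis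
  define s where "s j = \<beta> + real j / 8" for j :: nat
  \<comment> \<open>No logarithms: of the three powers of ln that dimension 3 allows, only the
    zeroth carries a coefficient.\<close>
  define d where "d i j \<phi> = (if i = 0 then c \<phi> j else 0)" for i j :: nat and \<phi>
  have blk: "(\<Sum>i<DIM(real^3). d i j \<phi> * complex_of_real (ln \<Lambda> ^ i * \<Lambda> powr - s j)) = c \<phi> j * inv_power \<beta> j \<Lambda>" for j \<phi> \<Lambda>
    by (simp add: d_def s_def numeral_3_eq_3)
  have "osc_expansion S U s d"
    unfolding osc_expansion_def blk
  proof (intro conjI allI impI U)
    show "\<exists>a q. a \<in> \<rat> \<and> q \<in> \<rat> \<and> 0 < a \<and> 0 < q \<and> (\<forall>j. s j = a + real j * q)"
      by (rule exI[of _ \<beta>], rule exI[of _ "1/8"]) (use \<beta> in \<open>auto simp: s_def\<close>)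
    fix \<phi> N assume "test_function U \<phi>"
    from c[OF this] show "(\<lambda>\<Lambda>. osc_integral S \<phi> \<Lambda> - (\<Sum>j\<le>N. c \<phi> j * inv_power \<beta> j \<Lambda>))
        \<in> o[at_top](\<lambda>\<Lambda>. complex_of_real (\<Lambda> powr - s N))"
      by (simp add: P_def is_expansion_def s_def)
  qed
  moreover have "contributes d 0"
    unfolding contributes_def
  proof (intro exI[of _ U] conjI allI impI U)
    fix V assume V: "open V \<and> 0 \<in> V \<and> V \<subseteq> U"
    then obtain \<phi> where \<phi>: "test_function V \<phi>" "\<And>x. 0 \<le> \<phi> x" "0 < \<phi> 0"
      using bump_exists by blast
    then have tU: "test_function U \<phi>" using V unfolding test_function_def by blast
    from c[OF tU] \<phi>(2,3) have "d 0 0 \<phi> \<noteq> 0" by (simp add: P_def d_def)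
    then show "\<exists>i<DIM(real ^ 3). \<exists>\<phi>. test_function V \<phi> \<and> d i 0 \<phi> \<noteq> 0"
      using \<phi>(1) by (intro exI[of _ 0]) auto
  qed
  moreover have "s 0 = \<beta>" "s 0 \<le> s k" for k by (simp_all add: s_def)
  ultimately show ?thesis unfolding has_oscillation_index_def by blast
qed

section \<open>Endpoint expansions\<close>

text \<open>
  If $g(r) = f(r^2)$ is even, then \<open>even_root_deriv g j r\<close> is $f^{(j)}(r^2)$. The kernel comes from iterating
  $f'(r^2) = g'(r) / (2 r) = \frac12 \int_0^1 g''(r w) \, dw$, which has no singularity at $r = 0$.
\<close>

primrec wcoeff :: "nat \<Rightarrow> real" where
  "wcoeff 0 = 1 / 2"
| "wcoeff (Suc j) = wcoeff j / (4 * real (Suc j))"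

primrec even_root_deriv :: "(nat \<Rightarrow> real \<Rightarrow> real) \<Rightarrow> nat \<Rightarrow> real \<Rightarrow> real" where
  "even_root_deriv g 0 = g 0"
| "even_root_deriv g (Suc j) = (\<lambda>r. integral {0..1} (\<lambda>w. wcoeff j * (1 - w\<^sup>2) ^ j * g (2 * Suc j) (r * w)))"

lemma wcoeff_pos: "0 < wcoeff j"
  by (induction j) auto

text \<open>Differentiating under the integral gives an integrand with the factor w (1 - w^2)^k,
  whose antiderivative is - (1 - w^2)^(k+1) / (2 (k+1)); integrating by parts in w then brings out a
  factor r. The boundary terms vanish at w = 1 through the weight and at w = 0 because odd
  derivatives of g vanish there. The 4 (k+1) in \<open>wcoeff\<close> is this 2 (k+1) times the 2 of
  2 r.\<close>

lemma even_root_deriv_derivative: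
  assumes g: "\<And>n r. (g n has_real_derivative g (Suc n) r) (at r)"
    and odd: "\<And>n. g (2 * n + 1) 0 = 0"
  shows "(even_root_deriv g j has_real_derivative 2 * r * even_root_deriv g (Suc j) r) (at r)"
proof -
  have cg: "continuous_on UNIV (g n)" for n
    using g by (intro continuous_at_imp_continuous_on ballI) (blast intro: DERIV_isCont)
  have cc: "continuous_on S (\<lambda>x. g n (f x))" if "continuous_on S f" for n S and f :: "'b::topological_space \<Rightarrow> real"
    using continuous_on_compose2[OF cg that] by auto
  have gd: "((\<lambda>x. g n (c * x)) has_real_derivative g (Suc n) (c * x) * c) (at x)" for n c x
    by (rule DERIV_chain2[where f = "g n" and g = "\<lambda>x. c * x", OF g]) (auto intro!: derivative_eq_intros)
  show ?thesis
  proof (cases j)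
    case 0
    have gd1: "((\<lambda>x. g (Suc 0) (r * x)) has_real_derivative g 2 (r * w) * r) (at w)" for w
      using gd[of 1 r w] by (simp add: numeral_2_eq_2)
    have "((\<lambda>w. g 2 (r * w) * r) has_integral g 1 (r * 1) - g 1 (r * 0)) {0..1}"
      by (rule fundamental_theorem_of_calculus)
         (auto simp: has_real_derivative_iff_has_vector_derivative[symmetric] intro: DERIV_subset[OF gd1])
    from integral_unique[OF this] have "integral {0..1} (\<lambda>w. g 2 (r * w)) * r = g 1 r"
      using odd[of 0] by simp
    moreover have "even_root_deriv g (Suc 0) r = 1 / 2 * integral {0..1} (\<lambda>w. g 2 (r * w))"
      by simp
    ultimately have "2 * r * even_root_deriv g (Suc 0) r = g (Suc 0) r"
      by (simp add: mult.commute)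
    then show ?thesis using g[of 0 r] by (simp add: 0)
  next
    case (Suc k)
    let ?f = "\<lambda>r w. wcoeff k * (1 - w\<^sup>2) ^ k * g (2 * Suc k) (r * w)"
    let ?f' = "\<lambda>r w. wcoeff k * (1 - w\<^sup>2) ^ k * (g (Suc (2 * Suc k)) (r * w) * w)"
    have d: "((\<lambda>r. integral (cbox 0 1) (?f r)) has_real_derivative integral (cbox 0 1) (?f' r)) (at r within UNIV)"
    proof (rule leibniz_rule_field_derivative[where U = UNIV])
      fix x t :: real
      show "((\<lambda>x. ?f x t) has_real_derivative ?f' x t) (at x within UNIV)"
        using DERIV_cmult[OF gd[of "2 * Suc k" t x], of "wcoeff k * (1 - t\<^sup>2) ^ k"] by (simp add: mult.commute)
      show "?f x integrable_on cbox 0 1"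
        by (intro integrable_continuous continuous_intros cc)
      show "continuous_on (UNIV \<times> cbox 0 1) (\<lambda>(x, t). ?f' x t)"
        unfolding case_prod_beta by (intro continuous_intros cc)
    qed auto
    let ?U = "\<lambda>w. - (wcoeff k / (2 * real (Suc k))) * (1 - w\<^sup>2) ^ Suc k * g (Suc (2 * Suc k)) (r * w)"
    let ?U' = "\<lambda>w. ?f' r w - wcoeff k / (2 * real (Suc k)) * (1 - w\<^sup>2) ^ Suc k * g (2 * Suc (Suc k)) (r * w) * r"
    have "(?U' has_integral ?U 1 - ?U 0) {0..1}"
    proof (rule fundamental_theorem_of_calculus)
      fix w :: real
      have 1: "((\<lambda>w. (1 - w\<^sup>2) ^ Suc k) has_real_derivative real (Suc k) * (1 - w\<^sup>2) ^ k * (- 2 * w)) (at w)"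
        by (auto intro!: derivative_eq_intros simp del: power_Suc of_nat_Suc)
      have "(?U has_real_derivative - (wcoeff k / (2 * real (Suc k))) * (real (Suc k) * (1 - w\<^sup>2) ^ k * (- 2 * w)) * g (Suc (2 * Suc k)) (r * w)
          + g (Suc (Suc (2 * Suc k))) (r * w) * r * (- (wcoeff k / (2 * real (Suc k))) * (1 - w\<^sup>2) ^ Suc k)) (at w)"
        by (rule DERIV_mult[OF DERIV_cmult[OF 1] gd])
      moreover have "- (wcoeff k / (2 * real (Suc k))) * (real (Suc k) * (1 - w\<^sup>2) ^ k * (- 2 * w)) = wcoeff k * (1 - w\<^sup>2) ^ k * w"
        by (simp del: of_nat_Suc)
      ultimately have "(?U has_real_derivative ?U' w) (at w)"
        by (simp add: mult_ac del: of_nat_Suc power_Suc)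
      then show "(?U has_vector_derivative ?U' w) (at w within {0..1})"
        unfolding has_real_derivative_iff_has_vector_derivative[symmetric] by (rule DERIV_subset) simp
    qed simp
    moreover have "?U 1 - ?U 0 = 0" using odd[of "Suc k"] by simp
    ultimately have z: "integral {0..1} ?U' = 0" by (simp only: integral_unique)
    have "integral {0..1} ?U' = integral {0..1} (?f' r) - integral {0..1} (\<lambda>w. wcoeff k / (2 * real (Suc k)) * (1 - w\<^sup>2) ^ Suc k * g (2 * Suc (Suc k)) (r * w) * r)"
      by (intro Henstock_Kurzweil_Integration.integral_diff integrable_continuous_interval continuous_intros cc)
    with z have "integral {0..1} (?f' r) = integral {0..1} (\<lambda>w. (2 * r) * (wcoeff (Suc k) * (1 - w\<^sup>2) ^ Suc k * g (2 * Suc (Suc k)) (r * w)))"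
      by (simp add: field_simps del: of_nat_Suc power_Suc integral_mult_right integral_mult_left)
    also have "\<dots> = 2 * r * even_root_deriv g (Suc j) r"
      unfolding Suc even_root_deriv.simps by (rule integral_mult_right)
    finally show ?thesis using d by (simp add: Suc)
  qed
qed

lemma even_root_deriv_bound:
  assumes c: "continuous_on UNIV (g (2 * j))" and B: "\<And>r. \<bar>g (2 * j) r\<bar> \<le> B" and "0 \<le> B"
  shows "\<bar>even_root_deriv g j r\<bar> \<le> max 1 (wcoeff (j - 1)) * B"
proof (cases j)
  case 0
  then show ?thesis using B[of r] \<open>0 \<le> B\<close> by simp
next
  case (Suc k)
  have "norm (integral {0..1} (\<lambda>w. wcoeff k * (1 - w\<^sup>2) ^ k * g (2 * Suc k) (r * w))) \<le> (wcoeff k * B) * (1 - 0)"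
  proof (rule integral_bound)
    show "continuous_on {0..1} (\<lambda>w. wcoeff k * (1 - w\<^sup>2) ^ k * g (2 * Suc k) (r * w))"
      using continuous_on_compose2[OF c[unfolded Suc], of "{0..1}" "\<lambda>w. r * w"] by (auto intro!: continuous_intros)
    fix w :: real assume w: "w \<in> {0..1}"
    then have "0 \<le> 1 - w\<^sup>2" "1 - w\<^sup>2 \<le> 1" by (auto simp: power_le_one)
    then have "\<bar>(1 - w\<^sup>2) ^ k\<bar> \<le> 1" by (simp add: power_le_one)
    then have "wcoeff k * \<bar>(1 - w\<^sup>2) ^ k\<bar> * \<bar>g (2 * Suc k) (r * w)\<bar> \<le> wcoeff k * 1 * B"
      using B[of "r * w"] wcoeff_pos[of k] unfolding Suc by (intro mult_mono) auto
    then show "norm (wcoeff k * (1 - w\<^sup>2) ^ k * g (2 * Suc k) (r * w)) \<le> wcoeff k * B"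
      using wcoeff_pos[of k] by (simp add: abs_mult)
  qed simp
  also have "\<dots> \<le> max 1 (wcoeff (j - 1)) * B" using \<open>0 \<le> B\<close> by (simp add: Suc mult_right_mono)
  finally show ?thesis by (simp add: Suc)
qed

text \<open>The total mass of the kernel, which is all that remains at r = 0, where g is evaluated
  at 0 for every w.\<close>

definition wmass :: "nat \<Rightarrow> real" where
  "wmass j = (case j of 0 \<Rightarrow> 1 | Suc k \<Rightarrow> integral {0..1} (\<lambda>w. wcoeff k * (1 - w\<^sup>2) ^ k))"

lemma even_root_deriv_0: "even_root_deriv g j 0 = wmass j * g (2 * j) 0"
  by (cases j) (simp_all add: wmass_def)

lemma even_root_deriv_continuous:
  fixes g :: "'z::topological_space \<Rightarrow> nat \<Rightarrow> real \<Rightarrow> real"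
  assumes "\<And>n. continuous_on UNIV (\<lambda>w. g (fst w) n (snd w))"
  shows "continuous_on UNIV (\<lambda>w. even_root_deriv (g (fst w)) j (snd w))"
proof (cases j)
  case 0 then show ?thesis using assms[of 0] by simp
next
  case (Suc k)
  have "continuous_on UNIV (\<lambda>p. integral (cbox 0 1) (\<lambda>w. wcoeff k * (1 - w\<^sup>2) ^ k * g (fst p) (2 * Suc k) (snd p * w)))"
  proof (rule integral_continuous_on_param)
    have "continuous_on (UNIV \<times> cbox 0 1) (\<lambda>p. g (fst (fst p)) (2 * Suc k) (snd (fst p) * snd p))"
    proof -
      have "continuous_on (UNIV \<times> cbox 0 1) (\<lambda>p::('z \<times> real) \<times> real. (fst (fst p), snd (fst p) * snd p))"
        by (intro continuous_intros)
      from continuous_on_compose2[OF assms[of "2 * Suc k"] this] show ?thesis by simp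
    qed
    then show "continuous_on (UNIV \<times> cbox 0 1) (\<lambda>(p, w). wcoeff k * (1 - w\<^sup>2) ^ k * g (fst p) (2 * Suc k) (snd p * w))"
      unfolding case_prod_beta by (intro continuous_intros)
  qed
  then show ?thesis by (simp add: Suc)
qed

section \<open>Antiderivatives of the Fresnel integrand and of its compositions with powers\<close>

text \<open>The functions e_k of the overview. Decay along the ray fixes every constant of
  integration, so the family is in fact unique.\<close>

definition fres :: "nat \<Rightarrow> complex \<Rightarrow> complex" where
  "fres = (SOME F. F 0 = (\<lambda>z. exp (\<i> * z\<^sup>2)) \<and> (\<forall>k. ray_decay (cis (pi/4)) (F k)) \<and>
     (\<forall>k z. (F (Suc k) has_field_derivative F k z) (at z)))"

lemma fres: "fres 0 z = exp (\<i> * z\<^sup>2)" "ray_decay (cis (pi/4)) (fres k)"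
  "(fres (Suc k) has_field_derivative fres k z) (at z)"
proof -
  have "fres 0 = (\<lambda>z. exp (\<i> * z\<^sup>2)) \<and> (\<forall>k. ray_decay (cis (pi/4)) (fres k)) \<and>
     (\<forall>k z. (fres (Suc k) has_field_derivative fres k z) (at z))"
    unfolding fres_def by (rule someI_ex[OF ray_decay_chain[OF ray_decay_exp norm_cis]])
  then show "fres 0 z = exp (\<i> * z\<^sup>2)" "ray_decay (cis (pi/4)) (fres k)"
    "(fres (Suc k) has_field_derivative fres k z) (at z)" by auto
qed

lemma fres_1_nonzero: "fres (Suc 0) 0 \<noteq> 0"
  using fresnel_primitive_ray[OF fres(2) fres(3)[of 0, unfolded fres(1)], of 0] by auto

text \<open>The antiderivatives of the second stage, with respect to the straightened variable on
  the x-axis. Index i = 0 is the oscillating coefficient left by the radial stage, and the ray has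
  the smaller angle pi / (4 m).\<close>

definition power_chain :: "nat \<Rightarrow> nat \<Rightarrow> nat \<Rightarrow> complex \<Rightarrow> complex" where
  "power_chain m k = (SOME F. F 0 = (\<lambda>z. fres k (z ^ m)) \<and> (\<forall>i. ray_decay (cis (pi / (4 * real m))) (F i)) \<and>
     (\<forall>i z. (F (Suc i) has_field_derivative F i z) (at z)))"

lemma power_chain:
  assumes "m > 0"
  shows "power_chain m k 0 z = fres k (z ^ m)" "ray_decay (cis (pi / (4 * real m))) (power_chain m k i)"
  "(power_chain m k (Suc i) has_field_derivative power_chain m k i z) (at z)"
proof -
  have "power_chain m k 0 = (\<lambda>z. fres k (z ^ m)) \<and> (\<forall>i. ray_decay (cis (pi / (4 * real m))) (power_chain m k i)) \<and>
     (\<forall>i z. (power_chain m k (Suc i) has_field_derivative power_chain m k i z) (at z))"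
    unfolding power_chain_def by (rule someI_ex[OF ray_decay_chain[OF ray_decay_power[OF fres(2) assms] norm_cis]])
  then show "power_chain m k 0 z = fres k (z ^ m)" "ray_decay (cis (pi / (4 * real m))) (power_chain m k i)"
    "(power_chain m k (Suc i) has_field_derivative power_chain m k i z) (at z)" by auto
qed

lemma power_chain_nonzero:
  assumes "m > 0" shows "power_chain m (Suc 0) (Suc 0) 0 \<noteq> 0"
  using fresnel_primitive_power_nonzero[OF fres(2) fres(3)[of 0, unfolded fres(1)] assms power_chain(2)[OF assms]]
    power_chain(3)[OF assms, of "Suc 0" 0] unfolding power_chain(1)[OF assms] by blast

lemma of_real_chain_derivative:
  fixes G g :: "complex \<Rightarrow> complex"
  assumes G: "\<And>z. (G has_field_derivative g z) (at z)"
    and u: "(u has_real_derivative u') (at r within S)"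
  shows "((\<lambda>r. G (of_real (u r))) has_vector_derivative of_real u' * g (of_real (u r))) (at r within S)"
proof -
  have "((\<lambda>r. complex_of_real (u r)) has_vector_derivative of_real u') (at r within S)"
    using u by (rule has_vector_derivative_of_real)
  from field_vector_diff_chain_within[OF this, of G "g (of_real (u r))"] G
  show ?thesis by (auto simp: o_def intro: has_field_derivative_at_within)
qed

text \<open>On an interval where the phase r^2 - c keeps the sign \<tau>, the antiderivatives are
  evaluated at \<mu> \<tau> (r^2 - c) \<ge> 0, where they are bounded. The integrand is even in this
  argument, so \<tau> does not alter it, and each integration gains \<tau> / \<mu>.\<close>

lemma radial_part:
  fixes Q :: "nat \<Rightarrow> real \<Rightarrow> real"
  assumes ab: "0 \<le> a" "a \<le> b" and \<mu>: "\<mu> > 0" and \<tau>: "\<tau> = 1 \<or> \<tau> = -1"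
    and pos: "\<And>r. a \<le> r \<Longrightarrow> r \<le> b \<Longrightarrow> 0 \<le> \<tau> * (r\<^sup>2 - c)"
    and Q: "\<And>j r. (Q j has_real_derivative 2 * r * Q (Suc j) r) (at r)"
    and M: "\<And>r. \<bar>Q K r\<bar> \<le> M"
    and C: "\<And>y. 0 \<le> y \<Longrightarrow> norm (fres K (of_real y)) \<le> C"
  shows "norm (integral {a..b} (\<lambda>r. of_real (2 * r) * (exp (\<i> * of_real ((\<mu> * (r\<^sup>2 - c))\<^sup>2)) * of_real (Q 0 r))) -
     (\<Sum>j<K. (-1) ^ j * (of_real ((\<tau> / \<mu>) ^ Suc j) * fres (Suc j) (of_real (\<mu> * (\<tau> * (b\<^sup>2 - c)))) * of_real (Q j b)
        - of_real ((\<tau> / \<mu>) ^ Suc j) * fres (Suc j) (of_real (\<mu> * (\<tau> * (a\<^sup>2 - c)))) * of_real (Q j a))))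
     \<le> 2 * b * (C * M / \<mu> ^ K) * (b - a)"
proof -
  define A where "A j r = of_real ((\<tau> / \<mu>) ^ j) * fres j (of_real (\<mu> * (\<tau> * (r\<^sup>2 - c))))" for j r
  have t2: "\<tau> * \<tau> = 1" using \<tau> by auto
  have A': "(A (Suc j) has_vector_derivative of_real (2 * r) * A j r) (at r within {a..b})" for j r
  proof -
    have "((\<lambda>r. \<mu> * (\<tau> * (r\<^sup>2 - c))) has_real_derivative \<mu> * (\<tau> * (2 * r))) (at r within {a..b})"
      by (auto intro!: derivative_eq_intros)
    from of_real_chain_derivative[OF fres(3)[of j] this]
    have "(A (Suc j) has_vector_derivative of_real ((\<tau> / \<mu>) ^ Suc j) * (of_real (\<mu> * (\<tau> * (2 * r))) * fres j (of_real (\<mu> * (\<tau> * (r\<^sup>2 - c)))))) (at r within {a..b})"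
      unfolding A_def by (rule has_vector_derivative_mult_right)
    moreover have "(\<tau> / \<mu>) ^ Suc j * (\<mu> * (\<tau> * (2 * r))) = (2 * r) * (\<tau> / \<mu>) ^ j"
      using \<mu> t2 by (simp add: field_simps)
    then have "of_real ((\<tau> / \<mu>) ^ Suc j * (\<mu> * (\<tau> * (2 * r)))) * X = of_real ((2 * r) * (\<tau> / \<mu>) ^ j) * X" for X :: complex
      by (simp only:)
    then have "of_real ((\<tau> / \<mu>) ^ Suc j) * (of_real (\<mu> * (\<tau> * (2 * r))) * X) = of_real (2 * r) * (of_real ((\<tau> / \<mu>) ^ j) * X)" for X :: complex
      by (simp only: of_real_mult mult.assoc)
    ultimately show ?thesis by (simp only: A_def)
  qed
  have Q': "((\<lambda>r. complex_of_real (Q j r)) has_vector_derivative of_real (2 * r) * of_real (Q (Suc j) r)) (at r within {a..b})" for j r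
    using has_vector_derivative_of_real[OF has_field_derivative_at_within[OF Q[of j r]]]
    by simp
  have A0: "A 0 r = exp (\<i> * of_real ((\<mu> * (r\<^sup>2 - c))\<^sup>2))" for r
  proof -
    have "(\<mu> * (\<tau> * (r\<^sup>2 - c)))\<^sup>2 = (\<mu> * (r\<^sup>2 - c))\<^sup>2" using \<tau> by (auto simp: power_mult_distrib)
    then show ?thesis unfolding A_def fres(1)
      by (simp only: power_0 of_real_1 mult_1_left of_real_power[symmetric])
  qed
  have cQ: "continuous_on {a..b} (\<lambda>r. complex_of_real (Q j r))" for j
    using Q[of j] by (intro continuous_on_of_real continuous_at_imp_continuous_on ballI) (blast intro: DERIV_isCont)
  have cA0: "continuous_on {a..b} (A 0)" unfolding A0 by (intro continuous_intros)
  let ?I = "integral {a..b} (\<lambda>r. of_real (2 * r) * (A 0 r * of_real (Q 0 r)))"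
  let ?S = "\<Sum>j<K. (-1) ^ j * (A (Suc j) b * of_real (Q j b) - A (Suc j) a * of_real (Q j a))"
  have "((\<lambda>r. of_real (2 * r) * (A K r * of_real (Q K r))) has_integral (-1) ^ K * (?I - ?S)) {a..b}"
  proof (rule iterated_by_parts[where p = "\<lambda>r. of_real (2 * r)"])
    show "((\<lambda>r. of_real (2 * r) * (A 0 r * of_real (Q 0 r))) has_integral ?I) {a..b}"
      by (intro integrable_integral integrable_continuous_interval continuous_intros cA0 cQ)
  qed (use ab A' Q' cQ cA0 in \<open>auto intro!: continuous_intros\<close>)
  moreover have "norm (of_real (2 * r) * (A K r * of_real (Q K r))) \<le> 2 * b * (C * M / \<mu> ^ K)" if "r \<in> {a..b}" for r
  proof -
    have "norm (A K r) \<le> C / \<mu> ^ K"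
      using C[of "\<mu> * (\<tau> * (r\<^sup>2 - c))"] pos[of r] that \<mu> \<tau>
      by (auto simp: A_def norm_mult norm_power norm_divide power_divide divide_right_mono)
    then have "norm (A K r) * \<bar>Q K r\<bar> \<le> C / \<mu> ^ K * M"
      using M[of r] order_trans[OF norm_ge_zero C[of 0]] \<mu> by (intro mult_mono) auto
    from mult_mono[OF _ this, of "2 * r" "2 * b"] have "(2 * r) * (norm (A K r) * \<bar>Q K r\<bar>) \<le> (2 * b) * (C / \<mu> ^ K * M)"
      using that ab by auto
    then show ?thesis using that ab by (simp add: norm_mult)
  qed
  moreover have "0 \<le> 2 * b * (C * M / \<mu> ^ K)"
    using ab \<mu> order_trans[OF norm_ge_zero C[of 0]] order_trans[OF abs_ge_zero M] by simp
  ultimately have "norm ((-1) ^ K * (?I - ?S)) \<le> 2 * b * (C * M / \<mu> ^ K) * (b - a)"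
    using has_integral_bound[of "2 * b * (C * M / \<mu> ^ K)" _ _ a b] ab by (auto simp: content_real)
  then have "norm (?I - ?S) \<le> 2 * b * (C * M / \<mu> ^ K) * (b - a)"
    by (simp add: norm_mult norm_power)
  then show ?thesis unfolding A0 unfolding A_def .
qed

text \<open>
  The weights of the two kinds of endpoint contributions of the radial integral: \<open>kap\<close> belongs to the
  endpoint $r = 0$, and \<open>lam\<close> to the interior zero $r = \sqrt q$ of the phase $r^2 - q$, which occurs only for \<open>\<sigma> = -1\<close>.
\<close>

definition kap :: "real \<Rightarrow> nat \<Rightarrow> complex" where
  "kap \<sigma> j = (if \<sigma> = 1 then - ((-1) ^ j) else 1)"

definition lam :: "real \<Rightarrow> nat \<Rightarrow> complex" where
  "lam \<sigma> j = (if \<sigma> = 1 then 0 else - (1 + (-1) ^ j))"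

text \<open>All \<open>Q j\<close> vanish at R. For \<sigma> = 1 this leaves the endpoint 0. For
  \<sigma> = -1 the interval is cut at sqrt q, where the boundary terms from the two sides are equal
  up to the signs -1 and - ((-1) ^ j): they add for even j and cancel for odd j.\<close>

lemma radial_expansion:
  fixes Q :: "nat \<Rightarrow> real \<Rightarrow> real"
  assumes R: "0 \<le> R" and q: "0 \<le> q" and \<sigma>: "\<sigma> = 1 \<or> \<sigma> = -1 \<and> sqrt q \<le> R" and \<mu>: "\<mu> > 0"
    and Q: "\<And>j r. (Q j has_real_derivative 2 * r * Q (Suc j) r) (at r)" and QR: "\<And>j. Q j R = 0"
    and M: "\<And>r. \<bar>Q K r\<bar> \<le> M"
    and C: "\<And>y. 0 \<le> y \<Longrightarrow> norm (fres K (of_real y)) \<le> C"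
  shows "norm (integral {0..R} (\<lambda>r. of_real (2 * r) * (exp (\<i> * of_real ((\<mu> * (r\<^sup>2 + \<sigma> * q))\<^sup>2)) * of_real (Q 0 r))) -
     (\<Sum>j<K. of_real ((1 / \<mu>) ^ Suc j) * (kap \<sigma> j * fres (Suc j) (of_real (\<mu> * q)) * of_real (Q j 0)
        + lam \<sigma> j * fres (Suc j) 0 * of_real (Q j (sqrt q)))))
     \<le> 2 * R * (C * M / \<mu> ^ K) * R"
  using \<sigma>
proof
  assume s: "\<sigma> = 1"
  have "norm (integral {0..R} (\<lambda>r. of_real (2 * r) * (exp (\<i> * of_real ((\<mu> * (r\<^sup>2 - (- q)))\<^sup>2)) * of_real (Q 0 r))) -
     (\<Sum>j<K. (-1) ^ j * (of_real ((1 / \<mu>) ^ Suc j) * fres (Suc j) (of_real (\<mu> * (1 * (R\<^sup>2 - (- q))))) * of_real (Q j R)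
        - of_real ((1 / \<mu>) ^ Suc j) * fres (Suc j) (of_real (\<mu> * (1 * (0\<^sup>2 - (- q))))) * of_real (Q j 0))))
     \<le> 2 * R * (C * M / \<mu> ^ K) * (R - 0)"
    by (rule radial_part) (use R q \<mu> Q M C in auto)
  also have "(\<Sum>j<K. (-1) ^ j * (of_real ((1 / \<mu>) ^ Suc j) * fres (Suc j) (of_real (\<mu> * (1 * (R\<^sup>2 - (- q))))) * of_real (Q j R)
        - of_real ((1 / \<mu>) ^ Suc j) * fres (Suc j) (of_real (\<mu> * (1 * (0\<^sup>2 - (- q))))) * of_real (Q j 0)))
     = (\<Sum>j<K. of_real ((1 / \<mu>) ^ Suc j) * (kap \<sigma> j * fres (Suc j) (of_real (\<mu> * q)) * of_real (Q j 0)
        + lam \<sigma> j * fres (Suc j) 0 * of_real (Q j (sqrt q))))"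
    by (intro sum.cong) (simp_all add: s QR kap_def lam_def mult_ac)
  finally show ?thesis by (simp add: s)
next
  assume s: "\<sigma> = -1 \<and> sqrt q \<le> R"
  define \<rho> where "\<rho> = sqrt q"
  have \<rho>: "0 \<le> \<rho>" "\<rho> \<le> R" "\<rho>\<^sup>2 = q" using s q by (auto simp: \<rho>_def)
  let ?f = "\<lambda>r. of_real (2 * r) * (exp (\<i> * of_real ((\<mu> * (r\<^sup>2 - q))\<^sup>2)) * of_real (Q 0 r))"
  let ?s1 = "\<lambda>j. (-1) ^ j * (of_real ((- 1 / \<mu>) ^ Suc j) * fres (Suc j) (of_real (\<mu> * (- 1 * (\<rho>\<^sup>2 - q)))) * of_real (Q j \<rho>)
        - of_real ((- 1 / \<mu>) ^ Suc j) * fres (Suc j) (of_real (\<mu> * (- 1 * (0\<^sup>2 - q)))) * of_real (Q j 0))"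
  let ?s2 = "\<lambda>j. (-1) ^ j * (of_real ((1 / \<mu>) ^ Suc j) * fres (Suc j) (of_real (\<mu> * (1 * (R\<^sup>2 - q)))) * of_real (Q j R)
        - of_real ((1 / \<mu>) ^ Suc j) * fres (Suc j) (of_real (\<mu> * (1 * (\<rho>\<^sup>2 - q)))) * of_real (Q j \<rho>))"
  have 1: "norm (integral {0..\<rho>} ?f - (\<Sum>j<K. ?s1 j)) \<le> 2 * \<rho> * (C * M / \<mu> ^ K) * (\<rho> - 0)"
    by (rule radial_part) (use \<rho> \<mu> Q M C in \<open>auto simp flip: \<rho>(3)\<close>)
  have 2: "norm (integral {\<rho>..R} ?f - (\<Sum>j<K. ?s2 j)) \<le> 2 * R * (C * M / \<mu> ^ K) * (R - \<rho>)"
    by (rule radial_part) (use \<rho> \<mu> Q M C in \<open>auto simp flip: \<rho>(3)\<close>)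
  have cQ: "continuous_on S (\<lambda>r. complex_of_real (Q j r))" for j S
    using Q[of j] by (intro continuous_on_of_real continuous_at_imp_continuous_on ballI) (blast intro: DERIV_isCont)
  have I: "integral {0..R} ?f = integral {0..\<rho>} ?f + integral {\<rho>..R} ?f"
    by (rule Henstock_Kurzweil_Integration.integral_combine[symmetric])
       (use \<rho> in \<open>auto intro!: integrable_continuous_interval continuous_intros cQ\<close>)
  have pw: "(-1) ^ j * complex_of_real ((- 1 / \<mu>) ^ Suc j) = - of_real ((1 / \<mu>) ^ Suc j)" for j
  proof -
    have "(- 1 / \<mu>) ^ Suc j = (-1) ^ Suc j * (1 / \<mu>) ^ Suc j"
      by (simp only: power_mult_distrib[symmetric]) simp
    moreover have "(-1 :: real) ^ j * ((-1) ^ Suc j * x) = - x" for x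
      by (cases "even j") simp_all
    ultimately have "(-1) ^ j * (- 1 / \<mu>) ^ Suc j = - ((1 / \<mu>) ^ Suc j)"
      by (simp only:)
    then have "complex_of_real ((-1) ^ j * (- 1 / \<mu>) ^ Suc j) = complex_of_real (- ((1 / \<mu>) ^ Suc j))"
      by (simp only:)
    then show ?thesis by (simp only: of_real_mult of_real_power of_real_minus of_real_1)
  qed
  have "?s1 j + ?s2 j = of_real ((1 / \<mu>) ^ Suc j) * (kap \<sigma> j * fres (Suc j) (of_real (\<mu> * q)) * of_real (Q j 0)
        + lam \<sigma> j * fres (Suc j) 0 * of_real (Q j (sqrt q)))" for j
  proof -
    have "?s1 j = ((-1) ^ j * complex_of_real ((- 1 / \<mu>) ^ Suc j)) * (fres (Suc j) 0 * of_real (Q j \<rho>) - fres (Suc j) (of_real (\<mu> * q)) * of_real (Q j 0))"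
      using \<rho> by (simp add: algebra_simps del: power_Suc)
    then show ?thesis unfolding pw using s \<rho> by (simp add: QR kap_def lam_def \<rho>_def[symmetric] algebra_simps del: power_Suc)
  qed
  then have "(\<Sum>j<K. of_real ((1 / \<mu>) ^ Suc j) * (kap \<sigma> j * fres (Suc j) (of_real (\<mu> * q)) * of_real (Q j 0)
        + lam \<sigma> j * fres (Suc j) 0 * of_real (Q j (sqrt q)))) = (\<Sum>j<K. ?s1 j) + (\<Sum>j<K. ?s2 j)"
    by (simp only: sum.distrib[symmetric])
  moreover have "norm (integral {0..R} ?f - ((\<Sum>j<K. ?s1 j) + (\<Sum>j<K. ?s2 j))) \<le> 2 * \<rho> * (C * M / \<mu> ^ K) * (\<rho> - 0) + 2 * R * (C * M / \<mu> ^ K) * (R - \<rho>)"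
    using norm_triangle_mono[OF 1 2] unfolding I by (simp only: add_diff_add)
  moreover have "2 * \<rho> * (C * M / \<mu> ^ K) * (\<rho> - 0) \<le> 2 * R * (C * M / \<mu> ^ K) * (\<rho> - 0)"
    using \<rho> \<mu> order_trans[OF norm_ge_zero C[of 0]] order_trans[OF abs_ge_zero M] by (intro mult_right_mono) auto
  ultimately have "norm (integral {0..R} ?f - (\<Sum>j<K. of_real ((1 / \<mu>) ^ Suc j) * (kap \<sigma> j * fres (Suc j) (of_real (\<mu> * q)) * of_real (Q j 0)
        + lam \<sigma> j * fres (Suc j) 0 * of_real (Q j (sqrt q))))) \<le> 2 * R * (C * M / \<mu> ^ K) * (\<rho> - 0) + 2 * R * (C * M / \<mu> ^ K) * (R - \<rho>)"
    by (simp only:)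
  moreover have "2 * R * x * (\<rho> - 0) + 2 * R * x * (R - \<rho>) = 2 * R * x * R" for x
    by (simp add: algebra_simps)
  moreover have "r\<^sup>2 + \<sigma> * q = r\<^sup>2 - q" for r using s by simp
  ultimately show ?thesis by (simp only:)
qed

text \<open>The argument \<nu> y makes every integration by parts gain 1 / \<nu>, and the vanishing
  at B leaves boundary terms at 0 only. The constant combines bounds for the antiderivative and for
  \<open>Q K\<close>, neither involving \<nu>.\<close>

lemma half_line_expansion:
  fixes Q :: "nat \<Rightarrow> real \<Rightarrow> real"
  assumes m: "m > 0" and B: "0 \<le> B"
    and Q: "\<And>i y. i < K \<Longrightarrow> 0 \<le> y \<Longrightarrow> y \<le> B \<Longrightarrow> (Q i has_real_derivative Q (Suc i) y) (at y)"
    and cQ: "continuous_on {0..B} (Q K)" and QB: "\<And>i. i < K \<Longrightarrow> Q i B = 0"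
  shows "\<exists>C. \<forall>\<nu>>0. norm (integral {0..B} (\<lambda>y. fres k (of_real ((\<nu> * y) ^ m)) * of_real (Q 0 y)) -
     (\<Sum>i<K. - ((-1) ^ i) * of_real ((1 / \<nu>) ^ Suc i) * power_chain m k (Suc i) 0 * of_real (Q i 0))) \<le> C / \<nu> ^ K"
proof -
  obtain C where C: "C \<ge> 0" "\<And>y. 0 \<le> y \<Longrightarrow> norm (power_chain m k K (of_real y)) \<le> C"
    using ray_decay_bounded_real[OF power_chain(2)[OF m]] by blast
  have "bounded (Q K ` {0..B})" by (intro compact_imp_bounded compact_continuous_image cQ) simp
  then obtain M where M: "\<And>y. 0 \<le> y \<Longrightarrow> y \<le> B \<Longrightarrow> \<bar>Q K y\<bar> \<le> M" unfolding bounded_iff by force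
  have cQ0: "continuous_on {0..B} (\<lambda>y. complex_of_real (Q j y))" if "j \<le> K" for j
    using Q[of j] cQ that by (cases "j = K") (auto intro!: continuous_on_of_real continuous_at_imp_continuous_on DERIV_isCont)
  have "norm (integral {0..B} (\<lambda>y. fres k (of_real ((\<nu> * y) ^ m)) * of_real (Q 0 y)) -
     (\<Sum>i<K. - ((-1) ^ i) * of_real ((1 / \<nu>) ^ Suc i) * power_chain m k (Suc i) 0 * of_real (Q i 0))) \<le> (C * M * B) / \<nu> ^ K" if \<nu>: "\<nu> > 0" for \<nu>
  proof -
    define A where "A j y = of_real ((1 / \<nu>) ^ j) * power_chain m k j (of_real (\<nu> * y))" for j y
    have A': "(A (Suc j) has_vector_derivative 1 * A j y) (at y within {0..B})" for j y
    proof -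
      have "((\<lambda>y. \<nu> * y) has_real_derivative \<nu>) (at y within {0..B})"
        by (auto intro!: derivative_eq_intros)
      from of_real_chain_derivative[OF power_chain(3)[OF m, of k j] this]
      have "(A (Suc j) has_vector_derivative of_real ((1 / \<nu>) ^ Suc j) * (of_real \<nu> * power_chain m k j (of_real (\<nu> * y)))) (at y within {0..B})"
        unfolding A_def by (rule has_vector_derivative_mult_right)
      then show ?thesis using \<nu> by (simp add: A_def)
    qed
    have Q': "((\<lambda>y. complex_of_real (Q j y)) has_vector_derivative 1 * of_real (Q (Suc j) y)) (at y within {0..B})" if "j < K" "0 \<le> y" "y \<le> B" for j y
      using has_vector_derivative_of_real[OF has_field_derivative_at_within[OF Q[OF that]]]
      by simp
    have A0: "A 0 y = fres k (of_real ((\<nu> * y) ^ m))" for y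
      unfolding A_def power_chain(1)[OF m] by simp
    have cA0: "continuous_on {0..B} (A 0)"
    proof -
      have "continuous_on UNIV (fres k)"
        using fres(2)[of k] unfolding ray_decay_def by (blast intro: holomorphic_on_imp_continuous_on)
      moreover have "continuous_on {0..B} (\<lambda>y. complex_of_real ((\<nu> * y) ^ m))"
        by (intro continuous_intros)
      ultimately show ?thesis unfolding A0 by (rule continuous_on_compose2) simp
    qed
    let ?I = "integral {0..B} (\<lambda>y. 1 * (A 0 y * of_real (Q 0 y)))"
    let ?S = "\<Sum>j<K. (-1) ^ j * (A (Suc j) B * of_real (Q j B) - A (Suc j) 0 * of_real (Q j 0))"
    have "((\<lambda>y. 1 * (A K y * of_real (Q K y))) has_integral (-1) ^ K * (?I - ?S)) {0..B}"
    proof (rule iterated_by_parts[where p = "\<lambda>_. 1"])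
      show "((\<lambda>y. 1 * (A 0 y * of_real (Q 0 y))) has_integral ?I) {0..B}"
        by (intro integrable_integral integrable_continuous_interval continuous_intros cA0 cQ0) simp
    qed (use B A' Q' cQ0[of K] cA0 in auto)
    moreover have "norm (1 * (A K y * of_real (Q K y))) \<le> C / \<nu> ^ K * M" if "y \<in> {0..B}" for y
    proof -
      have "norm (A K y) \<le> C / \<nu> ^ K"
        using C(2)[of "\<nu> * y"] that \<nu> by (simp add: A_def norm_mult norm_power norm_divide power_divide divide_right_mono)
      then have "norm (A K y) * \<bar>Q K y\<bar> \<le> C / \<nu> ^ K * M"
        using M[of y] that C(1) \<nu> by (intro mult_mono) auto
      then show ?thesis by (simp add: norm_mult)
    qed
    moreover have "0 \<le> C / \<nu> ^ K * M" using C(1) \<nu> order_trans[OF abs_ge_zero M[of 0]] B by simp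
    ultimately have "norm ((-1) ^ K * (?I - ?S)) \<le> C / \<nu> ^ K * M * (B - 0)"
      using has_integral_bound[of "C / \<nu> ^ K * M" _ _ 0 B] B by (auto simp: content_real)
    then have "norm (?I - ?S) \<le> C / \<nu> ^ K * M * B"
      by (simp add: norm_mult norm_power)
    moreover have "?S = (\<Sum>i<K. - ((-1) ^ i) * of_real ((1 / \<nu>) ^ Suc i) * power_chain m k (Suc i) 0 * of_real (Q i 0))"
      by (intro sum.cong) (auto simp: QB A_def)
    ultimately show ?thesis by (simp add: A0 mult.commute mult.left_commute)
  qed
  then show ?thesis by blast
qed

section \<open>Expansion of the oscillatory integral\<close>

lemma integral_compact_even_split:
  fixes f :: "real \<Rightarrow> complex"
  assumes f: "continuous_on UNIV f" and R: "0 \<le> R" and z: "\<And>r. R \<le> \<bar>r\<bar> \<Longrightarrow> f r = 0"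
  shows "(\<integral>r. f r \<partial>lborel) = integral {0..R} (\<lambda>r. f r + f (- r))"
proof -
  have c: "continuous_on S f" for S using f continuous_on_subset by blast
  have "integrable lborel (\<lambda>r. indicator {-R..R} r *\<^sub>R f r)"
    by (rule borel_integrable_compact) (auto intro: c)
  moreover have "(\<lambda>r. indicator {-R..R} r *\<^sub>R f r) = f"
    using z by (auto simp: fun_eq_iff indicator_def abs_le_iff not_le)
  ultimately have "(f has_integral (\<integral>r. f r \<partial>lborel)) UNIV"
    using has_integral_integral_lborel[of f] by simp
  moreover have "f = (\<lambda>r. if r \<in> {-R..R} then f r else 0)"
    using z by (auto simp: fun_eq_iff abs_le_iff not_le)
  ultimately have "((\<lambda>r. if r \<in> {-R..R} then f r else 0) has_integral (\<integral>r. f r \<partial>lborel)) UNIV" by simp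
  then have "(\<integral>r. f r \<partial>lborel) = integral {-R..R} f"
    unfolding has_integral_restrict_UNIV by (simp add: integral_unique)
  also have "\<dots> = integral {-R..0} f + integral {0..R} f"
    using R by (intro Henstock_Kurzweil_Integration.integral_combine[symmetric] integrable_continuous_interval c) auto
  also have "integral {-R..0} f = integral {0..R} (\<lambda>r. f (- r))"
    using Henstock_Kurzweil_Integration.integral_reflect_real[of R 0 "\<lambda>r. f (- r)"] by simp
  also have "integral {0..R} (\<lambda>r. f (- r)) + integral {0..R} f = integral {0..R} (\<lambda>r. f (- r) + f r)"
    using R by (intro Henstock_Kurzweil_Integration.integral_add[symmetric] integrable_continuous_interval c
        continuous_on_compose2[OF f]) (auto intro: continuous_intros)
  finally show ?thesis by (simp add: add.commute)
qed

section \<open>Integration over axis points and directions\<close>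

lemma axis_measure_strip: "emeasure axis_measure ({-X..X} \<times> UNIV) < \<infinity>"
proof -
  interpret finite_measure direction_measure by (rule finite_direction_measure)
  have "emeasure axis_measure ({-X..X} \<times> UNIV) = emeasure lborel {-X..X} * emeasure direction_measure UNIV"
    by (rule emeasure_pair_measure_Times) auto
  then show ?thesis using emeasure_real[of UNIV]
    by (auto simp: ennreal_mult_less_top emeasure_lborel_Icc_eq)
qed

text \<open>The axis measure is infinite, but directions have finite total mass, so a strip of
  bounded x has finite measure. This is how bounds uniform in z are integrated.\<close>

lemma axis_integral_strip:
  fixes f :: "real \<times> real \<Rightarrow> 'b::{banach, second_countable_topology}"
  assumes f: "f \<in> borel_measurable axis_measure" and C: "\<And>z. norm (f z) \<le> C" and z: "\<And>z. X < \<bar>fst z\<bar> \<Longrightarrow> f z = 0"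
  shows "integrable axis_measure f"
    and "norm (\<integral>z. f z \<partial>axis_measure) \<le> C * measure axis_measure ({-X..X} \<times> UNIV)"
proof -
  let ?A = "{-X..X} \<times> (UNIV :: real set)"
  have A: "?A \<in> sets axis_measure" by (simp add: sets_axis_measure borel_Times)
  have out: "z \<notin> ?A \<Longrightarrow> f z = 0" for z
    using assms(3)[of z] by (cases z) (auto simp: not_le)
  show i: "integrable axis_measure f"
    by (rule integrableI_bounded_set[OF A f axis_measure_strip, of C]) (use C out in auto)
  have iA: "integrable axis_measure (\<lambda>z. C * indicator ?A z :: real)"
    using A axis_measure_strip by (intro integrable_mult_right integrable_real_indicator) auto
  have "norm (\<integral>z. f z \<partial>axis_measure) \<le> (\<integral>z. norm (f z) \<partial>axis_measure)"
    by (rule integral_norm_bound)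
  also have "\<dots> \<le> (\<integral>z. C * indicator ?A z \<partial>axis_measure)"
  proof (rule integral_mono[OF integrable_norm[OF i] iA])
    fix z show "norm (f z) \<le> C * indicator ?A z"
      using C[of z] out[of z] by (cases "z \<in> ?A") auto
  qed
  also have "\<dots> = C * measure axis_measure ?A"
    using A by (simp add: sets.Int_space_eq1)
  finally show "norm (\<integral>z. f z \<partial>axis_measure) \<le> C * measure axis_measure ?A" .
qed

lemma borel_measurable_axis:
  fixes f :: "real \<times> real \<Rightarrow> 'b::topological_space"
  assumes "continuous_on UNIV f" shows "f \<in> borel_measurable axis_measure"
  using borel_measurable_continuous_onI[OF assms] by (simp add: measurable_cong_sets[OF sets_axis_measure refl])

lemma open_null_set_empty:
  fixes T :: "'a::euclidean_space set"
  assumes "open T" "T \<in> null_sets lborel"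
  shows "T = {}"
  using open_not_negligible[OF assms(1)] null_sets_completionI[OF assms(2)]
  unfolding negligible_iff_null_sets by (metis (no_types))

text \<open>A nonempty open set contains an open rectangle, and the density 1 / (1 + s^2) is nowhere
  zero, so null sets of directions are Lebesgue null. Nonvanishing of the leading coefficients
  depends on this.\<close>

lemma axis_open_null:
  assumes A: "A \<in> null_sets axis_measure" and "open A" shows "A = {}"
proof (rule ccontr)
  interpret finite_measure direction_measure by (rule finite_direction_measure)
  assume "A \<noteq> {}"
  then obtain z where z: "z \<in> A" by (rule ex_in_conv[THEN iffD2, THEN exE])
  obtain P Q where PQ: "open P" "open Q" "z \<in> P \<times> Q" "P \<times> Q \<subseteq> A"
    using open_prod_elim[OF \<open>open A\<close> z] by metis
  have b: "P \<in> sets lborel" "Q \<in> sets direction_measure"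
    using PQ by simp_all
  have "P \<times> Q \<in> sets axis_measure" using b by (rule pair_measureI)
  from null_sets_subset[OF A this PQ(4)] have "emeasure axis_measure (P \<times> Q) = 0"
    by (rule null_setsD1)
  moreover have "emeasure axis_measure (P \<times> Q) = emeasure lborel P * emeasure direction_measure Q"
    using b by (rule emeasure_pair_measure_Times)
  ultimately consider "emeasure lborel P = 0" | "emeasure direction_measure Q = 0"
    by auto
  then show False
  proof cases
    case 1
    then have "P \<in> null_sets lborel" using b by (simp add: null_sets_def)
    from open_null_set_empty[OF PQ(1)] this have "P = {}" by simp
    then show False using PQ(3) by simp
  next
    case 2
    then have "Q \<in> null_sets direction_measure" using b by (simp add: null_sets_def)
    then have "AE s in lborel. s \<in> Q \<longrightarrow> ennreal (1 / (1 + s\<^sup>2)) = 0"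
      unfolding direction_measure_def by (subst (asm) null_sets_density_iff) auto
    then have "AE s in lborel. s \<notin> Q"
    proof eventually_elim
      case (elim s)
      have "0 < ennreal (1 / (1 + s\<^sup>2))" using one_plus_square_pos[of s] by (simp add: ennreal_zero_less_divide)
      with elim show ?case by auto
    qed
    moreover have "Q \<in> sets lborel" using PQ by simp
    ultimately have "Q \<in> null_sets lborel" by (simp only: AE_iff_null_sets)
    from open_null_set_empty[OF PQ(2)] this have "Q = {}" by simp
    then show False using PQ(3) by simp
  qed
qed

lemma axis_integral_pos:
  fixes f :: "real \<times> real \<Rightarrow> real"
  assumes "continuous_on UNIV f" and i: "integrable axis_measure f" and pos: "\<And>z. 0 \<le> f z" and z: "0 < f z"
  shows "(\<integral>z. f z \<partial>axis_measure) \<noteq> 0"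
proof
  assume "(\<integral>z. f z \<partial>axis_measure) = 0"
  then have "AE z in axis_measure. f z = 0"
    using integral_nonneg_eq_0_iff_AE[OF i] pos by auto
  moreover have o: "open {z. 0 < f z}"
    by (intro open_Collect_less continuous_intros assms(1))
  moreover have "{z. 0 < f z} \<in> sets axis_measure"
    unfolding sets_axis_measure using o by (rule borel_open)
  moreover have "AE z in axis_measure. z \<notin> {z. 0 < f z}"
    using \<open>AE z in axis_measure. f z = 0\<close> by eventually_elim simp
  ultimately have "{z. 0 < f z} \<in> null_sets axis_measure"
    by (simp only: AE_iff_null_sets)
  from axis_open_null[OF this o] have "z \<notin> {z. 0 < f z}" by (simp only: empty_iff not_False_eq_True)
  with z show False by simp
qed

text \<open>
  The sign \<open>\<sigma>\<close> is that of $x^4 + t x^2$ for small $x \neq 0$, and \<open>h\<close> straightens it: $|x^4 + t x^2|$ becomes $y^m$ for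
  $x = h(y)$. The amplitude is supported in $|x| \le X' < X$.
\<close>

locale osc_phase =
  fixes t \<sigma> :: real and m :: nat and X' X B :: real and h :: "real \<Rightarrow> real" and h0' :: real and S :: "real set"
    and \<phi> :: "real ^ 3 \<Rightarrow> real"
  assumes \<sigma>: "\<sigma> = 1 \<or> \<sigma> = -1" and m: "m > 0"
    and X: "0 \<le> X'" "X' < X" and q_nonneg': "\<And>x. \<bar>x\<bar> \<le> X \<Longrightarrow> 0 \<le> \<sigma> * (x ^ 4 + t * x\<^sup>2)"
    and S: "open S" "{0..B} \<subseteq> S" and B: "0 \<le> B" and h: "\<And>k. kdiff k S h" "h 0 = 0" "h B = X"
    and h0': "(h has_real_derivative h0') (at 0)"
    and hq': "\<And>y. 0 \<le> y \<Longrightarrow> y \<le> B \<Longrightarrow> \<sigma> * (h y ^ 4 + t * (h y)\<^sup>2) = y ^ m"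
    and \<phi>: "test_function UNIV \<phi>" and supp: "\<And>p. \<phi> p \<noteq> 0 \<Longrightarrow> \<bar>p $ 1\<bar> \<le> X'"
begin

definition q :: "real \<Rightarrow> real" where "q x = \<sigma> * (x ^ 4 + t * x\<^sup>2)"

lemma q_nonneg: "\<bar>x\<bar> \<le> X \<Longrightarrow> 0 \<le> q x" using q_nonneg' by (simp add: q_def)

lemma q_minus: "q (- x) = q x" by (simp add: q_def)

lemma continuous_q: "continuous_on A f \<Longrightarrow> continuous_on A (\<lambda>x. q (f x))"
  unfolding q_def by (intro continuous_intros)

abbreviation D :: "nat \<Rightarrow> real \<times> real \<Rightarrow> real ^ 3 \<Rightarrow> real" where
  "D n z \<equiv> (dd (direction (snd z)) ^^ n) \<phi>"

text \<open>The n-th r-derivative of the amplitude summed over r and -r. This sum is even in r;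
  reflecting r produces the sign (-1) ^ n.\<close>

definition g :: "real \<times> real \<Rightarrow> nat \<Rightarrow> real \<Rightarrow> real" where
  "g z n r = D n z (cyl z r) + (-1) ^ n * D n z (cyl z (- r))"

text \<open>The j-th derivative of the summed amplitude as a function of u, evaluated at u =
  r^2.\<close>

definition Q :: "real \<times> real \<Rightarrow> nat \<Rightarrow> real \<Rightarrow> real" where
  "Q z = even_root_deriv (g z)"

lemma smooth_\<phi>: "smooth \<phi>" using \<phi> by (rule test_function_smooth)

lemma g_derivative: "(g z n has_real_derivative g z (Suc n) r) (at r)"
proof -
  have d: "((\<lambda>r. D n z (cyl z r)) has_real_derivative D (Suc n) z (cyl z r)) (at r)" for r
    using dd_line[OF smooth_ddn[OF smooth_\<phi>], where p = "fst z *\<^sub>R axis 1 1" and v = "direction (snd z)" and r = r]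
    by (simp add: cyl_def)
  have "((\<lambda>r. D n z (cyl z (- r))) has_real_derivative D (Suc n) z (cyl z (- r)) * (- 1)) (at r)"
    by (rule DERIV_chain2[where f = "\<lambda>r. D n z (cyl z r)" and g = uminus, OF d]) (auto intro!: derivative_eq_intros)
  from DERIV_add[OF d DERIV_cmult[OF this, of "(-1) ^ n"]] show ?thesis
    unfolding g_def[abs_def] by simp
qed

lemma g_odd: "g z (2 * n + 1) 0 = 0"
  by (simp add: g_def)

lemma Q_derivative: "(Q z j has_real_derivative 2 * r * Q z (Suc j) r) (at r)"
  unfolding Q_def by (rule even_root_deriv_derivative[OF g_derivative g_odd])

lemma continuous_D: "continuous_on UNIV (\<lambda>w. D n (fst w) (cyl (fst w) (snd w)))"
proof -
  have 1: "continuous_on UNIV (\<lambda>w. direction (snd (fst w)))"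
    by (rule continuous_on_compose2[OF continuous_direction]) (auto intro!: continuous_intros)
  show ?thesis
    using continuous_on_compose2[OF ddn_continuous[OF smooth_\<phi>] continuous_on_Pair[OF 1 continuous_cyl]] by simp
qed

lemma continuous_g: "continuous_on UNIV (\<lambda>w. g (fst w) n (snd w))"
proof -
  have 1: "continuous_on UNIV (\<lambda>w::(real \<times> real) \<times> real. (fst w, - snd w))" by (intro continuous_intros)
  have "continuous_on UNIV (\<lambda>w. D n (fst w) (cyl (fst w) (- snd w)))"
    using continuous_on_compose2[OF continuous_D 1] by simp
  then show ?thesis unfolding g_def by (intro continuous_intros continuous_D)
qed

lemma continuous_Q: "continuous_on UNIV (\<lambda>w. Q (fst w) j (snd w))"
  unfolding Q_def by (rule even_root_deriv_continuous[OF continuous_g])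

lemma continuous_Q_along:
  assumes "continuous_on UNIV f" shows "continuous_on UNIV (\<lambda>z. Q z j (f z))"
  using continuous_on_compose2[OF continuous_Q continuous_on_Pair[OF continuous_on_id assms]] by simp

lemma support_subset: "closure {p. \<phi> p \<noteq> 0} \<subseteq> {p. \<bar>p $ 1\<bar> \<le> X'}"
proof (rule closure_minimal)
  show "closed {p::real^3. \<bar>p $ 1\<bar> \<le> X'}"
    by (intro closed_Collect_le continuous_intros)
qed (use supp in auto)

lemma D_outside: "X' < \<bar>fst z\<bar> \<Longrightarrow> D n z (cyl z r) = 0"
proof (rule ddn_outside_support)
  assume "X' < \<bar>fst z\<bar>"
  moreover have "cyl z r $ 1 = fst z" by (cases z) (simp add: cyl_vec3)
  ultimately show "cyl z r \<notin> closure {p. \<phi> p \<noteq> 0}" using support_subset by force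
qed

lemma g_outside: "X' < \<bar>fst z\<bar> \<Longrightarrow> g z n r = 0"
  by (simp add: g_def D_outside)

lemma Q_outside: "X' < \<bar>fst z\<bar> \<Longrightarrow> Q z j r = 0"
  by (cases j) (simp_all add: Q_def g_outside)

lemma norm_cyl_ge: "\<bar>r\<bar> \<le> norm (cyl z r)"
proof -
  obtain x s where z: "z = (x, s)" by (cases z)
  have "r\<^sup>2 \<le> x\<^sup>2 + ((r / sqrt (1 + s\<^sup>2))\<^sup>2 + (r * s / sqrt (1 + s\<^sup>2))\<^sup>2)"
    by (simp only: direction_components_square) simp
  also have "\<dots> = (norm (cyl z r))\<^sup>2"
    unfolding z cyl_vec3 by (simp add: norm_vec_def L2_set_def sum_3 add_nonneg_nonneg)
  finally show ?thesis by (simp add: abs_le_square_iff[symmetric])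
qed

text \<open>The radius must clear the support and also the zero sqrt q of the phase, at which the
  radial interval is divided for \<sigma> = -1.\<close>

lemma radius_exists: "\<exists>R\<ge>0. (\<forall>z n r. R \<le> \<bar>r\<bar> \<longrightarrow> D n z (cyl z r) = 0) \<and> (\<forall>x. \<bar>x\<bar> \<le> X' \<longrightarrow> sqrt (q x) \<le> R)"
proof -
  have "bounded (closure {p. \<phi> p \<noteq> 0})" using \<phi> by (simp add: test_function_def compact_imp_bounded)
  then obtain R1 where R1: "\<forall>p\<in>closure {p. \<phi> p \<noteq> 0}. norm p \<le> R1" unfolding bounded_iff by blast
  have "compact ((\<lambda>x. sqrt (q x)) ` {-X'..X'})"
    by (intro compact_continuous_image continuous_intros continuous_q) auto
  then have "bounded ((\<lambda>x. sqrt (q x)) ` {-X'..X'})" by (rule compact_imp_bounded)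
  then obtain R2 where R2: "\<forall>y\<in>(\<lambda>x. sqrt (q x)) ` {-X'..X'}. norm y \<le> R2" unfolding bounded_iff by blast
  show ?thesis
  proof (rule exI[of _ "max 0 (max (R1 + 1) R2)"], intro conjI allI impI)
    fix z n r assume "max 0 (max (R1 + 1) R2) \<le> \<bar>r\<bar>"
    then have "R1 < norm (cyl z r)" using norm_cyl_ge[of r z] by linarith
    then have "cyl z r \<notin> closure {p. \<phi> p \<noteq> 0}" using R1 by force
    then show "D n z (cyl z r) = 0" by (rule ddn_outside_support)
  next
    fix x assume "\<bar>x\<bar> \<le> X'"
    then have "x \<in> {-X'..X'}" by auto
    from bspec[OF R2 imageI[OF this]] show "sqrt (q x) \<le> max 0 (max (R1 + 1) R2)" by simp
  qed simp
qed

text \<open>The additional 1 makes all derivatives of the amplitude vanish in a neighbourhood of \<open>R\<close>.\<close>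

definition R :: real where
  "R = 1 + (SOME R. 0 \<le> R \<and> (\<forall>z n r. R \<le> \<bar>r\<bar> \<longrightarrow> D n z (cyl z r) = 0) \<and> (\<forall>x. \<bar>x\<bar> \<le> X' \<longrightarrow> sqrt (q x) \<le> R))"

lemma R: "1 \<le> R" "R - 1 \<le> \<bar>r\<bar> \<Longrightarrow> D n z (cyl z r) = 0" "\<bar>x\<bar> \<le> X' \<Longrightarrow> sqrt (q x) \<le> R"
proof -
  define R' where "R' = (SOME R. 0 \<le> R \<and> (\<forall>z n r. R \<le> \<bar>r\<bar> \<longrightarrow> D n z (cyl z r) = 0) \<and> (\<forall>x. \<bar>x\<bar> \<le> X' \<longrightarrow> sqrt (q x) \<le> R))"
  have R': "0 \<le> R'" "\<forall>z n r. R' \<le> \<bar>r\<bar> \<longrightarrow> D n z (cyl z r) = 0" "\<forall>x. \<bar>x\<bar> \<le> X' \<longrightarrow> sqrt (q x) \<le> R'"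
    using someI_ex[OF radius_exists] unfolding R'_def by auto
  have e: "R = 1 + R'" unfolding R_def R'_def ..
  show "1 \<le> R" using R' e by simp
  show "D n z (cyl z r) = 0" if "R - 1 \<le> \<bar>r\<bar>" using R'(2)[THEN spec[of _ z], THEN spec[of _ n], THEN spec[of _ r]] e that by simp
  show "sqrt (q x) \<le> R" if "\<bar>x\<bar> \<le> X'" using R'(3) e that by fastforce
qed

text \<open>The kernel form of \<open>Q\<close> integrates over the whole segment from 0 to r, so
  vanishing of the amplitude near r is not visible in it. It is recovered from the derivative
  relation, where r > 0 permits division by 2 r.\<close>

lemma Q_beyond: "R - 1 < r \<Longrightarrow> Q z j r = 0"
proof (induction j arbitrary: r)
  case 0
  then show ?case using R(2)[of r 0 z] R(2)[of "- r" 0 z] R(1) by (simp add: Q_def g_def)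
next
  case (Suc j)
  have "((\<lambda>_. 0) has_real_derivative 2 * r * Q z (Suc j) r) (at r)"
    by (rule has_field_derivative_transform_within_open[OF Q_derivative[of z j r], of "{R - 1<..}"]) (use Suc in auto)
  then have "2 * r * Q z (Suc j) r = 0" using DERIV_unique DERIV_const by blast
  then show ?case using Suc.prems R(1) by simp
qed

lemma Q_R: "Q z j R = 0" by (rule Q_beyond) simp

lemma Q_bounded: "\<exists>M\<ge>0. \<forall>z r. \<bar>Q z j r\<bar> \<le> M"
proof -
  obtain N where N: "N \<ge> 0" "\<forall>v p. norm v \<le> 1 \<longrightarrow> \<bar>(dd v ^^ (2 * j)) \<phi> p\<bar> \<le> N"
    using ddn_bounded[OF \<phi>] by blast
  have N': "\<bar>D (2 * j) z p\<bar> \<le> N" for z p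
    using N(2)[rule_format, of "direction (snd z)" p] by (simp add: norm_direction)
  have gb: "\<bar>g z (2 * j) r\<bar> \<le> 2 * N" for z r
    using abs_triangle_ineq[of "D (2 * j) z (cyl z r)" "D (2 * j) z (cyl z (- r))"] N'[of z "cyl z r"] N'[of z "cyl z (- r)"]
    by (simp add: g_def)
  have "\<bar>Q z j r\<bar> \<le> max 1 (wcoeff (j - 1)) * (2 * N)" for z r
    unfolding Q_def
  proof (rule even_root_deriv_bound)
    show "continuous_on UNIV (g z (2 * j))"
      by (intro continuous_at_imp_continuous_on ballI DERIV_isCont[OF g_derivative])
  qed (use gb N in auto)
  then show ?thesis using N(1) by (intro exI[of _ "max 1 (wcoeff (j - 1)) * (2 * N)"]) (auto simp: le_max_iff_disj)
qed

text \<open>\<mu> is the square root of the large parameter, and the factor 2 r is du / dr for u =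
  r^2.\<close>

definition radial_integral :: "real \<Rightarrow> real \<times> real \<Rightarrow> complex" where
  "radial_integral \<mu> z = integral {0..R} (\<lambda>r. of_real (2 * r) * (exp (\<i> * of_real ((\<mu> * (r\<^sup>2 + \<sigma> * q (fst z)))\<^sup>2)) * of_real (Q z 0 r)))"

text \<open>The points at r and -r share the phase, so the integral over all r folds onto [0, R]
  with the summed amplitude. The 1/2 accounts for writing the Jacobian |r| as half of 2 r.\<close>

lemma osc_integral_eq:
  "integrable axis_measure (radial_integral \<mu>)" "osc_integral (Vt t) \<phi> (\<mu>\<^sup>2) = 1 / 2 * (\<integral>z. radial_integral \<mu> z \<partial>axis_measure)"
proof -
  define F where "F p = exp (\<i> * complex_of_real (\<mu>\<^sup>2 * Vt t p)) * complex_of_real (\<phi> p)" for p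
  have cF: "continuous_on UNIV F"
    unfolding F_def Vt_def by (intro continuous_intros smooth_continuous[OF smooth_\<phi>])
  have K: "compact (closure {p. \<phi> p \<noteq> 0})" using \<phi> by (simp add: test_function_def)
  have "integrable lborel (\<lambda>p. indicator (closure {p. \<phi> p \<noteq> 0}) p *\<^sub>R F p)"
    by (rule borel_integrable_compact[OF K]) (rule continuous_on_subset[OF cF], simp)
  moreover have "indicator (closure {p. \<phi> p \<noteq> 0}) p *\<^sub>R F p = F p" for p
    using closure_subset[of "{p. \<phi> p \<noteq> 0}"] by (auto simp: indicator_def F_def)
  ultimately have iF: "integrable lborel F" by simp
  have inner: "(\<integral>r. \<bar>r\<bar> *\<^sub>R F (cyl z r) \<partial>lborel) = 1 / 2 * radial_integral \<mu> z" for z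
  proof -
    have cyl_c: "continuous_on UNIV (\<lambda>r. cyl z r)" unfolding cyl_def by (intro continuous_intros)
    have "(\<integral>r. \<bar>r\<bar> *\<^sub>R F (cyl z r) \<partial>lborel) = integral {0..R} (\<lambda>r. \<bar>r\<bar> *\<^sub>R F (cyl z r) + \<bar>- r\<bar> *\<^sub>R F (cyl z (- r)))"
    proof (rule integral_compact_even_split)
      show "continuous_on UNIV (\<lambda>r. \<bar>r\<bar> *\<^sub>R F (cyl z r))"
        by (intro continuous_intros continuous_on_compose2[OF cF cyl_c]) auto
      show "\<bar>r\<bar> *\<^sub>R F (cyl z r) = 0" if "R \<le> \<bar>r\<bar>" for r
        using R(2)[of r 0 z] that by (simp add: F_def)
    qed (use R(1) in simp)
    also have "\<dots> = integral {0..R} (\<lambda>r. 1 / 2 * (of_real (2 * r) * (exp (\<i> * of_real ((\<mu> * (r\<^sup>2 + \<sigma> * q (fst z)))\<^sup>2)) * of_real (Q z 0 r))))"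
    proof (rule Henstock_Kurzweil_Integration.integral_cong)
      fix r assume r: "r \<in> {0..R}"
      have "\<sigma> * q (fst z) = fst z ^ 4 + t * (fst z)\<^sup>2" using \<sigma> by (auto simp: q_def)
      then have V: "\<mu>\<^sup>2 * Vt t (cyl z r') = (\<mu> * (r\<^sup>2 + \<sigma> * q (fst z)))\<^sup>2" if "r'\<^sup>2 = r\<^sup>2" for r'
        using Vt_cyl[of t "fst z" "snd z" r'] that by (simp add: power_mult_distrib add_ac)
      show "\<bar>r\<bar> *\<^sub>R F (cyl z r) + \<bar>- r\<bar> *\<^sub>R F (cyl z (- r)) =
          1 / 2 * (of_real (2 * r) * (exp (\<i> * of_real ((\<mu> * (r\<^sup>2 + \<sigma> * q (fst z)))\<^sup>2)) * of_real (Q z 0 r)))"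
        using r unfolding F_def V[OF refl] V[OF power2_minus] by (simp add: Q_def g_def scaleR_conv_of_real algebra_simps)
    qed
    also have "\<dots> = 1 / 2 * radial_integral \<mu> z" unfolding radial_integral_def by (rule integral_mult_right)
    finally show ?thesis .
  qed
  have "integrable axis_measure (\<lambda>z. 2 * (1 / 2 * radial_integral \<mu> z))"
    using integral_cyl(1)[OF iF] unfolding inner by (rule integrable_mult_right)
  then show "integrable axis_measure (radial_integral \<mu>)" by simp
  have "osc_integral (Vt t) \<phi> (\<mu>\<^sup>2) = (\<integral>p. F p \<partial>lborel)"
    by (simp add: osc_integral_def F_def)
  also have "\<dots> = (\<integral>z. 1 / 2 * radial_integral \<mu> z \<partial>axis_measure)" unfolding integral_cyl(2)[OF iF] inner ..
  also have "\<dots> = 1 / 2 * (\<integral>z. radial_integral \<mu> z \<partial>axis_measure)" by (rule integral_mult_right_zero)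
  finally show "osc_integral (Vt t) \<phi> (\<mu>\<^sup>2) = 1 / 2 * (\<integral>z. radial_integral \<mu> z \<partial>axis_measure)" .
qed

text \<open>The amplitude part of the contribution of the cone r^2 = q, which matters for \<sigma> =
  -1; it does not involve the large parameter.\<close>

definition cone_mean :: "nat \<Rightarrow> real" where
  "cone_mean j = (\<integral>z. Q z j (sqrt (q (fst z))) \<partial>axis_measure)"

text \<open>The contribution of r = 0. It still depends on \<mu> and is expanded by the second
  stage.\<close>

definition axis_term :: "nat \<Rightarrow> real \<Rightarrow> complex" where
  "axis_term j \<mu> = (\<integral>z. fres (Suc j) (of_real (\<mu> * q (fst z))) * of_real (Q z j 0) \<partial>axis_measure)"

lemma continuous_fres: "continuous_on UNIV (fres k)"
  using fres(2)[of k] unfolding ray_decay_def by (blast intro: holomorphic_on_imp_continuous_on)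

lemma continuous_fres_q: "continuous_on A f \<Longrightarrow> continuous_on A (\<lambda>z. fres k (of_real (\<mu> * q (f z))))"
  by (intro continuous_on_compose2[OF continuous_fres] continuous_intros continuous_q) auto

lemma integrable_terms:
  assumes \<mu>: "\<mu> > 0"
  shows "integrable axis_measure (\<lambda>z. fres (Suc j) (of_real (\<mu> * q (fst z))) * of_real (Q z j 0))"
    and "integrable axis_measure (\<lambda>z. Q z j (sqrt (q (fst z))))"
proof -
  obtain M where M: "M \<ge> 0" "\<forall>z r. \<bar>Q z j r\<bar> \<le> M" using Q_bounded by blast
  obtain C where C: "C \<ge> 0" "\<forall>y\<ge>0. norm (fres (Suc j) (of_real y)) \<le> C" using ray_decay_bounded_real[OF fres(2)] by blast
  show "integrable axis_measure (\<lambda>z. Q z j (sqrt (q (fst z))))"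
    by (rule axis_integral_strip(1)[where C = M and X = X'])
       (use M Q_outside in \<open>auto intro!: borel_measurable_axis continuous_Q_along continuous_intros continuous_q\<close>)
  show "integrable axis_measure (\<lambda>z. fres (Suc j) (of_real (\<mu> * q (fst z))) * of_real (Q z j 0))"
  proof (rule axis_integral_strip(1)[where C = "C * M" and X = X'])
    show "(\<lambda>z. fres (Suc j) (of_real (\<mu> * q (fst z))) * of_real (Q z j 0)) \<in> borel_measurable axis_measure"
      by (intro borel_measurable_axis continuous_intros continuous_fres_q continuous_Q_along)
    fix z :: "real \<times> real"
    show "norm (fres (Suc j) (of_real (\<mu> * q (fst z))) * of_real (Q z j 0)) \<le> C * M"
    proof (cases "X' < \<bar>fst z\<bar>")
      case True then show ?thesis using M C by (simp add: Q_outside)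
    next
      case False
      then have "0 \<le> \<mu> * q (fst z)" using \<mu> q_nonneg[of "fst z"] X by auto
      then have "norm (fres (Suc j) (of_real (\<mu> * q (fst z)))) * \<bar>Q z j 0\<bar> \<le> C * M"
        using C M(1) M(2)[THEN spec[of _ z], THEN spec[of _ 0]] by (intro mult_mono) auto
      then show ?thesis by (simp add: norm_mult)
    qed
  qed (simp add: Q_outside)
qed

text \<open>The radial expansion integrated over z: its remainder bound is uniform in z, and all
  terms vanish for |x| > X'.\<close>

lemma radial_stage:
  "\<exists>C. \<forall>\<mu>>0. norm (osc_integral (Vt t) \<phi> (\<mu>\<^sup>2) -
     1 / 2 * (\<Sum>j<K. of_real ((1 / \<mu>) ^ Suc j) * (kap \<sigma> j * axis_term j \<mu> + lam \<sigma> j * fres (Suc j) 0 * of_real (cone_mean j)))) \<le> C / \<mu> ^ K"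
proof -
  obtain M where M: "M \<ge> 0" "\<forall>z r. \<bar>Q z K r\<bar> \<le> M" using Q_bounded by blast
  obtain C where C: "C \<ge> 0" "\<forall>y\<ge>0. norm (fres K (of_real y)) \<le> C" using ray_decay_bounded_real[OF fres(2)] by blast
  let ?D = "measure axis_measure ({-X'..X'} \<times> UNIV)"
  have "norm (osc_integral (Vt t) \<phi> (\<mu>\<^sup>2) -
     1 / 2 * (\<Sum>j<K. of_real ((1 / \<mu>) ^ Suc j) * (kap \<sigma> j * axis_term j \<mu> + lam \<sigma> j * fres (Suc j) 0 * of_real (cone_mean j))))
     \<le> (1 / 2 * (2 * R * (C * M) * R * ?D)) / \<mu> ^ K" if \<mu>: "\<mu> > 0" for \<mu>
  proof -
    define T where "T j z = of_real ((1 / \<mu>) ^ Suc j) * (kap \<sigma> j * (fres (Suc j) (of_real (\<mu> * q (fst z))) * of_real (Q z j 0))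
        + lam \<sigma> j * fres (Suc j) 0 * of_real (Q z j (sqrt (q (fst z)))))" for j z
    note it = integrable_terms[OF \<mu>]
    have iT: "integrable axis_measure (T j)" for j
      unfolding T_def using it[of j] by (intro integrable_mult_right Bochner_Integration.integrable_add integrable_of_real)
    have T: "(\<integral>z. T j z \<partial>axis_measure) = of_real ((1 / \<mu>) ^ Suc j) * (kap \<sigma> j * axis_term j \<mu> + lam \<sigma> j * fres (Suc j) 0 * of_real (cone_mean j))" for j
    proof -
      have "(\<integral>z. T j z \<partial>axis_measure) = of_real ((1 / \<mu>) ^ Suc j) * ((\<integral>z. kap \<sigma> j * (fres (Suc j) (of_real (\<mu> * q (fst z))) * of_real (Q z j 0)) \<partial>axis_measure)
        + (\<integral>z. lam \<sigma> j * fres (Suc j) 0 * of_real (Q z j (sqrt (q (fst z)))) \<partial>axis_measure))"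
        unfolding T_def integral_mult_right_zero
        by (subst Bochner_Integration.integral_add) (use it[of j] in \<open>auto intro!: integrable_mult_right integrable_of_real\<close>)
      then show ?thesis by (simp only: integral_mult_right_zero integral_complex_of_real axis_term_def cone_mean_def)
    qed
    have bound: "norm (radial_integral \<mu> z - (\<Sum>j<K. T j z)) \<le> 2 * R * (C * M / \<mu> ^ K) * R" for z
    proof (cases "X' < \<bar>fst z\<bar>")
      case True
      have "0 \<le> 2 * R * (C * M / \<mu> ^ K) * R" using M(1) C(1) R(1) \<mu> by simp
      then show ?thesis using True by (simp add: radial_integral_def T_def Q_outside)
    next
      case False
      then have q0: "0 \<le> q (fst z)" using q_nonneg[of "fst z"] X by auto
      have s: "\<sigma> = 1 \<or> \<sigma> = -1 \<and> sqrt (q (fst z)) \<le> R" using \<sigma> R(3)[of "fst z"] False by auto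
      have R0: "0 \<le> R" using R(1) by simp
      have M': "\<bar>Q z K r\<bar> \<le> M" for r using M(2) by blast
      have C': "norm (fres K (of_real y)) \<le> C" if "0 \<le> y" for y using C(2) that by blast
      from radial_expansion[where Q = "Q z", OF R0 q0 s \<mu> Q_derivative Q_R M' C']
      show ?thesis unfolding radial_integral_def T_def by (simp only: mult.assoc)
    qed
    have iS: "integrable axis_measure (\<lambda>z. \<Sum>j<K. T j z)" by (rule Bochner_Integration.integrable_sum) (rule iT)
    have iD: "integrable axis_measure (\<lambda>z. radial_integral \<mu> z - (\<Sum>j<K. T j z))"
      by (rule Bochner_Integration.integrable_diff[OF osc_integral_eq(1) iS])
    have "norm (\<integral>z. radial_integral \<mu> z - (\<Sum>j<K. T j z) \<partial>axis_measure) \<le> (2 * R * (C * M / \<mu> ^ K) * R) * ?D"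
      by (rule axis_integral_strip(2)[OF borel_measurable_integrable[OF iD] bound]) (simp add: radial_integral_def T_def Q_outside)
    moreover have "(\<integral>z. radial_integral \<mu> z - (\<Sum>j<K. T j z) \<partial>axis_measure) = (\<integral>z. radial_integral \<mu> z \<partial>axis_measure) - (\<Sum>j<K. \<integral>z. T j z \<partial>axis_measure)"
      using iT by (subst Bochner_Integration.integral_diff[OF osc_integral_eq(1) iS]) (simp add: Bochner_Integration.integral_sum)
    ultimately have "norm ((\<integral>z. radial_integral \<mu> z \<partial>axis_measure) - (\<Sum>j<K. \<integral>z. T j z \<partial>axis_measure)) \<le> (2 * R * (C * M / \<mu> ^ K) * R) * ?D"
      by (simp only:)
    then have "norm (1 / 2 * ((\<integral>z. radial_integral \<mu> z \<partial>axis_measure) - (\<Sum>j<K. \<integral>z. T j z \<partial>axis_measure))) \<le> 1 / 2 * ((2 * R * (C * M / \<mu> ^ K) * R) * ?D)"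
      unfolding norm_mult by (intro mult_mono) auto
    then show ?thesis unfolding osc_integral_eq(2) T right_diff_distrib
      by (simp only: times_divide_eq_right times_divide_eq_left mult.assoc)
  qed
  then show ?thesis by blast
qed

end

section \<open>Expansion along the x-axis\<close>

context osc_phase
begin

text \<open>Folding x and -x and substituting x = h y turns the argument into (\<nu> y)^m on a
  half-line. The scale is written \<nu>^m so that the result is in powers of 1 / \<nu>; the 2 in
  \<open>\<alpha> 0\<close> comes from the folding and \<open>h0'\<close> from the
  substitution.\<close>

lemma line_stage:
  assumes \<theta>: "smooth \<theta>" and \<theta>0: "\<And>x. X' < \<bar>x\<bar> \<Longrightarrow> \<theta> (x *\<^sub>R axis 1 1 :: real ^ 3) = 0"
  shows "\<exists>\<alpha> C. \<alpha> 0 = - power_chain m k (Suc 0) 0 * of_real (2 * \<theta> 0 * h0') \<and>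
    (\<forall>\<nu>>0. norm ((\<integral>x. fres k (of_real (\<nu> ^ m * q x)) * of_real (\<theta> (x *\<^sub>R axis 1 1)) \<partial>lborel) -
       (\<Sum>i<K. \<alpha> i * of_real ((1 / \<nu>) ^ Suc i))) \<le> C / \<nu> ^ K)"
proof -
  define \<psi> where "\<psi> x = \<theta> (0 + x *\<^sub>R axis 1 1) + \<theta> (0 + x *\<^sub>R (- axis 1 1))" for x
  have k\<psi>: "kdiff k UNIV \<psi>" for k unfolding \<psi>_def by (intro kdiff_add kdiff_smooth_line \<theta>)
  \<comment> \<open>Of the two extra orders, one is spent on passing to h' and one on the continuity
    of the K-th derivative of the new amplitude.\<close>
  have "\<exists>h'. (\<forall>y\<in>S. (h has_real_derivative h' y) (at y)) \<and> kdiff (Suc K) S h'"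
    using h(1)[of "Suc (Suc K)"] by (simp only: kdiff.simps(2)[of "Suc K"])
  then obtain h' where h': "\<forall>y\<in>S. (h has_real_derivative h' y) (at y)" "kdiff (Suc K) S h'"
    by (elim exE conjE)
  have "kdiff (Suc K) S (\<lambda>y. \<psi> (h y) * h' y)"
    by (rule kdiff_mult[OF kdiff_compose[OF UNIV_I k\<psi> h(1)] h'(2)])
  from kdiff_sequence[OF this] obtain Dq where Dq: "Dq 0 = (\<lambda>y. \<psi> (h y) * h' y)"
    "\<forall>j<Suc K. \<forall>x\<in>S. (Dq j has_real_derivative Dq (Suc j) x) (at x)" by (elim exE conjE)
  have BS: "B \<in> S" "0 \<in> S" using S(2) B by auto
  have ch: "continuous_on S h"
    using h'(1) by (intro continuous_at_imp_continuous_on ballI) (blast intro: DERIV_isCont)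
  have \<psi>0: "\<psi> x = 0" if "X' < \<bar>x\<bar>" for x
    using \<theta>0[OF that] \<theta>0[of "- x"] that by (simp add: \<psi>_def)
  \<comment> \<open>h B = X lies strictly beyond X', so h stays beyond X' near B and the amplitude
    vanishes on a neighbourhood of B.\<close>
  have DqB: "Dq j B = 0" if "j \<le> K" for j
  proof (rule derivative_sequence_vanishes[where D = Dq and j = j and x = B and K = "Suc K" and S = "S \<inter> h -` {X'<..}"])
    show "open (S \<inter> h -` {X'<..})" by (rule continuous_open_preimage[OF ch S(1)]) simp
    show "(Dq j has_real_derivative Dq (Suc j) x) (at x)" if "j < Suc K" "x \<in> S \<inter> h -` {X'<..}" for j x
      using Dq(2) that by blast
    show "Dq 0 x = 0" if "x \<in> S \<inter> h -` {X'<..}" for x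
    proof -
      have "X' < \<bar>h x\<bar>" using that by auto
      then show ?thesis by (simp add: Dq(1) \<psi>0)
    qed
    show "B \<in> S \<inter> h -` {X'<..}" using BS h(3) X by auto
  qed (use that in simp)
  have dq: "(Dq i has_real_derivative Dq (Suc i) y) (at y)" if "i < Suc K" "0 \<le> y" "y \<le> B" for i y
    using Dq(2) that S(2) by (meson atLeastAtMost_iff subsetD)
  have cDq: "continuous_on {0..B} (Dq K)"
    by (intro continuous_at_imp_continuous_on ballI DERIV_isCont[OF dq[of K]]) auto
  obtain C where C: "\<forall>\<nu>>0. norm (integral {0..B} (\<lambda>y. fres k (of_real ((\<nu> * y) ^ m)) * of_real (Dq 0 y)) -
     (\<Sum>i<K. - ((-1) ^ i) * of_real ((1 / \<nu>) ^ Suc i) * power_chain m k (Suc i) 0 * of_real (Dq i 0))) \<le> C / \<nu> ^ K"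
    using half_line_expansion[OF m B dq cDq DqB, of k] by auto
  define \<alpha> where "\<alpha> i = - ((-1) ^ i) * power_chain m k (Suc i) 0 * of_real (Dq i 0)" for i
  have "h' 0 = h0'" using h'(1) BS h0' DERIV_unique by blast
  then have \<alpha>0: "\<alpha> 0 = - power_chain m k (Suc 0) 0 * of_real (2 * \<theta> 0 * h0')"
    by (simp add: \<alpha>_def Dq(1) h(2) \<psi>_def)
  have eq: "(\<integral>x. fres k (of_real (\<nu> ^ m * q x)) * of_real (\<theta> (x *\<^sub>R axis 1 1)) \<partial>lborel)
     = integral {0..B} (\<lambda>y. fres k (of_real ((\<nu> * y) ^ m)) * of_real (Dq 0 y))" for \<nu>
  proof -
    have c\<theta>: "continuous_on UNIV (\<lambda>x. \<theta> (x *\<^sub>R axis 1 1))"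
      by (intro continuous_on_compose2[OF smooth_continuous[OF \<theta>]] continuous_intros) auto
    have c\<psi>: "continuous_on A \<psi>" for A
      unfolding \<psi>_def by (intro continuous_intros continuous_on_compose2[OF smooth_continuous[OF \<theta>]]) auto
    let ?f = "\<lambda>x. fres k (of_real (\<nu> ^ m * q x)) * of_real (\<psi> x)"
    have "(\<integral>x. fres k (of_real (\<nu> ^ m * q x)) * of_real (\<theta> (x *\<^sub>R axis 1 1)) \<partial>lborel)
      = integral {0..X} (\<lambda>x. fres k (of_real (\<nu> ^ m * q x)) * of_real (\<theta> (x *\<^sub>R axis 1 1))
          + fres k (of_real (\<nu> ^ m * q (- x))) * of_real (\<theta> ((- x) *\<^sub>R axis 1 1)))"
    proof (rule integral_compact_even_split)
      show "continuous_on UNIV (\<lambda>x. fres k (of_real (\<nu> ^ m * q x)) * of_real (\<theta> (x *\<^sub>R axis 1 1)))"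
        by (intro continuous_intros continuous_fres_q c\<theta>)
    qed (use X \<theta>0 in auto)
    also have "\<dots> = integral {0..X} ?f"
      by (simp add: q_minus \<psi>_def algebra_simps)
    also have "\<dots> = integral {h 0..h B} ?f" by (simp add: h)
    also have "\<dots> = integral {0..B} (\<lambda>y. h' y *\<^sub>R ?f (h y))"
    proof -
      have "compact (h ` {0..B})" by (intro compact_continuous_image continuous_on_subset[OF ch S(2)]) simp
      then have "bounded (h ` {0..B})" by (rule compact_imp_bounded)
      then obtain c where c: "\<forall>y\<in>h ` {0..B}. norm y \<le> c" unfolding bounded_iff by blast
      have "((\<lambda>y. h' y *\<^sub>R ?f (h y)) has_integral integral {h 0..h B} ?f) {0..B}"
      proof (rule has_integral_substitution[OF B])
        show "h ` {0..B} \<subseteq> {-c..c}"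
        proof
          fix y assume "y \<in> h ` {0..B}"
          from bspec[OF c this] show "y \<in> {-c..c}" by auto
        qed
        show "continuous_on {-c..c} ?f" by (intro continuous_intros continuous_fres_q c\<psi>)
        show "(h has_real_derivative h' y) (at y within {0..B})" if "y \<in> {0..B}" for y
          using h'(1) that S(2) by (meson has_field_derivative_at_within subsetD)
      qed (use X in \<open>simp add: h\<close>)
      then show ?thesis by (simp add: integral_unique)
    qed
    also have "\<dots> = integral {0..B} (\<lambda>y. fres k (of_real ((\<nu> * y) ^ m)) * of_real (Dq 0 y))"
    proof (rule Henstock_Kurzweil_Integration.integral_cong)
      fix y assume "y \<in> {0..B}"
      then have "q (h y) = y ^ m" using hq' by (simp add: q_def)
      then show "h' y *\<^sub>R ?f (h y) = fres k (of_real ((\<nu> * y) ^ m)) * of_real (Dq 0 y)"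
        by (simp add: Dq(1) power_mult_distrib scaleR_conv_of_real)
    qed
    finally show ?thesis .
  qed
  have "norm ((\<integral>x. fres k (of_real (\<nu> ^ m * q x)) * of_real (\<theta> (x *\<^sub>R axis 1 1)) \<partial>lborel) -
       (\<Sum>i<K. \<alpha> i * of_real ((1 / \<nu>) ^ Suc i))) \<le> C / \<nu> ^ K" if "\<nu> > 0" for \<nu>
  proof -
    have "(\<Sum>i<K. \<alpha> i * of_real ((1 / \<nu>) ^ Suc i)) =
      (\<Sum>i<K. - ((-1) ^ i) * of_real ((1 / \<nu>) ^ Suc i) * power_chain m k (Suc i) 0 * of_real (Dq i 0))"
      by (intro sum.cong) (simp_all add: \<alpha>_def)
    then show ?thesis unfolding eq using C that by simp
  qed
  with \<alpha>0 show ?thesis by blast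
qed

text \<open>At r = 0 all directions meet the same axis point and the phase depends on x alone, so
  the directions can be averaged first; the averaged amplitude is again smooth. The 4 for j = 0
  collects the two values at r and -r and the two halves of the x-axis.\<close>

lemma axis_term_stage:
  "\<exists>\<alpha> C. (j = 0 \<longrightarrow> \<alpha> 0 = - power_chain m (Suc 0) (Suc 0) 0 * of_real (4 * \<phi> 0 * measure direction_measure UNIV * h0')) \<and>
    (\<forall>\<nu>>0. norm (axis_term j (\<nu> ^ m) - (\<Sum>i<K. \<alpha> i * of_real ((1 / \<nu>) ^ Suc i))) \<le> C / \<nu> ^ K)"
proof -
  interpret DM: finite_measure direction_measure by (rule finite_direction_measure)
  interpret P: pair_sigma_finite lborel direction_measure ..
  have "direction \<in> borel_measurable direction_measure"
    using measurable_direction by (simp add: measurable_cong_sets[OF sets_direction_measure refl])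
  from ddn_average_test_function[OF finite_direction_measure this _ \<phi>, of "\<lambda>_. 1" 1 "2 * j"]
  obtain \<theta> where \<theta>: "test_function UNIV \<theta>" "\<forall>x. (\<integral>s. (dd (direction s) ^^ (2 * j)) \<phi> x \<partial>direction_measure) = \<theta> x"
    by (auto simp: norm_direction)
  define \<theta>' where "\<theta>' x = (2 * wmass j) * \<theta> x" for x
  have Q0: "Q (x, s) j 0 = (2 * wmass j) * (dd (direction s) ^^ (2 * j)) \<phi> (x *\<^sub>R axis 1 1)" for x s
    unfolding Q_def even_root_deriv_0 g_def by (simp add: cyl_def)
  have Qs: "(\<integral>s. Q (x, s) j 0 \<partial>direction_measure) = \<theta>' (x *\<^sub>R axis 1 1)" for x
    unfolding Q0 \<theta>'_def using \<theta>(2) by simp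
  have "smooth \<theta>'" unfolding \<theta>'_def
    by (intro smooth_mult smooth_const test_function_smooth[OF \<theta>(1)])
  moreover have "\<theta>' (x *\<^sub>R axis 1 1) = 0" if "X' < \<bar>x\<bar>" for x
    using that unfolding Qs[symmetric] by (simp add: Q_outside)
  ultimately obtain \<alpha> C where \<alpha>: "\<alpha> 0 = - power_chain m (Suc j) (Suc 0) 0 * of_real (2 * \<theta>' 0 * h0')"
    "\<forall>\<nu>>0. norm ((\<integral>x. fres (Suc j) (of_real (\<nu> ^ m * q x)) * of_real (\<theta>' (x *\<^sub>R axis 1 1)) \<partial>lborel) -
       (\<Sum>i<K. \<alpha> i * of_real ((1 / \<nu>) ^ Suc i))) \<le> C / \<nu> ^ K"
    using line_stage[of \<theta>' "Suc j" K] by blast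
  have "axis_term j (\<nu> ^ m) = (\<integral>x. fres (Suc j) (of_real (\<nu> ^ m * q x)) * of_real (\<theta>' (x *\<^sub>R axis 1 1)) \<partial>lborel)" if "\<nu> > 0" for \<nu>
  proof -
    have "\<nu> ^ m > 0" using that by simp
    from P.integral_fst'[OF integrable_terms(1)[OF this]]
    have "axis_term j (\<nu> ^ m) = (\<integral>x. \<integral>s. fres (Suc j) (of_real (\<nu> ^ m * q x)) * of_real (Q (x, s) j 0) \<partial>direction_measure \<partial>lborel)"
      by (simp add: axis_term_def)
    also have "\<dots> = (\<integral>x. fres (Suc j) (of_real (\<nu> ^ m * q x)) * of_real (\<theta>' (x *\<^sub>R axis 1 1)) \<partial>lborel)"
      by (simp only: integral_mult_right_zero integral_complex_of_real Qs)
    finally show ?thesis .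
  qed
  moreover have "2 * \<theta>' 0 = 4 * \<phi> 0 * measure direction_measure UNIV" if "j = 0"
    using \<theta>(2)[THEN spec[of _ 0]] that
    by (simp add: \<theta>'_def wmass_def) (simp add: mult.commute)
  ultimately show ?thesis using \<alpha> by (intro exI[of _ \<alpha>] exI[of _ C]) auto
qed

lemma norm_kap: "norm (kap \<sigma> j) = 1"
  by (simp add: kap_def norm_power)

text \<open>Both stages are expressed in \<nu>, with \<mu> = \<nu>^m. For \<nu> \<ge> 1 the radial
  remainder of order \<nu>^(- m K) and the axis remainders, multiplied by factors of norm at most 1,
  are all within a constant times \<nu>^(- K).\<close>

lemma full_expansion:
  "\<exists>a C. a 0 0 = - kap \<sigma> 0 * power_chain m (Suc 0) (Suc 0) 0 * of_real (2 * \<phi> 0 * measure direction_measure UNIV * h0') \<and>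
    (\<forall>\<nu>\<ge>1. norm (osc_integral (Vt t) \<phi> (\<nu> ^ (2 * m)) -
      ((\<Sum>j<K. \<Sum>i<K. a j i * of_real ((1 / \<nu> ^ m) ^ Suc j * (1 / \<nu>) ^ Suc i)) +
       (\<Sum>j<K. (1 / 2 * lam \<sigma> j * fres (Suc j) 0 * of_real (cone_mean j)) * of_real ((1 / \<nu> ^ m) ^ Suc j)))) \<le> C / \<nu> ^ K)"
proof -
  define P where "P j \<alpha> C \<longleftrightarrow> (j = 0 \<longrightarrow> \<alpha> 0 = - power_chain m (Suc 0) (Suc 0) 0 * of_real (4 * \<phi> 0 * measure direction_measure UNIV * h0')) \<and>
    (\<forall>\<nu>>0. norm (axis_term j (\<nu> ^ m) - (\<Sum>i<K. \<alpha> i * of_real ((1 / \<nu>) ^ Suc i))) \<le> C / \<nu> ^ K)" for j :: nat and \<alpha> and C :: real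
  have "\<forall>j. \<exists>\<alpha> C. P j \<alpha> C" unfolding P_def using axis_term_stage by blast
  then obtain \<alpha> C1 where \<alpha>: "\<And>j. P j (\<alpha> j) (C1 j)" by metis
  obtain C0 where C0: "\<forall>\<mu>>0. norm (osc_integral (Vt t) \<phi> (\<mu>\<^sup>2) -
     1 / 2 * (\<Sum>j<K. of_real ((1 / \<mu>) ^ Suc j) * (kap \<sigma> j * axis_term j \<mu> + lam \<sigma> j * fres (Suc j) 0 * of_real (cone_mean j)))) \<le> C0 / \<mu> ^ K"
    using radial_stage[of K] by blast
  define a where "a j i = 1 / 2 * kap \<sigma> j * \<alpha> j i" for j i
  define C where "C = C0 + (\<Sum>j<K. C1 j)"
  have "norm (osc_integral (Vt t) \<phi> (\<nu> ^ (2 * m)) -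
      ((\<Sum>j<K. \<Sum>i<K. a j i * of_real ((1 / \<nu> ^ m) ^ Suc j * (1 / \<nu>) ^ Suc i)) +
       (\<Sum>j<K. (1 / 2 * lam \<sigma> j * fres (Suc j) 0 * of_real (cone_mean j)) * of_real ((1 / \<nu> ^ m) ^ Suc j)))) \<le> C / \<nu> ^ K"
    if \<nu>: "\<nu> \<ge> 1" for \<nu>
  proof -
    have fin: "(x - u) + v = x - (s + l)" if "s = r" "u - v = r + l" for x u v s r l :: complex
      unfolding that(1) that(2)[symmetric] by simp
    have alg: "1 / 2 * (\<Sum>j<K. p j * (k j * g j + l j)) - (\<Sum>j<K. 1 / 2 * p j * k j * (g j - A j))
       = (\<Sum>j<K. 1 / 2 * p j * k j * A j) + (\<Sum>j<K. (1 / 2 * l j) * p j)" for p k g l A :: "nat \<Rightarrow> complex"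
      unfolding sum_distrib_left sum_subtractf[symmetric] sum.distrib[symmetric]
      by (intro sum.cong refl) (simp add: field_simps)
    let ?p = "\<lambda>j. complex_of_real ((1 / \<nu> ^ m) ^ Suc j)"
    let ?J = "osc_integral (Vt t) \<phi> ((\<nu> ^ m)\<^sup>2)"
    let ?A = "\<lambda>j. \<Sum>i<K. \<alpha> j i * of_real ((1 / \<nu>) ^ Suc i)"
    let ?L = "\<lambda>j. lam \<sigma> j * fres (Suc j) 0 * of_real (cone_mean j)"
    have \<nu>0: "\<nu> > 0" using \<nu> by simp
    have \<nu>m: "1 \<le> \<nu> ^ m" using \<nu> by simp
    have C0': "norm (?J - 1 / 2 * (\<Sum>j<K. ?p j * (kap \<sigma> j * axis_term j (\<nu> ^ m) + ?L j))) \<le> C0 / (\<nu> ^ m) ^ K"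
      by (rule C0[rule_format]) (use \<nu>0 in simp)
    \<comment> \<open>\<open>C0\<close> is known only through the estimate, so its sign is read off
      from there before the denominator is made smaller.\<close>
    have "0 \<le> C0 / (\<nu> ^ m) ^ K" using order_trans[OF norm_ge_zero C0'] .
    moreover have "0 < (\<nu> ^ m) ^ K" using \<nu>0 by simp
    ultimately have "0 \<le> C0" by (auto simp: zero_le_divide_iff)
    have "\<nu> ^ 1 \<le> \<nu> ^ m" using m \<nu> by (intro power_increasing) auto
    then have "\<nu> ^ K \<le> (\<nu> ^ m) ^ K" using \<nu> by (intro power_mono) auto
    then have "C0 / (\<nu> ^ m) ^ K \<le> C0 / \<nu> ^ K" using \<open>0 \<le> C0\<close> \<nu> by (intro divide_left_mono) auto
    with C0' have 1: "norm (?J - 1 / 2 * (\<Sum>j<K. ?p j * (kap \<sigma> j * axis_term j (\<nu> ^ m) + ?L j))) \<le> C0 / \<nu> ^ K" by simp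
    have "norm (\<Sum>j<K. 1 / 2 * ?p j * kap \<sigma> j * (axis_term j (\<nu> ^ m) - ?A j)) \<le> (\<Sum>j<K. C1 j / \<nu> ^ K)"
    proof (rule sum_norm_le)
      fix j
      have b: "norm (axis_term j (\<nu> ^ m) - ?A j) \<le> C1 j / \<nu> ^ K" using \<alpha>[of j] \<nu>0 unfolding P_def by blast
      have "norm (1 / 2 * ?p j) \<le> 1"
      proof -
        have "(1 / \<nu> ^ m) ^ Suc j \<le> 1" using \<nu>m by (intro power_le_one) auto
        moreover have "0 \<le> (1 / \<nu> ^ m) ^ Suc j" using \<nu>m by (intro zero_le_power) auto
        ultimately show ?thesis unfolding norm_mult norm_of_real by (simp del: power_Suc)
      qed
      then have "norm (1 / 2 * ?p j) * norm (axis_term j (\<nu> ^ m) - ?A j) \<le> 1 * (C1 j / \<nu> ^ K)"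
        using b by (intro mult_mono) auto
      then show "norm (1 / 2 * ?p j * kap \<sigma> j * (axis_term j (\<nu> ^ m) - ?A j)) \<le> C1 j / \<nu> ^ K"
        by (simp only: norm_mult[of _ "kap \<sigma> j"] norm_mult[of _ "axis_term j (\<nu> ^ m) - ?A j"] norm_kap mult_1_right mult_1_left)
    qed
    from norm_triangle_mono[OF 1 this]
    have 2: "norm ((?J - 1 / 2 * (\<Sum>j<K. ?p j * (kap \<sigma> j * axis_term j (\<nu> ^ m) + ?L j))) + (\<Sum>j<K. 1 / 2 * ?p j * kap \<sigma> j * (axis_term j (\<nu> ^ m) - ?A j)))
       \<le> C0 / \<nu> ^ K + (\<Sum>j<K. C1 j / \<nu> ^ K)" .
    have "(\<Sum>j<K. \<Sum>i<K. a j i * of_real ((1 / \<nu> ^ m) ^ Suc j * (1 / \<nu>) ^ Suc i)) = (\<Sum>j<K. 1 / 2 * ?p j * kap \<sigma> j * ?A j)"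
      unfolding a_def of_real_mult sum_distrib_left by (intro sum.cong refl) (simp only: mult_ac)
    moreover have "1 / 2 * (\<Sum>j<K. ?p j * (kap \<sigma> j * axis_term j (\<nu> ^ m) + ?L j)) - (\<Sum>j<K. 1 / 2 * ?p j * kap \<sigma> j * (axis_term j (\<nu> ^ m) - ?A j))
       = (\<Sum>j<K. 1 / 2 * ?p j * kap \<sigma> j * ?A j) + (\<Sum>j<K. (1 / 2 * lam \<sigma> j * fres (Suc j) 0 * of_real (cone_mean j)) * ?p j)"
      using alg[where p = ?p and k = "kap \<sigma>" and g = "\<lambda>j. axis_term j (\<nu> ^ m)" and l = ?L and A = ?A] by (simp only: mult.assoc)
    ultimately have "(?J - 1 / 2 * (\<Sum>j<K. ?p j * (kap \<sigma> j * axis_term j (\<nu> ^ m) + ?L j))) + (\<Sum>j<K. 1 / 2 * ?p j * kap \<sigma> j * (axis_term j (\<nu> ^ m) - ?A j))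
      = ?J - ((\<Sum>j<K. \<Sum>i<K. a j i * of_real ((1 / \<nu> ^ m) ^ Suc j * (1 / \<nu>) ^ Suc i)) +
       (\<Sum>j<K. (1 / 2 * lam \<sigma> j * fres (Suc j) 0 * of_real (cone_mean j)) * ?p j))"
      by (rule fin)
    with 2 have "norm (?J - ((\<Sum>j<K. \<Sum>i<K. a j i * of_real ((1 / \<nu> ^ m) ^ Suc j * (1 / \<nu>) ^ Suc i)) +
       (\<Sum>j<K. (1 / 2 * lam \<sigma> j * fres (Suc j) 0 * of_real (cone_mean j)) * ?p j))) \<le> C0 / \<nu> ^ K + (\<Sum>j<K. C1 j / \<nu> ^ K)"
      by (simp only:)
    also have "\<dots> = C / \<nu> ^ K" by (simp add: C_def add_divide_distrib sum_divide_distrib)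
    also have "(\<nu> ^ m)\<^sup>2 = \<nu> ^ (2 * m)" by (simp add: power_mult[symmetric] mult.commute)
    finally show ?thesis .
  qed
  moreover have "a 0 0 = - kap \<sigma> 0 * power_chain m (Suc 0) (Suc 0) 0 * of_real (2 * \<phi> 0 * measure direction_measure UNIV * h0')"
    using \<alpha>[of 0] unfolding P_def by (simp add: a_def)
  ultimately show ?thesis by blast
qed

text \<open>For j = 0 the integrand is a sum of two values of \<phi>; over x = 0 the cone
  degenerates to the origin, where both are positive.\<close>

lemma cone_mean_0_nonzero:
  assumes "\<And>p. 0 \<le> \<phi> p" "0 < \<phi> 0"
  shows "cone_mean 0 \<noteq> 0"
  unfolding cone_mean_def
proof (rule axis_integral_pos)
  show "continuous_on UNIV (\<lambda>z. Q z 0 (sqrt (q (fst z))))"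
    by (intro continuous_Q_along continuous_intros continuous_q)
  show "integrable axis_measure (\<lambda>z. Q z 0 (sqrt (q (fst z))))"
    by (rule integrable_terms(2)[of 1]) simp
  show "0 \<le> Q z 0 (sqrt (q (fst z)))" for z
    using assms(1) by (simp add: Q_def g_def)
  show "0 < Q (0, 0) 0 (sqrt (q (fst (0, 0))))"
    using assms(2) by (simp add: Q_def g_def q_def cyl_def)
qed

end

text \<open>Setting \<nu> = \<Lambda> powr (1 / (2 m)) makes monomials in 1 / \<nu> powers of
  \<Lambda>, and \<open>e\<close> and \<open>e'\<close> locate them in the progression. Exponents of
  the second family are matched only where b is nonzero: for \<sigma> = 1 its coefficients vanish
  while its first exponent 1/2 lies below \<beta>.\<close>

lemma is_expansion_of_powers:
  fixes a :: "nat \<Rightarrow> nat \<Rightarrow> complex" and e :: "nat \<Rightarrow> nat \<Rightarrow> nat" and m :: nat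
  assumes m: "m > 0"
    and bound: "\<And>\<nu>. 1 \<le> \<nu> \<Longrightarrow> norm (f (\<nu> ^ (2 * m)) -
      ((\<Sum>j<K. \<Sum>i<K. a j i * of_real ((1 / \<nu> ^ m) ^ Suc j * (1 / \<nu>) ^ Suc i)) +
       (\<Sum>j<K. b j * of_real ((1 / \<nu> ^ m) ^ Suc j)))) \<le> C / \<nu> ^ K"
    and e: "\<And>j i. real (Suc j) / 2 + real (Suc i) / (2 * real m) = \<beta> + real (e j i) / 8"
    and e': "\<And>j. b j \<noteq> 0 \<Longrightarrow> real (Suc j) / 2 = \<beta> + real (e' j) / 8"
    and K: "\<beta> + real N / 8 < real K / (2 * real m)"
  shows "is_expansion \<beta> N f (\<lambda>l. (\<Sum>j<K. \<Sum>i<K. if l = e j i then a j i else 0) + (\<Sum>j<K. if l = e' j then b j else 0))"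
proof -
  define M where "M \<Lambda> = (\<Sum>j<K. \<Sum>i<K. a j i * inv_power \<beta> (e j i) \<Lambda>) +
       (\<Sum>j<K. b j * inv_power \<beta> (e' j) \<Lambda>)" for \<Lambda>
  have "norm (f \<Lambda> - M \<Lambda>) \<le> C * \<Lambda> powr - (real K / (2 * real m))" if \<Lambda>: "1 \<le> \<Lambda>" for \<Lambda>
  proof -
    define \<nu> where "\<nu> = \<Lambda> powr (1 / (2 * real m))"
    have \<nu>: "1 \<le> \<nu>" using \<Lambda> by (simp add: \<nu>_def ge_one_powr_ge_zero)
    have pw: "\<nu> ^ l = \<Lambda> powr (real l / (2 * real m))" for l
      using \<nu> \<Lambda> by (simp add: \<nu>_def powr_powr powr_realpow[symmetric])
    have p1: "(1 / \<nu> ^ m) ^ Suc j = \<Lambda> powr - (real (Suc j) / 2)" for j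
    proof -
      have "(1 / \<nu> ^ m) ^ Suc j = 1 / \<nu> ^ (m * Suc j)" by (simp only: power_one_over power_mult)
      also have "\<dots> = \<Lambda> powr - (real (m * Suc j) / (2 * real m))" unfolding pw by (simp add: powr_minus_divide)
      also have "real (m * Suc j) / (2 * real m) = real (Suc j) / 2" using m by (simp add: field_simps)
      finally show ?thesis .
    qed
    have p2: "(1 / \<nu>) ^ Suc i = \<Lambda> powr - (real (Suc i) / (2 * real m))" for i
      unfolding power_one_over pw by (simp add: powr_minus_divide)
    have q1: "(1 / \<nu> ^ m) ^ Suc j * (1 / \<nu>) ^ Suc i = \<Lambda> powr - (\<beta> + real (e j i) / 8)" for j i
      unfolding p1 p2 e[symmetric] powr_add[symmetric] by (simp add: add.commute)
    have q2: "b j * complex_of_real ((1 / \<nu> ^ m) ^ Suc j) = b j * inv_power \<beta> (e' j) \<Lambda>" for j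
    proof (cases "b j = 0")
      case False
      show ?thesis unfolding p1 e'[OF False] ..
    qed simp
    have "\<nu> ^ (2 * m) = \<Lambda>" unfolding pw using m \<Lambda> by simp
    moreover have "C / \<nu> ^ K = C * \<Lambda> powr - (real K / (2 * real m))" unfolding pw by (simp add: powr_minus_divide)
    ultimately show ?thesis using bound[OF \<nu>] unfolding q1 q2 M_def by simp
  qed
  from is_expansion_bound[OF this K] have 1: "is_expansion \<beta> N (\<lambda>\<Lambda>. f \<Lambda> - M \<Lambda>) (\<lambda>_. 0)" .
  have 2: "is_expansion \<beta> N M (\<lambda>l. (\<Sum>j<K. \<Sum>i<K. if l = e j i then a j i else 0) + (\<Sum>j<K. if l = e' j then b j else 0))"
    unfolding M_def by (intro is_expansion_add is_expansion_sum is_expansion_monomial)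
  from is_expansion_add[OF 1 2] show ?thesis by simp
qed

section \<open>Oscillation indices\<close>

text \<open>Otherwise the whole plane would be an open null set of the axis measure; the value of
  the total mass is not computed.\<close>

lemma measure_direction_measure_pos: "0 < measure direction_measure UNIV"
proof (rule ccontr)
  interpret finite_measure direction_measure by (rule finite_direction_measure)
  assume "\<not> 0 < measure direction_measure UNIV"
  then have "measure direction_measure UNIV = 0"
    using measure_nonneg[of direction_measure UNIV] by linarith
  then have "emeasure direction_measure UNIV = 0" by (simp add: emeasure_eq_measure)
  moreover have "emeasure axis_measure (UNIV \<times> UNIV) = emeasure lborel (UNIV :: real set) * emeasure direction_measure UNIV"
    by (rule emeasure_pair_measure_Times) auto
  ultimately have "emeasure axis_measure UNIV = 0" by simp
  moreover have "UNIV \<in> sets axis_measure" unfolding sets_axis_measure by simp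
  ultimately have "UNIV \<in> null_sets axis_measure" by (rule null_setsI)
  from axis_open_null[OF this] show False by simp
qed

context osc_phase
begin

lemma large_order: "\<exists>K>0. (x::real) < real K / (2 * real m)"
proof -
  obtain K where K: "max 0 (x * (2 * real m)) < real K" using reals_Archimedean2 by blast
  then have "x < real K / (2 * real m)" using m by (simp add: pos_less_divide_eq)
  moreover have "K > 0" using K by (cases K) auto
  ultimately show ?thesis by blast
qed

text \<open>With \<open>lam\<close> zero, the least exponent arises from one integration in each
  stage. By \<open>e0\<close> no other pair reaches it, so nothing can cancel the leading
  coefficient.\<close>

lemma expansion_definite:
  assumes "\<sigma> = 1"
    and e: "\<And>j i. real (Suc j) / 2 + real (Suc i) / (2 * real m) = \<beta> + real (e j i) / 8"
    and e0: "\<And>j i. e j i = 0 \<longleftrightarrow> j = 0 \<and> i = 0"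
  shows "\<exists>c. c 0 = power_chain m (Suc 0) (Suc 0) 0 * of_real (2 * \<phi> 0 * measure direction_measure UNIV * h0')
     \<and> is_expansion \<beta> N (osc_integral (Vt t) \<phi>) c"
proof -
  obtain K where K: "K > 0" "\<beta> + real N / 8 < real K / (2 * real m)" using large_order by blast
  let ?b = "\<lambda>j. 1 / 2 * lam \<sigma> j * fres (Suc j) 0 * of_real (cone_mean j)"
  obtain a C where a0: "a 0 0 = - kap \<sigma> 0 * power_chain m (Suc 0) (Suc 0) 0 * of_real (2 * \<phi> 0 * measure direction_measure UNIV * h0')"
    and C: "\<forall>\<nu>\<ge>1. norm (osc_integral (Vt t) \<phi> (\<nu> ^ (2 * m)) -
      ((\<Sum>j<K. \<Sum>i<K. a j i * of_real ((1 / \<nu> ^ m) ^ Suc j * (1 / \<nu>) ^ Suc i)) +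
       (\<Sum>j<K. ?b j * of_real ((1 / \<nu> ^ m) ^ Suc j)))) \<le> C / \<nu> ^ K"
    using full_expansion[of K] by blast
  have E: "is_expansion \<beta> N (osc_integral (Vt t) \<phi>)
     (\<lambda>l. (\<Sum>j<K. \<Sum>i<K. if l = e j i then a j i else 0) + (\<Sum>j<K. if l = 0 then ?b j else 0))"
    by (rule is_expansion_of_powers[OF m C[rule_format] e _ K(2)])
       (simp_all add: \<open>\<sigma> = 1\<close> lam_def)
  have Z: "(\<Sum>j<K. \<Sum>i<K. if 0 = e j i then a j i else 0) + (\<Sum>j<K. if (0::nat) = 0 then ?b j else 0)
     = power_chain m (Suc 0) (Suc 0) 0 * of_real (2 * \<phi> 0 * measure direction_measure UNIV * h0')"
  proof -
    have "(\<Sum>j<K. \<Sum>i<K. if 0 = e j i then a j i else 0) = (\<Sum>j<K. if j = 0 then \<Sum>i<K. if i = 0 then a 0 0 else 0 else 0)"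
      using e0 by (intro sum.cong refl) (auto intro!: sum.cong sum.neutral simp: eq_commute[of 0])
    also have "\<dots> = a 0 0" using K(1) by simp
    also have "\<dots> = power_chain m (Suc 0) (Suc 0) 0 * of_real (2 * \<phi> 0 * measure direction_measure UNIV * h0')"
      unfolding a0 by (simp add: \<open>\<sigma> = 1\<close> kap_def)
    finally show ?thesis by (simp add: \<open>\<sigma> = 1\<close> lam_def)
  qed
  show ?thesis by (rule exI, rule conjI[rotated], rule E, rule Z)
qed

text \<open>Terms that pass through the second stage have exponent at least 1/2 + 1/4, so index 0 is
  reached only by the first cone term, whose weight is half of \<open>lam \<sigma> 0\<close> =
  -2.\<close>

lemma expansion_indefinite:
  assumes "\<sigma> = -1" "m = 2"
  shows "\<exists>c. c 0 = - fres (Suc 0) 0 * of_real (cone_mean 0) \<and> is_expansion (1 / 2) N (osc_integral (Vt t) \<phi>) c"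
proof -
  obtain K where K: "K > 0" "1 / 2 + real N / 8 < real K / (2 * real m)" using large_order by blast
  let ?b = "\<lambda>j. 1 / 2 * lam \<sigma> j * fres (Suc j) 0 * of_real (cone_mean j)"
  obtain a C where C: "\<forall>\<nu>\<ge>1. norm (osc_integral (Vt t) \<phi> (\<nu> ^ (2 * m)) -
      ((\<Sum>j<K. \<Sum>i<K. a j i * of_real ((1 / \<nu> ^ m) ^ Suc j * (1 / \<nu>) ^ Suc i)) +
       (\<Sum>j<K. ?b j * of_real ((1 / \<nu> ^ m) ^ Suc j)))) \<le> C / \<nu> ^ K"
    using full_expansion[of K] by blast
  have E: "is_expansion (1 / 2) N (osc_integral (Vt t) \<phi>)
     (\<lambda>l. (\<Sum>j<K. \<Sum>i<K. if l = 4 * j + 2 * i + 2 then a j i else 0) + (\<Sum>j<K. if l = 4 * j then ?b j else 0))"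
    by (rule is_expansion_of_powers[OF m C[rule_format] _ _ K(2)])
       (simp_all add: \<open>m = 2\<close> field_simps)
  have Z: "(\<Sum>j<K. \<Sum>i<K. if 0 = 4 * j + 2 * i + 2 then a j i else 0) + (\<Sum>j<K. if 0 = 4 * j then ?b j else 0)
     = - fres (Suc 0) 0 * of_real (cone_mean 0)"
  proof -
    have "(\<Sum>j<K. if 0 = 4 * j then ?b j else 0) = (\<Sum>j<K. if j = 0 then ?b 0 else 0)"
      by (intro sum.cong) auto
    also have "\<dots> = ?b 0" using K(1) by simp
    finally show ?thesis by (simp add: \<open>\<sigma> = -1\<close> lam_def)
  qed
  show ?thesis by (rule exI, rule conjI[rotated], rule E, rule Z)
qed

end

section \<open>Straightening the phase on the axis\<close>

text \<open>The solution $x$ of $|x^4 + t x^2| = y^2$ with the sign of $y$, written without cancellation.\<close>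

definition square_root_map :: "real \<Rightarrow> real \<Rightarrow> real" where
  "square_root_map t y = y * (sqrt 2 * (\<bar>t\<bar> + (t\<^sup>2 + 4 * sgn t * y\<^sup>2) powr (1 / 2)) powr (- (1 / 2)))"

text \<open>With r the root of the discriminant, (r - |t|) (r + |t|) = 4 sgn t y^2 undoes the
  rationalisation and recovers the usual solution of the quadratic equation in x^2.\<close>

lemma square_root_map_square:
  assumes "t \<noteq> 0" and r: "0 \<le> t\<^sup>2 + 4 * sgn t * y\<^sup>2"
  shows "(square_root_map t y)\<^sup>2 = sgn t * (sqrt (t\<^sup>2 + 4 * sgn t * y\<^sup>2) - \<bar>t\<bar>) / 2"
proof -
  define r where "r = sqrt (t\<^sup>2 + 4 * sgn t * y\<^sup>2)"
  have r0: "0 \<le> r" "r\<^sup>2 = t\<^sup>2 + 4 * sgn t * y\<^sup>2" using r by (auto simp: r_def)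
  have pos: "0 < \<bar>t\<bar> + r" using \<open>t \<noteq> 0\<close> r0 by simp
  have "((\<bar>t\<bar> + r) powr (- (1 / 2)))\<^sup>2 = (\<bar>t\<bar> + r) powr (- 1)"
    by (simp add: power2_eq_square powr_add[symmetric])
  also have "\<dots> = 1 / (\<bar>t\<bar> + r)" using pos by (simp add: powr_minus_divide)
  finally have sq: "(square_root_map t y)\<^sup>2 = y\<^sup>2 * (2 * (1 / (\<bar>t\<bar> + r)))"
    using r by (simp add: square_root_map_def power_mult_distrib powr_half_sqrt r_def)
  have "sgn t * (r - \<bar>t\<bar>) * (\<bar>t\<bar> + r) = 4 * y\<^sup>2"
  proof -
    have "(r - \<bar>t\<bar>) * (\<bar>t\<bar> + r) = r\<^sup>2 - t\<^sup>2" by (simp add: algebra_simps power2_eq_square)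
    also have "\<dots> = 4 * sgn t * y\<^sup>2" using r0 by simp
    finally have "sgn t * (r - \<bar>t\<bar>) * (\<bar>t\<bar> + r) = sgn t * (4 * sgn t * y\<^sup>2)" by (simp only: mult.assoc)
    also have "\<dots> = (sgn t * sgn t) * (4 * y\<^sup>2)" by (simp only: mult_ac)
    also have "sgn t * sgn t = 1" using \<open>t \<noteq> 0\<close> by (simp add: sgn_if)
    finally show ?thesis by simp
  qed
  then have "4 * y\<^sup>2 / (\<bar>t\<bar> + r) = sgn t * (r - \<bar>t\<bar>)"
    using pos by (simp only: nonzero_divide_eq_eq less_imp_neq[THEN not_sym] not_False_eq_True)
  then show ?thesis unfolding sq r_def[symmetric] by simp
qed

lemma kdiff_square_root_map:
  assumes "t \<noteq> 0"
  shows "kdiff k {y. 0 < t\<^sup>2 + 4 * sgn t * y\<^sup>2} (square_root_map t)"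
proof -
  let ?S = "{y. 0 < t\<^sup>2 + 4 * sgn t * y\<^sup>2}"
  have 1: "kdiff k ?S (\<lambda>y. t\<^sup>2 + 4 * sgn t * y\<^sup>2)" for k
    unfolding power2_eq_square[of "_ :: real"]
    by (intro kdiff_add kdiff_mult kdiff_const kdiff_ident)
  have 2: "kdiff k ?S (\<lambda>y. (t\<^sup>2 + 4 * sgn t * y\<^sup>2) powr (1 / 2))" for k
    by (rule kdiff_compose[OF _ kdiff_powr 1]) simp
  have "kdiff k ?S (\<lambda>y. (\<bar>t\<bar> + (t\<^sup>2 + 4 * sgn t * y\<^sup>2) powr (1 / 2)) powr (- (1 / 2)))" for k
    by (rule kdiff_compose[OF _ kdiff_powr kdiff_add[OF kdiff_const 2]]) (use assms in \<open>simp add: add_pos_nonneg\<close>)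
  then show ?thesis unfolding square_root_map_def[abs_def]
    by (intro kdiff_mult kdiff_const kdiff_ident)
qed

lemma square_root_map_derivative_0:
  assumes "t \<noteq> 0"
  shows "\<exists>d>0. (square_root_map t has_real_derivative d) (at 0)"
proof -
  let ?k = "\<lambda>y. sqrt 2 * (\<bar>t\<bar> + (t\<^sup>2 + 4 * sgn t * y\<^sup>2) powr (1 / 2)) powr (- (1 / 2))"
  have "\<exists>d. (?k has_real_derivative d) (at 0)"
    by (rule exI) (use assms in \<open>auto intro!: derivative_eq_intros simp: add_pos_pos\<close>)
  then obtain d where "(?k has_real_derivative d) (at 0)" by blast
  from DERIV_mult[OF DERIV_ident this] have "(square_root_map t has_real_derivative ?k 0) (at 0)"
    unfolding square_root_map_def[abs_def] by simp
  moreover have "?k 0 > 0" using assms by (simp add: add_pos_nonneg)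
  ultimately show ?thesis by blast
qed

text \<open>For t < 0 the bound 2 X^2 < -t keeps X on the increasing branch of x^2 (|t| - x^2). The
  discriminant at the endpoint is the square of |t| + 2 sgn t X^2; positivity of this number selects
  the right root, so that \<open>square_root_map\<close> takes the endpoint to X.\<close>

lemma osc_phase_quadratic:
  fixes \<phi> :: "real ^ 3 \<Rightarrow> real"
  assumes t: "t \<noteq> 0" and X: "0 \<le> X'" "X' < X" and neg: "t < 0 \<Longrightarrow> 2 * X\<^sup>2 < - t"
    and d: "(square_root_map t has_real_derivative d) (at 0)"
    and \<phi>: "test_function UNIV \<phi>" "\<And>p. \<phi> p \<noteq> 0 \<Longrightarrow> \<bar>p $ 1\<bar> \<le> X'"
  shows "osc_phase t (sgn t) 2 X' X (sqrt (sgn t * (X ^ 4 + t * X\<^sup>2))) (square_root_map t) d {y. 0 < t\<^sup>2 + 4 * sgn t * y\<^sup>2} \<phi>"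
proof -
  let ?S = "{y. 0 < t\<^sup>2 + 4 * sgn t * y\<^sup>2}" and ?q = "\<lambda>x. sgn t * (x ^ 4 + t * x\<^sup>2)"
  let ?B = "sqrt (?q X)"
  have sg: "sgn t = 1 \<or> sgn t = -1" "sgn t * sgn t = 1" "sgn t * t = \<bar>t\<bar>" "sgn t * \<bar>t\<bar> = t" using t by (auto simp: sgn_if)
  have qn: "0 \<le> ?q x" if "\<bar>x\<bar> \<le> X" for x
  proof (cases "t > 0")
    case False
    then have "t < 0" using t by simp
    have "x\<^sup>2 \<le> X\<^sup>2" using that by (metis abs_le_square_iff abs_of_nonneg order.trans X less_imp_le)
    then have "0 \<le> - t - x\<^sup>2" using neg[OF \<open>t < 0\<close>] zero_le_power2[of X] by linarith
    then have "0 \<le> x\<^sup>2 * (- t - x\<^sup>2)" by (intro mult_nonneg_nonneg) auto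
    also have "\<dots> = ?q x" using \<open>t < 0\<close> by (simp add: algebra_simps power4_eq_xxxx power2_eq_square)
    finally show ?thesis .
  qed simp
  have qX: "0 \<le> ?q X" using qn[of X] X by simp
  have disc: "t\<^sup>2 + 4 * sgn t * ?q X = (\<bar>t\<bar> + 2 * sgn t * X\<^sup>2)\<^sup>2"
    using sg by (auto simp: power2_eq_square power4_eq_xxxx algebra_simps)
  have rpos: "0 < \<bar>t\<bar> + 2 * sgn t * X\<^sup>2"
    using neg t by (cases "t > 0") (auto intro: add_pos_nonneg)
  have B2: "?B\<^sup>2 = ?q X" using qX by simp
  have sub: "{0..?B} \<subseteq> ?S"
  proof
    fix y assume y: "y \<in> {0..?B}"
    show "y \<in> ?S"
    proof (cases "t > 0")
      case True then show ?thesis by (simp add: add_pos_nonneg)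
    next
      case False
      have "y\<^sup>2 \<le> ?B\<^sup>2" using y by (intro power_mono) auto
      then have l: "t\<^sup>2 + 4 * sgn t * ?q X \<le> t\<^sup>2 + 4 * sgn t * y\<^sup>2"
        using False t unfolding B2 by simp
      have "0 < t\<^sup>2 + 4 * sgn t * ?q X" unfolding disc using rpos by simp
      from less_le_trans[OF this l] show ?thesis by (simp only: mem_Collect_eq)
    qed
  qed
  have hB: "square_root_map t ?B = X"
  proof -
    have "(square_root_map t ?B)\<^sup>2 = sgn t * (sqrt (t\<^sup>2 + 4 * sgn t * ?B\<^sup>2) - \<bar>t\<bar>) / 2"
      by (rule square_root_map_square[OF t]) (unfold B2 disc, simp)
    also have "sqrt (t\<^sup>2 + 4 * sgn t * ?B\<^sup>2) = \<bar>t\<bar> + 2 * sgn t * X\<^sup>2"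
      unfolding B2 disc using rpos by simp
    also have "sgn t * (\<bar>t\<bar> + 2 * sgn t * X\<^sup>2 - \<bar>t\<bar>) / 2 = X\<^sup>2"
      using sg by (auto simp: mult.assoc[symmetric])
    finally have "(square_root_map t ?B)\<^sup>2 = X\<^sup>2" .
    moreover have "0 \<le> square_root_map t ?B" using qX by (simp add: square_root_map_def)
    ultimately show ?thesis using X by (simp add: power2_eq_iff_nonneg)
  qed
  have hq: "sgn t * (square_root_map t y ^ 4 + t * (square_root_map t y)\<^sup>2) = y ^ 2" if "0 \<le> y" "y \<le> ?B" for y
  proof -
    have yS: "0 < t\<^sup>2 + 4 * sgn t * y\<^sup>2" using sub that by auto
    define r where "r = sqrt (t\<^sup>2 + 4 * sgn t * y\<^sup>2)"
    have r2: "r\<^sup>2 = t\<^sup>2 + 4 * sgn t * y\<^sup>2" using yS by (simp add: r_def)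
    define u where "u = (square_root_map t y)\<^sup>2"
    have u: "u = sgn t * (r - \<bar>t\<bar>) / 2" using square_root_map_square[OF t less_imp_le[OF yS]] by (simp add: u_def r_def)
    have "square_root_map t y ^ 4 = u\<^sup>2" by (simp add: u_def power_mult[symmetric])
    then have "sgn t * (square_root_map t y ^ 4 + t * (square_root_map t y)\<^sup>2) = sgn t * (u\<^sup>2 + t * u)" by (simp add: u_def)
    also have "\<dots> = sgn t * (u * (u + t))" by (simp add: power2_eq_square algebra_simps)
    also have "u + t = sgn t * (r + \<bar>t\<bar>) / 2" unfolding u using sg by (simp add: field_simps)
    also have "sgn t * (u * (sgn t * (r + \<bar>t\<bar>) / 2)) = (sgn t * sgn t) * (sgn t * ((r - \<bar>t\<bar>) * (r + \<bar>t\<bar>))) / 4"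
      unfolding u by (simp add: field_simps)
    also have "(r - \<bar>t\<bar>) * (r + \<bar>t\<bar>) = 4 * sgn t * y\<^sup>2"
      using r2 by (simp add: algebra_simps power2_eq_square)
    also have "(sgn t * sgn t) * (sgn t * (4 * sgn t * y\<^sup>2)) / 4 = y\<^sup>2" using sg by (auto)
    finally show ?thesis .
  qed
  show ?thesis
  proof
    show "open ?S" by (intro open_Collect_less continuous_intros)
  qed (use sg X qn sub kdiff_square_root_map[OF t] hB d hq \<phi> qX in \<open>auto simp: square_root_map_def\<close>)
qed

lemma osc_phase_quartic:
  fixes \<phi> :: "real ^ 3 \<Rightarrow> real"
  assumes X: "0 \<le> X'" "X' < X"
    and \<phi>: "test_function UNIV \<phi>" "\<And>p. \<phi> p \<noteq> 0 \<Longrightarrow> \<bar>p $ 1\<bar> \<le> X'"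
  shows "osc_phase 0 1 4 X' X X (\<lambda>y. y) 1 UNIV \<phi>"
  by unfold_locales (use X \<phi> in \<open>auto intro: kdiff_ident\<close>)

text \<open>A compact support in an open strip leaves a gap, which makes room for the X strictly
  between X' and the edge.\<close>

lemma support_strip:
  fixes \<phi> :: "real ^ 3 \<Rightarrow> real"
  assumes "test_function {p. \<bar>p $ 1\<bar> < X0} \<phi>" "0 < X0"
  shows "\<exists>X'. 0 \<le> X' \<and> X' < X0 \<and> (\<forall>p. \<phi> p \<noteq> 0 \<longrightarrow> \<bar>p $ 1\<bar> \<le> X')"
proof (cases "closure {p. \<phi> p \<noteq> 0} = {}")
  case True
  then show ?thesis using assms(2) by (intro exI[of _ 0]) auto
next
  case False
  let ?K = "closure {p. \<phi> p \<noteq> 0}"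
  have K: "compact ?K" "?K \<subseteq> {p. \<bar>p $ 1\<bar> < X0}" using assms(1) by (auto simp: test_function_def)
  have "continuous_on ?K (\<lambda>p. \<bar>p $ 1\<bar>)" by (intro continuous_intros)
  from continuous_attains_sup[OF K(1) False this]
  obtain p :: "real ^ 3" where p: "p \<in> ?K" "\<forall>p'::real^3\<in>?K. \<bar>p' $ 1\<bar> \<le> \<bar>p $ 1\<bar>" by blast
  show ?thesis
  proof (intro exI[of _ "\<bar>p $ 1\<bar>"] conjI allI impI)
    show "\<bar>p $ 1\<bar> < X0" using p(1) K(2) by auto
    fix p' assume "\<phi> p' \<noteq> 0"
    then have "p' \<in> ?K" using closure_subset[of "{p. \<phi> p \<noteq> 0}"] by auto
    then show "\<bar>p' $ 1\<bar> \<le> \<bar>p $ 1\<bar>" using p(2) by blast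
  qed simp
qed

lemma test_function_mono: "test_function V \<phi> \<Longrightarrow> V \<subseteq> W \<Longrightarrow> test_function W \<phi>"
  unfolding test_function_def by blast

lemma support_bounded:
  fixes \<phi> :: "real ^ 3 \<Rightarrow> real"
  assumes "test_function UNIV \<phi>"
  shows "\<exists>X'\<ge>0. \<forall>p. \<phi> p \<noteq> 0 \<longrightarrow> \<bar>p $ 1\<bar> \<le> X'"
proof -
  have "bounded (closure {p. \<phi> p \<noteq> 0})" using assms by (simp add: test_function_def compact_imp_bounded)
  then obtain R where R: "\<forall>p\<in>closure {p. \<phi> p \<noteq> 0}. norm p \<le> R" unfolding bounded_iff by blast
  have "\<bar>p $ 1\<bar> \<le> max 0 R" if "\<phi> p \<noteq> 0" for p :: "real ^ 3"
  proof -
    have "p \<in> closure {p. \<phi> p \<noteq> 0}" using that closure_subset[of "{p. \<phi> p \<noteq> 0}"] by auto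
    from bspec[OF R this] show ?thesis using component_le_norm_cart[of p 1] by linarith
  qed
  then show ?thesis by (intro exI[of _ "max 0 R"]) auto
qed

section \<open>The three signs of t\<close>

lemma osc_index_positive:
  assumes t: "t > 0" shows "Vt t has_oscillation_index (3/4)"
proof (rule osc_index_if_expansion[where U = UNIV])
  obtain d where d: "d > 0" "(square_root_map t has_real_derivative d) (at 0)"
    using square_root_map_derivative_0[of t] t by auto
  fix \<phi> :: "real ^ 3 \<Rightarrow> real" assume \<phi>: "test_function UNIV \<phi>"
  obtain X' where X': "0 \<le> X'" "\<And>p. \<phi> p \<noteq> 0 \<Longrightarrow> \<bar>p $ 1\<bar> \<le> X'" using support_bounded[OF \<phi>] by blast
  \<comment> \<open>Any X beyond X' would serve, as x^4 + t x^2 is nonnegative and increasing for x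
    \<ge> 0.\<close>
  interpret osc_phase t "sgn t" 2 X' "X' + 1" "sqrt (sgn t * ((X' + 1) ^ 4 + t * (X' + 1)\<^sup>2))" "square_root_map t" d
    "{y. 0 < t\<^sup>2 + 4 * sgn t * y\<^sup>2}" \<phi>
    by (rule osc_phase_quadratic) (use t X' d \<phi> in auto)
  let ?c0 = "power_chain 2 (Suc 0) (Suc 0) 0 * complex_of_real (2 * \<phi> 0 * measure direction_measure UNIV * d)"
  show "\<exists>c0. ((\<forall>x. 0 \<le> \<phi> x) \<longrightarrow> 0 < \<phi> 0 \<longrightarrow> c0 \<noteq> 0) \<and>
     (\<forall>N. \<exists>c. c 0 = c0 \<and> is_expansion (3/4) N (osc_integral (Vt t) \<phi>) c)"
  proof (intro exI[of _ ?c0] conjI impI allI)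
    show "?c0 \<noteq> 0" if "0 < \<phi> 0"
      using that d(1) measure_direction_measure_pos power_chain_nonzero[of 2] by simp
    \<comment> \<open>Here (j + 1) / 2 + (i + 1) / 4 = 3/4 + (4 j + 2 i) / 8.\<close>
    show "\<exists>c. c 0 = ?c0 \<and> is_expansion (3/4) N (osc_integral (Vt t) \<phi>) c" for N
      by (rule expansion_definite[where e = "\<lambda>j i. 4 * j + 2 * i"]) (use t in \<open>auto simp: field_simps\<close>)
  qed
qed auto

lemma osc_index_zero: "Vt 0 has_oscillation_index (5/8)"
proof (rule osc_index_if_expansion[where U = UNIV])
  fix \<phi> :: "real ^ 3 \<Rightarrow> real" assume \<phi>: "test_function UNIV \<phi>"
  obtain X' where X': "0 \<le> X'" "\<And>p. \<phi> p \<noteq> 0 \<Longrightarrow> \<bar>p $ 1\<bar> \<le> X'" using support_bounded[OF \<phi>] by blast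
  interpret osc_phase 0 1 4 X' "X' + 1" "X' + 1" "\<lambda>y. y" 1 UNIV \<phi>
    by (rule osc_phase_quartic) (use X' \<phi> in auto)
  let ?c0 = "power_chain 4 (Suc 0) (Suc 0) 0 * complex_of_real (2 * \<phi> 0 * measure direction_measure UNIV * 1)"
  show "\<exists>c0. ((\<forall>x. 0 \<le> \<phi> x) \<longrightarrow> 0 < \<phi> 0 \<longrightarrow> c0 \<noteq> 0) \<and>
     (\<forall>N. \<exists>c. c 0 = c0 \<and> is_expansion (5/8) N (osc_integral (Vt 0) \<phi>) c)"
  proof (intro exI[of _ ?c0] conjI impI allI)
    show "?c0 \<noteq> 0" if "0 < \<phi> 0"
      using that measure_direction_measure_pos power_chain_nonzero[of 4] by simp
    \<comment> \<open>Here (j + 1) / 2 + (i + 1) / 8 = 5/8 + (4 j + i) / 8.\<close>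
    show "\<exists>c. c 0 = ?c0 \<and> is_expansion (5/8) N (osc_integral (Vt 0) \<phi>) c" for N
      by (rule expansion_definite[where e = "\<lambda>j i. 4 * j + i"]) (auto simp: field_simps)
  qed
qed auto

lemma osc_index_negative:
  assumes t: "t < 0" shows "Vt t has_oscillation_index (1/2)"
proof -
  obtain d where d: "d > 0" "(square_root_map t has_real_derivative d) (at 0)"
    using square_root_map_derivative_0[of t] t by auto
  \<comment> \<open>The point where x^2 (|t| - x^2) attains its maximum, so the straightening is
    possible exactly up to it.\<close>
  define X0 where "X0 = sqrt (- t / 2)"
  have X0: "0 < X0" "2 * X0\<^sup>2 = - t" using t by (auto simp: X0_def)
  let ?U = "{p::real^3. \<bar>p $ 1\<bar> < X0}"
  show ?thesis
  proof (rule osc_index_if_expansion[where U = ?U])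
    show "open ?U" by (intro open_Collect_less continuous_intros)
    fix \<phi> assume \<phi>: "test_function ?U \<phi>"
    have \<phi>': "test_function UNIV \<phi>" by (rule test_function_mono[OF \<phi>]) simp
    obtain X' where X': "0 \<le> X'" "X' < X0" "\<And>p. \<phi> p \<noteq> 0 \<Longrightarrow> \<bar>p $ 1\<bar> \<le> X'" using support_strip[OF \<phi> X0(1)] by blast
    define X where "X = (X' + X0) / 2"
    have X: "0 \<le> X" "X' < X" "X < X0" using X' by (auto simp: X_def)
    have "2 * X\<^sup>2 < - t" using power_strict_mono[OF X(3,1), of 2] X0(2) by simp
    then interpret osc_phase t "sgn t" 2 X' X "sqrt (sgn t * (X ^ 4 + t * X\<^sup>2))" "square_root_map t" d
      "{y. 0 < t\<^sup>2 + 4 * sgn t * y\<^sup>2}" \<phi>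
      by (intro osc_phase_quadratic) (use t X X' d \<phi>' in auto)
    let ?c0 = "- fres (Suc 0) 0 * of_real (cone_mean 0)"
    show "\<exists>c0. ((\<forall>x. 0 \<le> \<phi> x) \<longrightarrow> 0 < \<phi> 0 \<longrightarrow> c0 \<noteq> 0) \<and>
       (\<forall>N. \<exists>c. c 0 = c0 \<and> is_expansion (1/2) N (osc_integral (Vt t) \<phi>) c)"
    proof (intro exI[of _ ?c0] conjI impI allI)
      show "?c0 \<noteq> 0" if "\<forall>x. 0 \<le> \<phi> x" "0 < \<phi> 0"
        using cone_mean_0_nonzero that fres_1_nonzero by simp
      show "\<exists>c. c 0 = ?c0 \<and> is_expansion (1/2) N (osc_integral (Vt t) \<phi>) c" for N
        by (rule expansion_indefinite) (use t in auto)
    qed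
  qed (use X0 in auto)
qed

theorem theorem1p8:
  shows "(\<forall>t>0. Vt t has_oscillation_index (3/4)) \<and>
         Vt 0 has_oscillation_index (5/8) \<and>
         (\<forall>t<0. Vt t has_oscillation_index (1/2))"
  using osc_index_positive osc_index_zero osc_index_negative by blast

end
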